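(* Let $\beta>1$ and $C>0$. There exist constants $K_1=K_1(C,\beta)>0$ and $T_0=T_0(C,\beta)>0$ such that for every $d\ge 1$, every potential $U$ on $\mathbf{R}^d\times\mathbf{R}$ such that $U(\cdot,t)$ is $C^1$ for every $t$ and $$0\le U(x,t)\le C,\qquad |\nabla U(x,t)|\le C\qquad\text{for all }x\in\mathbf{R}^d,\ t\in\mathbf{R},$$ every interval $[t_1,t_2]$ with $T:=t_2-t_1\ge T_0$, every $x\in\mathbf{R}^d$ and every minimizer $\gamma^x_{t_1,t_2}$, $$|\dot\gamma^x_{t_1,t_2}(t_2)|\le K_1(\log T)^{2/\beta}.$$
   Context: $\nabla$ denotes the gradient with respect to $x\in\mathbf{R}^d$; $U$ is assumed measurable in $(x,t)$ so that the action is defined. For $t_1<t_2$ and an absolutely continuous curve $\gamma:[t_1,t_2]\to\mathbf{R}^d$, the action is $$A_{t_1,t_2}[\gamma]=\int_{t_1}^{t_2}\Bigl(\tfrac1\beta|\dot\gamma(s)|^\beta-U(\gamma(s),s)\Bigr)ds .$$ For $x\in\mathbf{R}^d$, $\gamma^x_{t_1,t_2}:[t_1,t_2]\to\mathbf{R}^d$ denotes a (not necessarily unique) minimizer of $A_{t_1,t_2}$ among all absolutely continuous curves $\gamma$ on $[t_1,t_2]$ with $\gamma(t_2)=x$ (the initial point $\gamma(t_1)$ being free). Such minimizers are $C^1$ curves satisfying the Euler--Lagrange equation $\frac{d}{dt}(\dot\gamma|\dot\gamma|^{\beta-2})=-\nabla U(\gamma(t),t)$ (in integrated form if $U$ is merely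 measurable in $t$) and $\dot\gamma^x_{t_1,t_2}(t_1)=0$. *)

theory Defs
  imports "HOL-Analysis.Analysis"
begin

text \<open>
  The dimension \<open>d\<close> has to be quantified inside the main statement (the constants there do not
  depend on it), so it cannot be the cardinality of an index type. Points of the \<open>d\<close>-dimensional
  space are therefore functions on \<open>{..<d}\<close>, extended by \<^const>\<open>undefined\<close>. This carrier is both
  the topological space \<^term>\<open>powertop_real {..<d}\<close> and the space of the product measure
  \<^term>\<open>PiM {..<d} (\<lambda>_. lborel)\<close>; the Euclidean norm of \<open>x\<close> is \<^term>\<open>L2_set x {..<d}\<close>.
\<close>

abbreviation Rn :: "nat \<Rightarrow> (nat \<Rightarrow> real) set" where
  "Rn d \<equiv> {..<d} \<rightarrow>\<^sub>E UNIV"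

text \<open>Frechet differentiability at \<open>x\<close>, the derivative being represented by the vector \<open>g\<close>.\<close>

definition has_gradient ::
  "nat \<Rightarrow> ((nat \<Rightarrow> real) \<Rightarrow> real) \<Rightarrow> (nat \<Rightarrow> real) \<Rightarrow> (nat \<Rightarrow> real) \<Rightarrow> bool" where
  "has_gradient d f g x \<longleftrightarrow>
     (\<forall>\<epsilon>>0. \<exists>\<delta>>0. \<forall>y\<in>Rn d. L2_set (\<lambda>i. y i - x i) {..<d} < \<delta> \<longrightarrow>
        \<bar>f y - f x - (\<Sum>i<d. g i * (y i - x i))\<bar> \<le> \<epsilon> * L2_set (\<lambda>i. y i - x i) {..<d})"

definition C1_with_gradient ::
  "nat \<Rightarrow> ((nat \<Rightarrow> real) \<Rightarrow> real) \<Rightarrow> ((nat \<Rightarrow> real) \<Rightarrow> nat \<Rightarrow> real) \<Rightarrow> bool" where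
  "C1_with_gradient d f G \<longleftrightarrow>
     (\<forall>x\<in>Rn d. has_gradient d f (G x) x) \<and>
     (\<forall>i<d. continuous_map (powertop_real {..<d}) euclideanreal (\<lambda>x. G x i))"

definition lebesgue_measurable_potential ::
  "nat \<Rightarrow> ((nat \<Rightarrow> real) \<Rightarrow> real \<Rightarrow> real) \<Rightarrow> bool" where
  "lebesgue_measurable_potential d U \<longleftrightarrow>
     (\<lambda>(x, t). U x t) \<in> borel_measurable (completion (PiM {..<d} (\<lambda>_. lborel) \<Otimes>\<^sub>M lborel))"

text \<open>
  A finite family of pairwise disjoint nonempty open intervals is represented by the set of
  its pairs of endpoints.
\<close>

definition abs_continuous_curve :: "nat \<Rightarrow> real \<Rightarrow> real \<Rightarrow> (real \<Rightarrow> nat \<Rightarrow> real) \<Rightarrow> bool" where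
  "abs_continuous_curve d t1 t2 \<gamma> \<longleftrightarrow>
     \<gamma> \<in> {t1..t2} \<rightarrow> Rn d \<and>
     (\<forall>\<epsilon>>0. \<exists>\<delta>>0. \<forall>P. finite P \<longrightarrow>
        (\<forall>(a, b)\<in>P. t1 \<le> a \<and> a < b \<and> b \<le> t2) \<longrightarrow>
        pairwise (\<lambda>p q. disjnt {fst p<..<snd p} {fst q<..<snd q}) P \<longrightarrow>
        (\<Sum>(a, b)\<in>P. b - a) < \<delta> \<longrightarrow>
        (\<Sum>(a, b)\<in>P. L2_set (\<lambda>i. \<gamma> b i - \<gamma> a i) {..<d}) < \<epsilon>)"

text \<open>
  Derivatives are taken within \<open>{t1..t2}\<close>, hence one-sided at the endpoints. An absolutely
  continuous curve is differentiable almost everywhere, so the unspecified value of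
  \<^const>\<open>vector_derivative\<close> at the other times does not affect the action.
\<close>

definition curve_velocity :: "real \<Rightarrow> real \<Rightarrow> (real \<Rightarrow> nat \<Rightarrow> real) \<Rightarrow> real \<Rightarrow> nat \<Rightarrow> real" where
  "curve_velocity t1 t2 \<gamma> s i = vector_derivative (\<lambda>r. \<gamma> r i) (at s within {t1..t2})"

text \<open>
  The kinetic part of an absolutely continuous curve may be infinite. The action is therefore
  extended-real valued, with the integral split into its kinetic and potential parts; for the
  bounded measurable potentials considered here the potential part is finite.
\<close>

definition action ::
  "nat \<Rightarrow> real \<Rightarrow> ((nat \<Rightarrow> real) \<Rightarrow> real \<Rightarrow> real) \<Rightarrow> real \<Rightarrow> real \<Rightarrow> (real \<Rightarrow> nat \<Rightarrow> real) \<Rightarrow> ereal" where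
  "action d \<beta> U t1 t2 \<gamma> =
     enn2ereal (\<integral>\<^sup>+s\<in>{t1..t2}. ennreal (1 / \<beta> * L2_set (curve_velocity t1 t2 \<gamma> s) {..<d} powr \<beta>) \<partial>lebesgue)
     - ereal (LINT s:{t1..t2}|lebesgue. U (\<gamma> s) s)"

definition is_minimizer ::
  "nat \<Rightarrow> real \<Rightarrow> ((nat \<Rightarrow> real) \<Rightarrow> real \<Rightarrow> real) \<Rightarrow> real \<Rightarrow> real \<Rightarrow> (nat \<Rightarrow> real) \<Rightarrow>
   (real \<Rightarrow> nat \<Rightarrow> real) \<Rightarrow> bool" where
  "is_minimizer d \<beta> U t1 t2 x \<gamma> \<longleftrightarrow>
     abs_continuous_curve d t1 t2 \<gamma> \<and> \<gamma> t2 = x \<and>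
     (\<forall>\<eta>. abs_continuous_curve d t1 t2 \<eta> \<and> \<eta> t2 = x \<longrightarrow>
        action d \<beta> U t1 t2 \<gamma> \<le> action d \<beta> U t1 t2 \<eta>)"

end

theory Submission
  imports Defs
begin

text \<open>
  The Euler--Lagrange equation is not needed. Let \<open>c(\<tau>)\<close> be the mean velocity of the minimizer on
  \<open>[t2 - \<tau>, t2]\<close>. Comparing the minimizer with the curve that follows it up to \<open>t2 - \<tau>\<close> and then
  moves uniformly to \<open>x\<close>, and using Jensen's inequality on two subintervals, one bounds the defect of
  convexity of \<open>|v|^\<beta>\<close> between the scales \<open>\<tau>\<close> and \<open>\<tau>'\<close> with \<open>\<tau>/2 \<le> \<tau>' < \<tau>\<close>: it is at most a
  constant, because \<open>U\<close> is bounded, and at most a multiple of \<open>\<tau> (1 + |c(\<tau>)|^\<beta>)\<close>, because \<open>U\<close> is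
  Lipschitz. The defect dominates the squared increment of \<open>V(c)\<close>, where \<open>V(v) = |v|^(\<beta>/2 - 1) v\<close>.
  Since \<open>|c(T)|^\<beta> \<le> \<beta> C\<close> (compare with a constant curve), after about \<open>log T\<close> halvings of \<open>\<tau>\<close>
  from \<open>T\<close> to \<open>1\<close> the norm of \<open>V(c)\<close>, which is \<open>|c|^(\<beta>/2)\<close>, is \<open>O(log T)\<close>; below \<open>1\<close> the increments
  decay geometrically, so \<open>V(c(\<tau>))\<close> converges as \<open>\<tau> \<longrightarrow> 0\<close>. Its limit determines the final velocity.
  Since the action only involves the derivative of a curve, Lebesgue's theorem that absolutely
  continuous functions are differentiable almost everywhere is needed along the way.
\<close>

text \<open>The function |v|^\<beta> is not uniformly convex in v: its Hessian degenerates at 0 for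
  \<beta> > 2 and at infinity for \<beta> < 2. Measured through V, the defect is bounded below
  quadratically with a constant depending only on \<beta>. A bounded defect thus gives bounded
  increments of V(c), and the exponent 2/\<beta> is just the inversion of |V(v)| = |v|^(\<beta>/2).
  Boundedness of U alone would allow infinitely many bounded increments as \<tau> tends to 0. The
  Lipschitz bound supplies a factor sqrt \<tau> for an increment, but also a factor 1 + |V(c)|, so
  the sum below scale 1 is closed by a discrete Gronwall estimate, which costs a constant factor.
  Two obstacles precede this. The kinetic energy of a minimizer must first be shown finite, since
  the action is extended-real valued. And the graph of a curve is a null set in space-time, so joint
  Lebesgue measurability of U says nothing directly about U along a curve; continuity in space has
  to help.\<close>

hide_const (open) Polynomial.content

section \<open>Absolutely continuous functions of one variable\<close>

definition increment :: "(real \<Rightarrow> real) \<Rightarrow> real set \<Rightarrow> real" where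
  "increment f K = f (Sup K) - f (Inf K)"

text \<open>The intervals need not be disjoint, only non-overlapping, and may be degenerate, so that the
  predicate applies directly to divisions.\<close>

definition abs_cont :: "real \<Rightarrow> real \<Rightarrow> (real \<Rightarrow> real) \<Rightarrow> bool" where
  "abs_cont a b f \<longleftrightarrow> (\<forall>\<epsilon>>0. \<exists>\<delta>>0. \<forall>D. D division_of \<Union>D \<longrightarrow> \<Union>D \<subseteq> {a..b} \<longrightarrow>
     sum content D < \<delta> \<longrightarrow> (\<Sum>K\<in>D. \<bar>increment f K\<bar>) < \<epsilon>)"

lemma abs_contD:
  assumes "abs_cont a b f" "\<epsilon> > 0"
  obtains \<delta> where "\<delta> > 0"
    "\<And>D. D division_of \<Union>D \<Longrightarrow> \<Union>D \<subseteq> {a..b} \<Longrightarrow> sum content D < \<delta> \<Longrightarrow>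
      (\<Sum>K\<in>D. \<bar>increment f K\<bar>) < \<epsilon>"
  using assms unfolding abs_cont_def by meson

text \<open>The Vitali theorem for balls gives a countable disjoint family covering \<open>S\<close>
  up to a null set. Because \<open>V\<close> has finite measure, a finite subfamily \<open>D\<close>
  already carries all but \<open>e\<close> of the measure. \<open>R\<close> collects the null
  leftover and the discarded intervals, so it is measurable although \<open>S\<close> need not
  be.\<close>

lemma Vitali_covering_intervals:
  fixes S V :: "real set"
  assumes "V \<in> lmeasurable" "e > 0"
    and cover: "\<And>x d. x \<in> S \<Longrightarrow> d > 0 \<Longrightarrow>
      \<exists>u v. u < v \<and> v - u < d \<and> x \<in> {u..v} \<and> {u..v} \<subseteq> V \<and> Q u v"
  obtains D R where "finite D" "pairwise disjnt D"
    "\<And>K. K \<in> D \<Longrightarrow> \<exists>u v. u < v \<and> K = {u..v} \<and> {u..v} \<subseteq> V \<and> Q u v"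
    "R \<in> lmeasurable" "measure lebesgue R < e" "S \<subseteq> \<Union>D \<union> R"
proof -
  define I where "I = {(u, v). u < v \<and> {u..v} \<subseteq> V \<and> Q u v}"
  define c where "c = (\<lambda>(u, v). (u + v) / 2 :: real)"
  define r where "r = (\<lambda>(u, v). (v - u) / 2 :: real)"
  have ball: "cball (c p) (r p) = {fst p..snd p}" for p
    by (cases p) (auto simp: c_def r_def cball_eq_atLeastAtMost field_simps)
  obtain C where C: "countable C" "C \<subseteq> I"
    "pairwise (\<lambda>i j. disjnt (cball (c i) (r i)) (cball (c j) (r j))) C"
    "negligible (S - (\<Union>i\<in>C. cball (c i) (r i)))"
  proof (rule Vitali_covering_theorem_cballs[of I r S c])
    show "0 < r i" if "i \<in> I" for i
      using that by (auto simp: I_def r_def)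
    show "\<exists>i. i \<in> I \<and> x \<in> cball (c i) (r i) \<and> r i < d" if xd: "x \<in> S" "0 < d" for x d
    proof -
      obtain u v where uv: "u < v" "v - u < d" "x \<in> {u..v}" "{u..v} \<subseteq> V" "Q u v"
        using cover[OF xd] by blast
      then show ?thesis
        using ball[of "(u, v)"] by (intro exI[of _ "(u, v)"]) (simp add: I_def r_def)
    qed
  qed
  define C' where "C' = (\<lambda>p. {fst p..snd p}) ` C"
  have cnt: "countable C'" and dj: "pairwise disjnt C'" and neg: "negligible (S - \<Union>C')"
    using C(1,3,4) unfolding C'_def ball pairwise_image by (auto simp: pairwise_def)
  have C'I: "\<exists>u v. u < v \<and> K = {u..v} \<and> {u..v} \<subseteq> V \<and> Q u v" if KC: "K \<in> C'" for K
  proof -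
    obtain p where "p \<in> C" "K = {fst p..snd p}" using KC unfolding C'_def by (rule imageE)
    moreover then have "p \<in> I" using C(2) by blast
    ultimately show ?thesis by (auto simp: I_def)
  qed
  have C'm: "K \<in> lmeasurable" if "K \<in> C'" for K
    using C'I[OF that] by (metis lmeasurable_interval(1))
  have sub: "\<Union>C' \<subseteq> V"
    using C'I by blast
  obtain D where D: "D \<subseteq> C'" "finite D" "measure lebesgue (\<Union>C') - e < measure lebesgue (\<Union>D)"
  proof (rule measure_countable_Union_approachable[OF cnt \<open>e > 0\<close> C'm])
    show "measure lebesgue (\<Union>D) \<le> measure lebesgue V" if "D \<subseteq> C'" "finite D" for D
    proof (rule measure_mono_fmeasurable[OF _ _ assms(1)])
      show "\<Union>D \<subseteq> V" using that(1) sub by blast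
      show "\<Union>D \<in> sets lebesgue"
        using that C'm by (intro sets.finite_Union) (auto simp: subset_iff intro: fmeasurableD)
    qed
  qed auto
  have mC': "\<Union>C' \<in> lmeasurable"
  proof (rule fmeasurableI2[OF assms(1) sub])
    show "\<Union>C' \<in> sets lebesgue"
      using C'm by (intro sets.countable_Union cnt) (auto intro: fmeasurableD)
  qed
  have mD: "\<Union>D \<in> lmeasurable"
    using D(1,2) C'm by (intro fmeasurable.finite_Union) auto
  define R where "R = (S - \<Union>C') \<union> (\<Union>C' - \<Union>D)"
  have m1: "S - \<Union>C' \<in> lmeasurable" "measure lebesgue (S - \<Union>C') = 0"
    using neg negligible_iff_measure by blast+
  show thesis
  proof (rule that[of D R])
    show "pairwise disjnt D" using dj D(1) pairwise_subset by blast
    show "R \<in> lmeasurable" unfolding R_def using m1 mC' mD by blast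
    have "measure lebesgue R \<le> measure lebesgue (S - \<Union>C') + measure lebesgue (\<Union>C' - \<Union>D)"
      unfolding R_def using m1 mC' mD by (intro measure_Un_le) auto
    also have "measure lebesgue (\<Union>C' - \<Union>D) = measure lebesgue (\<Union>C') - measure lebesgue (\<Union>D)"
      using mC' mD D(1) by (intro measurable_measure_Diff) auto
    finally show "measure lebesgue R < e" using D(3) m1 by linarith
    show "S \<subseteq> \<Union>D \<union> R" unfolding R_def by blast
  qed (use D C'I in auto)
qed

section \<open>Divisions into intervals: measure and increments\<close>

lemma disjoint_intervals_division:
  fixes D :: "real set set"
  assumes "finite D" "pairwise disjnt D" "\<And>K. K \<in> D \<Longrightarrow> \<exists>u v. u < v \<and> K = {u..v} \<and> P u v"
  shows "D division_of \<Union>D"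
proof (rule division_ofI)
  show "K \<noteq> {}" "\<exists>a b. K = cbox a b" if "K \<in> D" for K
    using assms(3)[OF that] by auto
  show "interior K1 \<inter> interior K2 = {}" if "K1 \<in> D" "K2 \<in> D" "K1 \<noteq> K2" for K1 K2
    using assms(2) that unfolding pairwise_def disjnt_def
    by (metis interior_Int interior_empty)
qed (use assms in auto)

lemma measure_Union_division:
  assumes "D division_of \<Union>D"
  shows "\<Union>D \<in> lmeasurable" "measure lebesgue (\<Union>D) = sum content D"
proof -
  have box: "\<exists>a b. K = cbox a b" if "K \<in> D" for K
    using assms that by (auto simp: division_of_def)
  then have m: "K \<in> lmeasurable" if "K \<in> D" for K
    using that by fastforce
  have fin: "finite D" using assms by blast
  show "\<Union>D \<in> lmeasurable"
    using m fin by (intro fmeasurable.finite_Union) auto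
  have "measure lebesgue (\<Union>D) = (\<Sum>K\<in>D. measure lebesgue K)"
  proof (rule measure_negligible_finite_Union[OF fin m])
    show "pairwise (\<lambda>K L. negligible (K \<inter> L)) D"
    proof (clarsimp simp: pairwise_def)
      fix K L assume KL: "K \<in> D" "L \<in> D" "K \<noteq> L"
      have "interior (K \<inter> L) = {}"
        using assms KL by (auto simp: division_of_def)
      moreover have "convex (K \<inter> L)"
        using box KL by (metis convex_Int convex_box(1))
      ultimately show "negligible (K \<inter> L)"
        by (simp add: negligible_convex_interior)
    qed
  qed
  also have "\<dots> = sum content D"
  proof (rule sum.cong[OF refl])
    show "measure lebesgue K = content K" if "K \<in> D" for K
      using box[OF that] by auto
  qed
  finally show "measure lebesgue (\<Union>D) = sum content D" .
qed

text \<open>Tagging each interval by its left endpoint reduces this to the telescoping sum for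
  tagged divisions.\<close>

lemma increment_division:
  assumes "a \<le> b" "D division_of {a..b}"
  shows "(\<Sum>K\<in>D. increment f K) = f b - f a"
proof -
  define p where "p = (\<lambda>K. (Inf K, K)) ` D"
  have K: "Inf K \<in> K" if "K \<in> D" for K
    using that assms(2) by (metis atLeastatMost_empty_iff box_real(2) cInf_atLeastAtMost cbox_division_memE atLeastAtMost_iff order_refl)
  have "p tagged_division_of {a..b}"
  proof (rule tagged_division_ofI)
    show "finite p" using assms(2) by (auto simp: p_def)
    show "x \<in> K" "K \<subseteq> {a..b}" "\<exists>a b. K = cbox a b" if "(x, K) \<in> p" for x K
      using that K assms(2) by (auto simp: p_def division_of_def)
    show "interior K1 \<inter> interior K2 = {}" if "(x1, K1) \<in> p" "(x2, K2) \<in> p" "(x1, K1) \<noteq> (x2, K2)" for x1 x2 K1 K2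
    proof -
      have "K1 \<in> D" "K2 \<in> D" "K1 \<noteq> K2" using that by (auto simp: p_def)
      then show ?thesis using assms(2) by (simp add: division_of_def)
    qed
    have "{K. \<exists>x. (x, K) \<in> p} = D"
      by (auto simp: p_def)
    then show "\<Union>{K. \<exists>x. (x, K) \<in> p} = {a..b}"
      using assms(2) by (simp add: division_of_def)
  qed
  from additive_tagged_division_1[OF assms(1) this, of f] show ?thesis
    unfolding p_def by (subst (asm) sum.reindex) (auto simp: inj_on_def increment_def)
qed

text \<open>The last two assumptions say that \<open>\<alpha>\<close> is the outer measure of
  \<open>A\<close>, which need not be measurable. \<open>V\<close> arises from a near-optimal
  measurable superset, enlarged to an open set and then cut down to \<open>W\<close>.\<close>

lemma outer_open_lmeasurable:
  fixes A :: "real set"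
  assumes "A \<subseteq> W" "open W" "W \<in> lmeasurable" "e > 0"
    and "\<And>T. A \<subseteq> T \<Longrightarrow> T \<in> lmeasurable \<Longrightarrow> \<alpha> \<le> measure lebesgue T"
    and "\<And>e. e > 0 \<Longrightarrow> \<exists>T. A \<subseteq> T \<and> T \<in> lmeasurable \<and> measure lebesgue T < \<alpha> + e"
  obtains V where "A \<subseteq> V" "open V" "V \<subseteq> W" "V \<in> lmeasurable" "measure lebesgue V < \<alpha> + e"
proof -
  obtain T where T: "A \<subseteq> T" "T \<in> lmeasurable" "measure lebesgue T < \<alpha> + e / 2"
    using assms(6)[of "e/2"] assms(4) by auto
  obtain V where V: "open V" "T \<subseteq> V" "V - T \<in> lmeasurable" "emeasure lebesgue (V - T) < ennreal (e/2)"
    using sets_lebesgue_outer_open[of T "e/2"] T assms(4) by (auto intro: fmeasurableD)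
  have m: "measure lebesgue (V - T) < e / 2"
    using V(3,4) assms(4) by (simp add: emeasure_eq_measure2 ennreal_less_iff)
  have Vm: "V \<in> lmeasurable"
    using fmeasurable.Un[OF T(2) V(3)] V(2) by (simp add: Un_absorb1)
  have "measure lebesgue V \<le> measure lebesgue T + measure lebesgue (V - T)"
    using measure_Un_le[of T lebesgue "V - T"] fmeasurableD[OF T(2)] fmeasurableD[OF V(3)] V(2)
    by (simp add: Un_absorb1)
  then have V2: "measure lebesgue V < \<alpha> + e" using T m by linarith
  have "measure lebesgue (V \<inter> W) \<le> measure lebesgue V"
    using Vm by (intro measure_mono_fmeasurable fmeasurableD) (auto intro: fmeasurable.Int assms(3))
  then show thesis
  proof (intro that[of "V \<inter> W"])
    show "A \<subseteq> V \<inter> W" using T(1) V(2) assms(1) by blast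
    show "V \<inter> W \<in> lmeasurable" using Vm assms(3) by (rule fmeasurable.Int)
  qed (use V V2 assms(2) in auto)
qed

text \<open>Almost all of the set \<open>A\<close> is covered by disjoint intervals of slope \<open>> c\<close>, and again, inside
  these, by disjoint intervals of slope \<open>< -c\<close>. The gaps between the two families have small total
  length, but \<open>f\<close> has to increase over them by at least \<open>c\<close> times the measure of \<open>A\<close>. Since \<open>A\<close> is not
  known to be measurable, \<open>\<alpha>\<close> is its outer measure.\<close>

lemma abs_cont_oscillation_negligible:
  assumes f: "abs_cont a b f" and c: "c > 0"
  shows "negligible {x \<in> {a<..<b}. \<forall>d>0.
    (\<exists>u v. u < v \<and> v - u < d \<and> x \<in> {u..v} \<and> f v - f u > c * (v - u)) \<and>
    (\<exists>u v. u < v \<and> v - u < d \<and> x \<in> {u..v} \<and> f v - f u < - c * (v - u))}" (is "negligible ?A")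
proof -
  define M where "M = {measure lebesgue T | T. ?A \<subseteq> T \<and> T \<in> lmeasurable}"
  define \<alpha> where "\<alpha> = Inf M"
  have "measure lebesgue {a<..<b} \<in> M" 
    unfolding M_def by (intro CollectI exI[of _ "{a<..<b}"] conjI refl) auto
  then have Mne: "M \<noteq> {}" by auto
  have Mbdd: "bdd_below M" unfolding M_def by (rule bdd_belowI[of _ 0]) auto
  have \<alpha>le: "\<alpha> \<le> measure lebesgue T" if "?A \<subseteq> T" "T \<in> lmeasurable" for T
    unfolding \<alpha>_def using that Mbdd by (intro cInf_lower) (auto simp: M_def)
  have \<alpha>ex: "\<exists>T. ?A \<subseteq> T \<and> T \<in> lmeasurable \<and> measure lebesgue T < \<alpha> + e" if "e > 0" for e
  proof -
    have "Inf M < \<alpha> + e" using that by (simp add: \<alpha>_def)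
    then obtain m where "m \<in> M" "m < \<alpha> + e" using cInf_lessD[OF Mne] by blast
    then show ?thesis unfolding M_def by blast
  qed
  have "\<alpha> \<le> e" if e: "e > 0" for e
  proof -
    obtain \<delta> where \<delta>: "\<delta> > 0" and AC: "\<And>D. D division_of \<Union>D \<Longrightarrow> \<Union>D \<subseteq> {a..b} \<Longrightarrow>
        sum content D < \<delta> \<Longrightarrow> (\<Sum>K\<in>D. \<bar>increment f K\<bar>) < c * e / 2"
      using abs_contD[OF f, of "c * e / 2"] c e by (metis divide_pos_pos mult_pos_pos zero_less_numeral)
    \<comment> \<open>With this \<open>\<eta>\<close> the gaps between the two families have total
      length below 3 \<open>\<eta>\<close>, hence below \<open>\<delta>\<close>, and the final bound
      is \<open>\<alpha>\<close> < e/2 + \<open>\<eta>\<close>, hence below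
      \<open>e\<close>.\<close>
    define \<eta> where "\<eta> = min (\<delta> / 4) (e / 4)"
    have \<eta>: "\<eta> > 0" "4 * \<eta> \<le> \<delta>" "4 * \<eta> \<le> e" using \<delta> e by (auto simp: \<eta>_def)
    obtain V where V: "?A \<subseteq> V" "open V" "V \<subseteq> {a<..<b}" "V \<in> lmeasurable" "measure lebesgue V < \<alpha> + \<eta>"
      by (rule outer_open_lmeasurable[of ?A "{a<..<b}" \<eta> \<alpha>]) (use \<alpha>le \<alpha>ex \<eta> in auto)
    obtain D1 R1 where D1: "finite D1" "pairwise disjnt D1"
        "\<And>K. K \<in> D1 \<Longrightarrow> \<exists>u v. u < v \<and> K = {u..v} \<and> {u..v} \<subseteq> V \<and> f v - f u > c * (v - u)"
        and R1: "R1 \<in> lmeasurable" "measure lebesgue R1 < \<eta>" "?A \<subseteq> \<Union>D1 \<union> R1"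
    proof (rule Vitali_covering_intervals[OF V(4) \<eta>(1), of ?A "\<lambda>u v. f v - f u > c * (v - u)"])
      fix x d :: real assume x: "x \<in> ?A" "0 < d"
      then obtain r where r: "r > 0" "ball x r \<subseteq> V" using V(1,2) open_contains_ball by (meson subsetD)
      have "min r d > 0" using r x by auto
      then obtain u v where uv: "u < v" "v - u < min r d" "x \<in> {u..v}" "f v - f u > c * (v - u)"
        using x by blast
      have "{u..v} \<subseteq> ball x r" using uv by (auto simp: dist_real_def)
      then show "\<exists>u v. u < v \<and> v - u < d \<and> x \<in> {u..v} \<and> {u..v} \<subseteq> V \<and> c * (v - u) < f v - f u"
        using uv r by (intro exI[of _ u] exI[of _ v]) auto
    qed auto
    have div1: "D1 division_of \<Union>D1"
      by (rule disjoint_intervals_division[OF D1])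
    \<comment> \<open>Working in the interiors keeps short intervals around a point inside a single
      member of \<open>D1\<close>; the endpoints lost in this way form the null set
      \<open>E\<close>.\<close>
    define W where "W = (\<Union>K\<in>D1. interior K)"
    define A2 where "A2 = ?A \<inter> W"
    have "open W" unfolding W_def by auto
    have "\<Union>D1 \<in> lmeasurable" by (rule measure_Union_division[OF div1])
    have W1: "W \<subseteq> \<Union>D1" unfolding W_def using interior_subset by blast
    have "\<Union>D1 \<subseteq> V" using D1(3) by blast
    then have WV: "W \<subseteq> V" using W1 by blast
    have Wm: "W \<in> lmeasurable"
      using fmeasurableI2[OF V(4) WV] \<open>open W\<close> by auto
    obtain D2 R2 where D2: "finite D2" "pairwise disjnt D2"
        "\<And>K. K \<in> D2 \<Longrightarrow> \<exists>u v. u < v \<and> K = {u..v} \<and> {u..v} \<subseteq> W \<and>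
            ((\<exists>K\<in>D1. {u..v} \<subseteq> K) \<and> f v - f u < - c * (v - u))"
        and R2: "R2 \<in> lmeasurable" "measure lebesgue R2 < \<eta>" "A2 \<subseteq> \<Union>D2 \<union> R2"
    proof (rule Vitali_covering_intervals[OF Wm \<eta>(1), of A2
          "\<lambda>u v. (\<exists>K\<in>D1. {u..v} \<subseteq> K) \<and> f v - f u < - c * (v - u)"])
      fix x d :: real assume x: "x \<in> A2" "0 < d"
      then obtain K where K: "K \<in> D1" "x \<in> interior K" by (auto simp: A2_def W_def)
      then obtain r where r: "r > 0" "ball x r \<subseteq> interior K" by (meson open_contains_ball open_interior)
      have "min r d > 0" "x \<in> ?A" using r x by (auto simp: A2_def)
      then obtain u v where uv: "u < v" "v - u < min r d" "x \<in> {u..v}" "f v - f u < - c * (v - u)"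
        by blast
      have "{u..v} \<subseteq> ball x r" using uv by (auto simp: dist_real_def)
      then have "{u..v} \<subseteq> interior K" using r by blast
      moreover have "{u..v} \<subseteq> K" using calculation interior_subset by blast
      moreover have "{u..v} \<subseteq> W" using calculation(1) K(1) by (auto simp: W_def)
      ultimately show "\<exists>u v. u < v \<and> v - u < d \<and> x \<in> {u..v} \<and> {u..v} \<subseteq> W \<and>
          ((\<exists>K\<in>D1. {u..v} \<subseteq> K) \<and> f v - f u < - c * (v - u))"
        using uv r K(1) by (intro exI[of _ u] exI[of _ v]) auto
    qed auto
    have div2: "D2 division_of \<Union>D2"
      by (rule disjoint_intervals_division[OF D2])
    define E where "E = \<Union>D1 - W"
    have "negligible E"
    proof -
      have "E \<subseteq> \<Union>(frontier ` D1)"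
      proof
        fix x assume "x \<in> E"
        then obtain K where "K \<in> D1" "x \<in> K" "x \<notin> interior K" by (auto simp: E_def W_def)
        then show "x \<in> \<Union>(frontier ` D1)"
          using closure_subset by (auto simp: frontier_def)
      qed
      moreover have "negligible (\<Union>(frontier ` D1))"
      proof (intro negligible_Union ballI)
        show "finite (frontier ` D1)" using D1(1) by auto
        show "negligible t" if t: "t \<in> frontier ` D1" for t
        proof -
          obtain u v where "t = frontier {u..v}" using t D1(3) by blast
          then show ?thesis by (simp add: negligible_convex_frontier)
        qed
      qed
      ultimately show ?thesis by (rule negligible_subset[rotated])
    qed
    then have E: "E \<in> lmeasurable" "measure lebesgue E = 0"
      using negligible_iff_measure by blast+
    have m1: "\<Union>D1 \<in> lmeasurable" "measure lebesgue (\<Union>D1) = sum content D1"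
      and m2: "\<Union>D2 \<in> lmeasurable" "measure lebesgue (\<Union>D2) = sum content D2"
      using measure_Union_division div1 div2 by auto
    have s1: "sum content D1 < \<alpha> + \<eta>"
      using measure_mono_fmeasurable[OF \<open>\<Union>D1 \<subseteq> V\<close> _ V(4)] m1 V(5) by (auto simp: fmeasurableD)
    have "\<alpha> \<le> measure lebesgue (\<Union>D1 \<union> R1)"
      using R1 m1 by (intro \<alpha>le) auto
    also have "\<dots> \<le> measure lebesgue (\<Union>D1) + measure lebesgue R1"
      using R1 m1 by (intro measure_Un_le) auto
    finally have s1': "\<alpha> \<le> sum content D1 + \<eta>" using m1 R1 by linarith
    have "?A \<subseteq> \<Union>D2 \<union> (R1 \<union> (R2 \<union> E))"
      using R1(3) R2(3) unfolding A2_def E_def by blast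
    then have "\<alpha> \<le> measure lebesgue (\<Union>D2 \<union> (R1 \<union> (R2 \<union> E)))"
      using R1 R2 m2 E by (intro \<alpha>le) auto
    also have "\<dots> \<le> measure lebesgue (\<Union>D2) + measure lebesgue (R1 \<union> (R2 \<union> E))"
      using R1 R2 m2 E by (intro measure_Un_le) auto
    also have "measure lebesgue (R1 \<union> (R2 \<union> E)) \<le> measure lebesgue R1 + measure lebesgue (R2 \<union> E)"
      using R1 R2 E by (intro measure_Un_le) auto
    also have "measure lebesgue (R2 \<union> E) \<le> measure lebesgue R2 + measure lebesgue E"
      using R2 E by (intro measure_Un_le) auto
    finally have s2: "\<alpha> \<le> sum content D2 + 2 * \<eta>" using m2 R1 R2 E by linarith
    define p where "p K = {J \<in> D2. J \<subseteq> K}" for K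
    have "\<exists>r. p K \<subseteq> r \<and> r division_of K" if KD1: "K \<in> D1" for K
    proof -
      have "p K division_of \<Union>(p K)"
        by (rule division_of_subset[OF div2]) (auto simp: p_def)
      moreover obtain u v where "K = cbox u v" using D1(3)[OF KD1] by auto
      moreover have "\<Union>(p K) \<subseteq> K" by (auto simp: p_def)
      ultimately show ?thesis by (metis partial_division_extend_interval)
    qed
    then obtain r where r: "\<And>K. K \<in> D1 \<Longrightarrow> p K \<subseteq> r K" "\<And>K. K \<in> D1 \<Longrightarrow> r K division_of K"
      by metis
    \<comment> \<open>\<open>r K\<close> completes the second-generation intervals inside
      \<open>K\<close> to a division of \<open>K\<close>, so \<open>g K\<close> consists of the gaps
      between them.\<close>
    define g where "g K = r K - p K" for K
    have gfin: "finite (g K)" if "K \<in> D1" for K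
      using r(2)[OF that] by (auto simp: g_def)
    have gdiv: "g K division_of \<Union>(g K)" if "K \<in> D1" for K
    proof -
      have "r K division_of \<Union>(r K)" using r(2)[OF that] by (metis division_ofD(6))
      then show ?thesis by (rule division_of_subset) (auto simp: g_def)
    qed
    have gsub: "J \<subseteq> K" "J \<noteq> {}" if "K \<in> D1" "J \<in> g K" for J K
      using r(2)[OF that(1)] that(2) by (auto simp: g_def division_of_def)
    have pfin: "finite (p K)" for K using D2(1) by (auto simp: p_def)
    have gcont: "sum content (g K) = content K - sum content (p K)"
      and ginc: "(\<Sum>J\<in>g K. \<bar>increment f J\<bar>) \<ge> c * content K" if K: "K \<in> D1" for K
    proof -
      obtain u v where uv: "u < v" "K = {u..v}" "f v - f u > c * (v - u)" using D1(3)[OF K] by blast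
      have rdiv: "r K division_of {u..v}" using r(2)[OF K] uv by simp
      then have rfin: "finite (r K)" by auto
      have "sum content (r K) = content K"
        using additive_content_division[of "r K" u v] rdiv uv by simp
      then show "sum content (g K) = content K - sum content (p K)"
        unfolding g_def using r(1)[OF K] rfin by (simp add: sum_diff)
      have "(\<Sum>J\<in>r K. increment f J) = f v - f u"
        using increment_division[OF _ rdiv] uv by simp
      moreover have "(\<Sum>J\<in>g K. increment f J) = (\<Sum>J\<in>r K. increment f J) - (\<Sum>J\<in>p K. increment f J)"
        unfolding g_def using r(1)[OF K] rfin by (simp add: sum_diff)
      \<comment> \<open>The function decreases over the intervals of \<open>p K\<close>, so the gaps
        alone must account for the whole rise of \<open>f\<close> over \<open>K\<close>.\<close>
      moreover have "(\<Sum>J\<in>p K. increment f J) \<le> 0"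
      proof (rule sum_nonpos)
        fix J assume "J \<in> p K"
        then obtain u v where "u < v" "J = {u..v}" "f v - f u < - c * (v - u)"
          using D2(3) unfolding p_def by blast
        moreover then have "c * (v - u) > 0" using c by auto
        ultimately show "increment f J \<le> 0" by (simp add: increment_def)
      qed
      moreover have "(\<Sum>J\<in>g K. increment f J) \<le> (\<Sum>J\<in>g K. \<bar>increment f J\<bar>)"
        by (intro sum_mono) auto
      ultimately show "(\<Sum>J\<in>g K. \<bar>increment f J\<bar>) \<ge> c * content K"
        using uv by simp
    qed
    have dK: "K \<inter> L = {}" if "K \<in> D1" "L \<in> D1" "K \<noteq> L" for K L
      using D1(2) that unfolding pairwise_def disjnt_def by blast
    have gdisj: "\<forall>K\<in>D1. \<forall>L\<in>D1. K \<noteq> L \<longrightarrow> g K \<inter> g L = {}"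
    proof (intro ballI impI equals0I)
      fix K L J assume K: "K \<in> D1" and L: "L \<in> D1" and ne: "K \<noteq> L" and J: "J \<in> g K \<inter> g L"
      have "J \<subseteq> K \<inter> L"
        using gsub(1)[OF K IntD1[OF J]] gsub(1)[OF L IntD2[OF J]] by (rule Int_greatest)
      then show False using dK[OF K L ne] gsub(2)[OF K IntD1[OF J]] by simp
    qed
    have pdisj: "\<forall>K\<in>D1. \<forall>L\<in>D1. K \<noteq> L \<longrightarrow> p K \<inter> p L = {}"
    proof (intro ballI impI)
      fix K L assume KL: "K \<in> D1" "L \<in> D1" "K \<noteq> L"
      show "p K \<inter> p L = {}"
      proof (rule ccontr)
        assume "p K \<inter> p L \<noteq> {}"
        then obtain J where "J \<in> D2" "J \<subseteq> K" "J \<subseteq> L" by (auto simp: p_def)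
        moreover have "J \<noteq> {}" using D2(3)[OF \<open>J \<in> D2\<close>] by auto
        ultimately show False using dK[OF KL] by blast
      qed
    qed
    have D2p: "D2 = (\<Union>K\<in>D1. p K)"
    proof
      show "D2 \<subseteq> (\<Union>K\<in>D1. p K)"
      proof
        fix J assume "J \<in> D2"
        then obtain K where "K \<in> D1" "J \<subseteq> K" using D2(3) by metis
        then show "J \<in> (\<Union>K\<in>D1. p K)" using \<open>J \<in> D2\<close> by (auto simp: p_def)
      qed
    qed (auto simp: p_def)
    define G where "G = (\<Union>K\<in>D1. g K)"
    have Gdiv: "G division_of \<Union>G"
    proof -
      have "\<Union>(g ` D1) division_of \<Union>(\<Union>(g ` D1))"
      proof (rule division_of_Union)
        show "q division_of \<Union>q" if "q \<in> g ` D1" for q using gdiv that by auto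
        fix J1 J2 assume "J1 \<in> \<Union>(g ` D1)" "J2 \<in> \<Union>(g ` D1)" "J1 \<noteq> J2"
        then obtain K1 K2 where K: "K1 \<in> D1" "J1 \<in> g K1" "K2 \<in> D1" "J2 \<in> g K2" by auto
        show "interior J1 \<inter> interior J2 = {}"
        proof (cases "K1 = K2")
          case True
          then show ?thesis using division_ofD(5)[OF gdiv[OF K(1)] K(2)] K(4) \<open>J1 \<noteq> J2\<close> by simp
        next
          case False
          then have "J1 \<inter> J2 = {}"
            using dK[OF K(1,3) False] gsub(1)[OF K(1,2)] gsub(1)[OF K(3,4)] by (metis Int_mono subset_empty)
          then show ?thesis by (metis interior_Int interior_empty)
        qed
      qed (use D1 in auto)
      then show ?thesis by (simp add: G_def)
    qed
    have "\<Union>G \<subseteq> \<Union>D1" using gsub(1) by (auto simp: G_def)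
    then have Gsub: "\<Union>G \<subseteq> {a..b}" using \<open>\<Union>D1 \<subseteq> V\<close> V(3) by force
    have "sum content D2 = (\<Sum>K\<in>D1. sum content (p K))"
      unfolding D2p using D1(1) pfin pdisj by (intro sum.UNION_disjoint) auto
    moreover have "sum content G = (\<Sum>K\<in>D1. sum content (g K))"
      unfolding G_def using D1(1) gfin gdisj by (intro sum.UNION_disjoint) auto
    ultimately have "sum content G = sum content D1 - sum content D2"
      by (simp add: gcont sum_subtractf)
    also have "\<dots> < \<delta>" using s1 s2 \<eta> by linarith
    finally have "(\<Sum>K\<in>G. \<bar>increment f K\<bar>) < c * e / 2"
      by (intro AC Gdiv Gsub)
    moreover have "(\<Sum>K\<in>G. \<bar>increment f K\<bar>) = (\<Sum>K\<in>D1. \<Sum>J\<in>g K. \<bar>increment f J\<bar>)"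
      unfolding G_def using D1(1) gfin gdisj by (intro sum.UNION_disjoint) auto
    moreover have "(\<Sum>K\<in>D1. \<Sum>J\<in>g K. \<bar>increment f J\<bar>) \<ge> (\<Sum>K\<in>D1. c * content K)"
      by (intro sum_mono ginc)
    ultimately have "c * sum content D1 < c * (e / 2)"
      by (simp add: sum_distrib_left)
    then have "sum content D1 < e / 2" using c by (simp add: mult_less_cancel_left_pos)
    then show ?thesis using s1' \<eta> by linarith
  qed
  then have "\<alpha> \<le> 0" using field_le_epsilon[of \<alpha> 0] by simp
  then show ?thesis
    unfolding negligible_outer
  proof (intro allI impI)
    fix e :: real assume e: "e > 0"
    obtain T where T: "?A \<subseteq> T" "T \<in> lmeasurable" "measure lebesgue T < \<alpha> + e"
      by (rule exE[OF \<alpha>ex[OF e]], elim conjE)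
    have "measure lebesgue T < e" using T(3) \<open>\<alpha> \<le> 0\<close> by linarith
    then show "\<exists>T. ?A \<subseteq> T \<and> T \<in> lmeasurable \<and> measure lebesgue T < e"
      by (intro exI[of _ T] conjI T)
  qed
qed

section \<open>Lebesgue's theorem on differentiability almost everywhere\<close>

lemma abs_cont_minus_linear:
  assumes "abs_cont a b f"
  shows "abs_cont a b (\<lambda>x. f x - k * x)"
  unfolding abs_cont_def
proof (intro allI impI)
  fix \<epsilon> :: real assume "\<epsilon> > 0"
  then have "\<epsilon> / 2 > 0" by simp
  from abs_contD[OF assms this] obtain \<delta> where \<delta>: "\<delta> > 0"
    "\<And>D. D division_of \<Union>D \<Longrightarrow> \<Union>D \<subseteq> {a..b} \<Longrightarrow> sum content D < \<delta> \<Longrightarrow>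
      (\<Sum>K\<in>D. \<bar>increment f K\<bar>) < \<epsilon> / 2"
    by metis
  show "\<exists>\<delta>>0. \<forall>D. D division_of \<Union>D \<longrightarrow> \<Union>D \<subseteq> {a..b} \<longrightarrow>
     sum content D < \<delta> \<longrightarrow> (\<Sum>K\<in>D. \<bar>increment (\<lambda>x. f x - k * x) K\<bar>) < \<epsilon>"
  proof (intro exI[of _ "min \<delta> (\<epsilon> / (2 * (\<bar>k\<bar> + 1)))"] conjI allI impI)
    show "min \<delta> (\<epsilon> / (2 * (\<bar>k\<bar> + 1))) > 0" using \<delta> \<open>\<epsilon> > 0\<close> by (simp add: add_nonneg_pos)
    fix D :: "real set set"
    assume D: "D division_of \<Union>D" "\<Union>D \<subseteq> {a..b}" "sum content D < min \<delta> (\<epsilon> / (2 * (\<bar>k\<bar> + 1)))"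
    have "(\<Sum>K\<in>D. \<bar>increment (\<lambda>x. f x - k * x) K\<bar>) \<le> (\<Sum>K\<in>D. \<bar>increment f K\<bar> + \<bar>k\<bar> * content K)"
    proof (rule sum_mono)
      fix K assume "K \<in> D"
      then obtain u v where "K = {u..v}" "u \<le> v"
        using D(1) by (metis atLeastatMost_empty_iff2 box_real(2) cbox_division_memE)
      then have "increment (\<lambda>x. f x - k * x) K = increment f K - k * content K"
        by (simp add: increment_def algebra_simps)
      moreover have "\<bar>k * content K\<bar> = \<bar>k\<bar> * content K" by (simp add: abs_mult)
      ultimately show "\<bar>increment (\<lambda>x. f x - k * x) K\<bar> \<le> \<bar>increment f K\<bar> + \<bar>k\<bar> * content K"
        by linarith
    qed
    also have "\<dots> = (\<Sum>K\<in>D. \<bar>increment f K\<bar>) + \<bar>k\<bar> * sum content D"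
      by (simp add: sum.distrib sum_distrib_left)
    also have "\<bar>k\<bar> * sum content D \<le> (\<bar>k\<bar> + 1) * sum content D"
      by (intro mult_right_mono sum_nonneg) auto
    also have "(\<bar>k\<bar> + 1) * sum content D < \<epsilon> / 2"
    proof -
      have "sum content D < \<epsilon> / (2 * (\<bar>k\<bar> + 1))" using D(3) by simp
      then show ?thesis by (simp add: field_simps add_pos_nonneg)
    qed
    finally show "(\<Sum>K\<in>D. \<bar>increment (\<lambda>x. f x - k * x) K\<bar>) < \<epsilon>"
      using \<delta>(2)[OF D(1,2)] D(3) by linarith
  qed
qed

text \<open>Subtracting the line of slope \<open>(p + q) / 2\<close> turns the levels
  \<open>p\<close> and \<open>q\<close> into \<open>- c\<close> and \<open>c\<close> with
  \<open>c = (q - p) / 2\<close>.\<close>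

lemma abs_cont_oscillation_negligible':
  assumes f: "abs_cont a b f" and "p < q"
  shows "negligible {x \<in> {a<..<b}. \<forall>d>0.
    (\<exists>u v. u < v \<and> v - u < d \<and> x \<in> {u..v} \<and> f v - f u > q * (v - u)) \<and>
    (\<exists>u v. u < v \<and> v - u < d \<and> x \<in> {u..v} \<and> f v - f u < p * (v - u))}"
proof -
  define k where "k = (p + q) / 2"
  define c where "c = (q - p) / 2"
  have "c > 0" using assms(2) by (simp add: c_def)
  have 1: "(f v - k * v) - (f u - k * u) > c * (v - u) \<longleftrightarrow> f v - f u > q * (v - u)" for u v
  proof -
    have "f v - f u - q * (v - u) = ((f v - k * v) - (f u - k * u)) - c * (v - u)"
      by (simp add: k_def c_def field_simps)
    then show ?thesis by linarith
  qed
  have 2: "(f v - k * v) - (f u - k * u) < - c * (v - u) \<longleftrightarrow> f v - f u < p * (v - u)" for u v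
  proof -
    have "f v - f u - p * (v - u) = ((f v - k * v) - (f u - k * u)) + c * (v - u)"
      by (simp add: k_def c_def field_simps)
    then show ?thesis by linarith
  qed
  from abs_cont_oscillation_negligible[OF abs_cont_minus_linear[OF f, of k] \<open>c > 0\<close>]
  show ?thesis unfolding 1 2 .
qed

text \<open>Disjoint intervals of slope above \<open>2 / e\<close> within a window shorter than
  \<open>\<delta>\<close> have total increment below 1, hence total length below
  \<open>e / 2\<close>. Absolute continuity gives this only in short windows, so negligibility is
  proved locally.\<close>

lemma abs_cont_steep_negligible:
  assumes f: "abs_cont a b f"
  shows "negligible {x \<in> {a<..<b}. \<forall>M. \<forall>d>0.
    \<exists>u v. u < v \<and> v - u < d \<and> x \<in> {u..v} \<and> \<bar>f v - f u\<bar> > M * (v - u)}" (is "negligible ?A")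
proof -
  define S where "S = ?A"
  obtain \<delta> where \<delta>: "\<delta> > 0" and AC: "\<And>D. D division_of \<Union>D \<Longrightarrow> \<Union>D \<subseteq> {a..b} \<Longrightarrow>
      sum content D < \<delta> \<Longrightarrow> (\<Sum>K\<in>D. \<bar>increment f K\<bar>) < 1"
    using abs_contD[OF f zero_less_one] by metis
  have neg: "negligible (S \<inter> ball x (\<delta> / 4))" for x
    unfolding negligible_outer_le
  proof (intro allI impI)
    fix e :: real assume e: "e > 0"
    define W where "W = ball x (\<delta> / 4) \<inter> {a<..<b}"
    have "open W" by (auto simp: W_def)
    have Wm: "W \<in> lmeasurable" unfolding W_def by (intro fmeasurable.Int) auto
    have "measure lebesgue W \<le> measure lebesgue (ball x (\<delta> / 4))"
      using Wm by (intro measure_mono_fmeasurable) (auto simp: W_def fmeasurableD)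
    also have "\<dots> < \<delta>" using \<delta> by (simp add: ball_eq_greaterThanLessThan)
    finally have Wd: "measure lebesgue W < \<delta>" .
    have "e / 2 > 0" using e by simp
    obtain D R where D: "finite D" "pairwise disjnt D"
        "\<And>K. K \<in> D \<Longrightarrow> \<exists>u v. u < v \<and> K = {u..v} \<and> {u..v} \<subseteq> W \<and> \<bar>f v - f u\<bar> > (2 / e) * (v - u)"
        and R: "R \<in> lmeasurable" "measure lebesgue R < e / 2" "S \<inter> ball x (\<delta> / 4) \<subseteq> \<Union>D \<union> R"
    proof (rule Vitali_covering_intervals[OF Wm \<open>e / 2 > 0\<close>, of "S \<inter> ball x (\<delta> / 4)"
          "\<lambda>u v. \<bar>f v - f u\<bar> > (2 / e) * (v - u)"])
      fix y d :: real assume y: "y \<in> S \<inter> ball x (\<delta> / 4)" "0 < d"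
      then have "y \<in> W" by (simp add: W_def S_def)
      then obtain r where r: "r > 0" "ball y r \<subseteq> W" using \<open>open W\<close> open_contains_ball by (meson subsetD)
      have "min r d > 0" using r y by auto
      moreover have "\<forall>M. \<forall>d>0. \<exists>u v. u < v \<and> v - u < d \<and> y \<in> {u..v} \<and> \<bar>f v - f u\<bar> > M * (v - u)"
        using y by (simp add: S_def)
      ultimately obtain u v where uv: "u < v" "v - u < min r d" "y \<in> {u..v}" "\<bar>f v - f u\<bar> > (2 / e) * (v - u)"
        by blast
      have "{u..v} \<subseteq> ball y r" using uv by (auto simp: dist_real_def)
      then show "\<exists>u v. u < v \<and> v - u < d \<and> y \<in> {u..v} \<and> {u..v} \<subseteq> W \<and> (2 / e) * (v - u) < \<bar>f v - f u\<bar>"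
        using uv r by (intro exI[of _ u] exI[of _ v]) auto
    qed auto
    have div: "D division_of \<Union>D"
      by (rule disjoint_intervals_division[OF D])
    have DW: "\<Union>D \<subseteq> W" using D(3) by blast
    have "sum content D \<le> measure lebesgue W"
      using measure_mono_fmeasurable[OF DW _ Wm] measure_Union_division[OF div] by (simp add: fmeasurableD)
    then have "(\<Sum>K\<in>D. \<bar>increment f K\<bar>) < 1"
      using DW Wd by (intro AC div) (auto simp: W_def)
    moreover have "(\<Sum>K\<in>D. (2 / e) * content K) \<le> (\<Sum>K\<in>D. \<bar>increment f K\<bar>)"
    proof (rule sum_mono)
      fix K assume "K \<in> D"
      then obtain u v where "u < v" "K = {u..v}" "\<bar>f v - f u\<bar> > (2 / e) * (v - u)" using D(3) by blast
      then show "(2 / e) * content K \<le> \<bar>increment f K\<bar>" by (simp add: increment_def)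
    qed
    ultimately have "(2 / e) * sum content D < 1"
      by (simp only: sum_distrib_left)
    then have De: "sum content D < e / 2" using e by (simp add: field_simps)
    show "\<exists>T. S \<inter> ball x (\<delta> / 4) \<subseteq> T \<and> T \<in> lmeasurable \<and> measure lebesgue T \<le> e"
    proof (intro exI conjI)
      show "\<Union>D \<union> R \<in> lmeasurable" using measure_Union_division[OF div] R by auto
      have "measure lebesgue (\<Union>D \<union> R) \<le> measure lebesgue (\<Union>D) + measure lebesgue R"
        using measure_Union_division[OF div] R by (intro measure_Un_le) auto
      then show "measure lebesgue (\<Union>D \<union> R) \<le> e" using De R measure_Union_division[OF div] by linarith
    qed (rule R(3))
  qed
  have "negligible S"
  proof (rule locally_negligible_alt[THEN iffD2], intro ballI)
    fix x assume x: "x \<in> S"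
    have "openin (top_of_set S) (S \<inter> ball x (\<delta> / 4))"
      by (rule openin_open_Int[OF open_ball])
    moreover have "x \<in> S \<inter> ball x (\<delta> / 4)"
      by (rule IntI[OF x]) (use \<delta> in simp)
    ultimately show "\<exists>U. openin (top_of_set S) U \<and> x \<in> U \<and> negligible U"
      using neg by metis
  qed
  then show ?thesis by (simp only: S_def)
qed

text \<open>\<open>L\<close> is the supremum of the eventual lower bounds for slopes over intervals
  around \<open>x\<close>. A rational \<open>p\<close> just above \<open>L\<close> is no such bound,
  so \<open>osc\<close> makes a nearby \<open>q\<close> an eventual upper bound. Intervals may have
  \<open>x\<close> as an endpoint, which recovers ordinary difference quotients. Restricting
  \<open>osc\<close> to rational levels leaves only countably many exceptional sets to
  discard.\<close>

lemma real_differentiable_if_slopes_converge: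
  fixes f :: "real \<Rightarrow> real"
  assumes bdd: "\<exists>M. \<exists>d>0. \<forall>u v. u < v \<and> v - u < d \<and> x \<in> {u..v} \<longrightarrow> \<bar>f v - f u\<bar> \<le> M * (v - u)"
    and osc: "\<And>p q. p \<in> \<rat> \<Longrightarrow> q \<in> \<rat> \<Longrightarrow> p < q \<Longrightarrow> \<exists>d>0.
      (\<forall>u v. u < v \<and> v - u < d \<and> x \<in> {u..v} \<longrightarrow> f v - f u \<le> q * (v - u)) \<or>
      (\<forall>u v. u < v \<and> v - u < d \<and> x \<in> {u..v} \<longrightarrow> f v - f u \<ge> p * (v - u))"
  shows "f differentiable (at x)"
proof -
  obtain M d0 where M: "d0 > 0" "\<And>u v. u < v \<Longrightarrow> v - u < d0 \<Longrightarrow> x \<in> {u..v} \<Longrightarrow> \<bar>f v - f u\<bar> \<le> M * (v - u)"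
    using bdd by blast
  define P where "P = {p. \<exists>d>0. \<forall>u v. u < v \<and> v - u < d \<and> x \<in> {u..v} \<longrightarrow> f v - f u \<ge> p * (v - u)}"
  define L where "L = Sup P"
  have "- M \<in> P"
    unfolding P_def using M by (force intro!: exI[of _ d0])
  have ub: "p \<le> M" if p: "p \<in> P" for p
  proof -
    obtain d where d: "d > 0" "\<And>u v. u < v \<Longrightarrow> v - u < d \<Longrightarrow> x \<in> {u..v} \<Longrightarrow> f v - f u \<ge> p * (v - u)"
      using p unfolding P_def by blast
    define h where "h = min d d0 / 2"
    have h: "h > 0" "h < d" "h < d0" using d(1) M(1) by (auto simp: h_def)
    have "p * h \<le> f (x + h) - f x" "\<bar>f (x + h) - f x\<bar> \<le> M * h"
      using d(2)[of x "x + h"] M(2)[of x "x + h"] h by auto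
    then have "p * h \<le> M * h" by linarith
    then show ?thesis using h(1) by (simp add: mult_le_cancel_right)
  qed
  then have bP: "bdd_above P" by (auto simp: bdd_above_def)
  have "\<exists>d>0. \<forall>y. \<bar>y - x\<bar> < d \<longrightarrow> \<bar>f y - f x - L * (y - x)\<bar> \<le> \<epsilon> * \<bar>y - x\<bar>" if \<epsilon>: "\<epsilon> > 0" for \<epsilon>
  proof -
    obtain p where "p \<in> \<rat>" "L < p" "p < L + \<epsilon>" using Rats_dense_in_real[of L "L + \<epsilon>"] \<epsilon> by auto
    obtain q where "q \<in> \<rat>" "p < q" "q < L + \<epsilon>" using Rats_dense_in_real[of p "L + \<epsilon>"] \<open>p < L + \<epsilon>\<close> by auto
    have "p \<notin> P" using cSup_upper[OF _ bP, of p] \<open>L < p\<close> by (auto simp: L_def)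
    with osc[OF \<open>p \<in> \<rat>\<close> \<open>q \<in> \<rat>\<close> \<open>p < q\<close>] obtain d1 where d1: "d1 > 0"
        "\<And>u v. u < v \<Longrightarrow> v - u < d1 \<Longrightarrow> x \<in> {u..v} \<Longrightarrow> f v - f u \<le> q * (v - u)"
      unfolding P_def by auto
    have "L - \<epsilon> < Sup P" using \<epsilon> by (simp add: L_def)
    then obtain p' where "p' \<in> P" "L - \<epsilon> < p'" using less_cSupD \<open>- M \<in> P\<close> by blast
    then obtain d2 where d2: "d2 > 0"
        "\<And>u v. u < v \<Longrightarrow> v - u < d2 \<Longrightarrow> x \<in> {u..v} \<Longrightarrow> f v - f u \<ge> p' * (v - u)"
      by (auto simp: P_def)
    have two: "\<bar>f v - f u - L * (v - u)\<bar> \<le> \<epsilon> * (v - u)" if "u < v" "v - u < min d1 d2" "x \<in> {u..v}" for u v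
    proof -
      have "f v - f u \<le> q * (v - u)" "f v - f u \<ge> p' * (v - u)" using d1 d2 that by auto
      moreover have "q * (v - u) \<le> (L + \<epsilon>) * (v - u)" "p' * (v - u) \<ge> (L - \<epsilon>) * (v - u)"
        using \<open>q < L + \<epsilon>\<close> \<open>L - \<epsilon> < p'\<close> that by (auto intro!: mult_right_mono)
      ultimately show ?thesis unfolding abs_le_iff by (simp add: algebra_simps)
    qed
    show ?thesis
    proof (intro exI[of _ "min d1 d2"] conjI allI impI)
      fix y assume y: "\<bar>y - x\<bar> < min d1 d2"
      consider "y < x" | "y = x" | "y > x" by linarith
      then show "\<bar>f y - f x - L * (y - x)\<bar> \<le> \<epsilon> * \<bar>y - x\<bar>"
      proof cases
        case 1 then show ?thesis using two[of y x] y by (simp add: abs_if algebra_simps split: if_splits)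
      next
        case 3 then show ?thesis using two[of x y] y by (simp add: algebra_simps)
      qed simp
    qed (use d1 d2 in auto)
  qed
  then have "(f has_derivative (\<lambda>h. L * h)) (at x)"
    unfolding has_derivative_within_alt by (auto simp: bounded_linear_mult_right)
  then show ?thesis unfolding differentiable_def by blast
qed

text \<open>The points violating a hypothesis of the slope criterion form a countable union of null
  sets. The endpoints are put into \<open>N\<close> because the preceding estimates concern interior
  points.\<close>

lemma abs_cont_differentiable_ae:
  assumes f: "abs_cont a b f"
  obtains N where "negligible N" "\<And>x. x \<in> {a..b} - N \<Longrightarrow> f differentiable (at x)"
proof -
  define A where "A p q = {x \<in> {a<..<b}. \<forall>d>0.
    (\<exists>u v. u < v \<and> v - u < d \<and> x \<in> {u..v} \<and> f v - f u > q * (v - u)) \<and>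
    (\<exists>u v. u < v \<and> v - u < d \<and> x \<in> {u..v} \<and> f v - f u < p * (v - u))}" for p q
  define S where "S = {x \<in> {a<..<b}. \<forall>M. \<forall>d>0.
    \<exists>u v. u < v \<and> v - u < d \<and> x \<in> {u..v} \<and> \<bar>f v - f u\<bar> > M * (v - u)}"
  define I where "I = {(p, q). p \<in> \<rat> \<and> q \<in> \<rat> \<and> p < (q :: real)}"
  have "I \<subseteq> \<rat> \<times> \<rat>" by (auto simp: I_def)
  then have "countable I" by (rule countable_subset) (simp add: countable_rat)
  have "negligible (\<Union>((\<lambda>(p, q). A p q) ` I))"
  proof (rule negligible_countable_Union)
    show "countable ((\<lambda>(p, q). A p q) ` I)" using \<open>countable I\<close> by simp
    show "negligible T" if "T \<in> (\<lambda>(p, q). A p q) ` I" for T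
      using that abs_cont_oscillation_negligible'[OF f] by (auto simp: I_def A_def)
  qed
  moreover have "negligible S" unfolding S_def by (rule abs_cont_steep_negligible[OF f])
  ultimately have neg: "negligible ({a, b} \<union> S \<union> \<Union>((\<lambda>(p, q). A p q) ` I))"
    by (intro negligible_Un) auto
  show thesis
  proof (rule that[OF neg])
    fix x assume x: "x \<in> {a..b} - ({a, b} \<union> S \<union> \<Union>((\<lambda>(p, q). A p q) ` I))"
    then have xab: "x \<in> {a<..<b}" by auto
    show "f differentiable (at x)"
    proof (rule real_differentiable_if_slopes_converge)
      from x have "x \<notin> S" by simp
      then show "\<exists>M. \<exists>d>0. \<forall>u v. u < v \<and> v - u < d \<and> x \<in> {u..v} \<longrightarrow> \<bar>f v - f u\<bar> \<le> M * (v - u)"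
        using xab unfolding S_def not_le[symmetric] by blast
      fix p q :: real assume pq: "p \<in> \<rat>" "q \<in> \<rat>" "p < q"
      then have "(p, q) \<in> I" by (simp add: I_def)
      then have "x \<notin> A p q" using x by auto
      with xab obtain d where "d > 0" "\<not> ((\<exists>u v. u < v \<and> v - u < d \<and> x \<in> {u..v} \<and> f v - f u > q * (v - u)) \<and>
          (\<exists>u v. u < v \<and> v - u < d \<and> x \<in> {u..v} \<and> f v - f u < p * (v - u)))"
        unfolding A_def by blast
      then show "\<exists>d>0.
        (\<forall>u v. u < v \<and> v - u < d \<and> x \<in> {u..v} \<longrightarrow> f v - f u \<le> q * (v - u)) \<or>
        (\<forall>u v. u < v \<and> v - u < d \<and> x \<in> {u..v} \<longrightarrow> f v - f u \<ge> p * (v - u))"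
        by (intro exI[of _ d]) (meson not_le)
    qed
  qed
qed

text \<open>Integrability of \<open>g\<close> is a conclusion here, in the sense of the gauge
  integral. The gauge confines intervals tagged in \<open>N\<close> to an open set so small that
  absolute continuity bounds their increments; at all other tags the derivative controls the
  error.\<close>

lemma abs_cont_has_integral:
  assumes f: "abs_cont a b f" and "a \<le> b" and N: "negligible N"
    and der: "\<And>x. x \<in> {a..b} - N \<Longrightarrow> (f has_vector_derivative g x) (at x within {a..b})"
  shows "(g has_integral (f b - f a)) {a..b}"
proof -
  define f' where "f' x = (if x \<in> N then 0 else g x)" for x
  have "(f' has_integral (f b - f a)) (cbox a b)"
    unfolding has_integral
  proof (intro allI impI)
    fix e :: real assume "e > 0"
    then have "e / 2 > 0" by simp
    from abs_contD[OF f this] obtain \<delta> where \<delta>: "\<delta> > 0"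
      and AC: "\<And>D. D division_of \<Union>D \<Longrightarrow> \<Union>D \<subseteq> {a..b} \<Longrightarrow> sum content D < \<delta> \<Longrightarrow>
        (\<Sum>K\<in>D. \<bar>increment f K\<bar>) < e / 2"
      by metis
    have Nm: "N \<in> lmeasurable" "measure lebesgue N = 0" using N negligible_iff_measure by blast+
    obtain V where V: "open V" "N \<subseteq> V" "V \<in> lmeasurable" "measure lebesgue V < \<delta>"
    proof -
      obtain V where V: "open V" "N \<subseteq> V" "V - N \<in> lmeasurable" "emeasure lebesgue (V - N) < ennreal \<delta>"
        using sets_lebesgue_outer_open[OF fmeasurableD[OF Nm(1)] \<delta>] by metis
      have "measure lebesgue (V - N) < \<delta>"
        using V(3,4) \<delta> by (simp add: emeasure_eq_measure2 ennreal_less_iff)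
      moreover have "V = N \<union> (V - N)" using V(2) by blast
      moreover then have "V \<in> lmeasurable"
        using fmeasurable.Un[OF Nm(1) V(3)] by simp
      ultimately have "V \<in> lmeasurable" "measure lebesgue V < \<delta>"
        using Nm V(3) measure_Un_le[of N lebesgue "V - N"] by (simp_all add: fmeasurableD)
      then show thesis using that V by blast
    qed
    \<comment> \<open>Chosen so that \<open>e' * (b - a)\<close> is at most \<open>e / 2\<close>;
      the added 1 covers \<open>a = b\<close>.\<close>
    define e' where "e' = e / (2 * (b - a + 1))"
    have "e' > 0" using \<open>e > 0\<close> \<open>a \<le> b\<close> by (simp add: e'_def)
    have "\<exists>r>0. if x \<in> N then ball x r \<subseteq> V else
        (x \<in> {a..b} \<longrightarrow> (\<forall>y\<in>{a..b}. \<bar>y - x\<bar> < r \<longrightarrow> \<bar>f y - f x - (y - x) * g x\<bar> \<le> e' * \<bar>y - x\<bar>))" for x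
    proof (cases "x \<in> N")
      case True
      then show ?thesis using V(1,2) open_contains_ball by (metis subsetD)
    next
      case False
      show ?thesis
      proof (cases "x \<in> {a..b}")
        case True
        with False der have "(f has_vector_derivative g x) (at x within {a..b})" by auto
        then show ?thesis
          using False \<open>e' > 0\<close> unfolding has_vector_derivative_def has_derivative_within_alt
          by (metis real_norm_def real_scaleR_def)
      qed (use False in \<open>auto intro: exI[of _ 1]\<close>)
    qed
    then obtain r where r: "\<And>x. r x > 0" "\<And>x. x \<in> N \<Longrightarrow> ball x (r x) \<subseteq> V"
        "\<And>x y. x \<notin> N \<Longrightarrow> x \<in> {a..b} \<Longrightarrow> y \<in> {a..b} \<Longrightarrow> \<bar>y - x\<bar> < r x \<Longrightarrow>
          \<bar>f y - f x - (y - x) * g x\<bar> \<le> e' * \<bar>y - x\<bar>"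
      by metis
    show "\<exists>\<gamma>. gauge \<gamma> \<and> (\<forall>\<D>. \<D> tagged_division_of cbox a b \<and> \<gamma> fine \<D> \<longrightarrow>
        norm ((\<Sum>(x, K)\<in>\<D>. content K *\<^sub>R f' x) - (f b - f a)) < e)"
    proof (intro exI conjI allI impI; (elim conjE)?)
      show "gauge (\<lambda>x. ball x (r x))" using r(1) gauge_ball_dependent by blast
      fix p assume p: "p tagged_division_of cbox a b" and fine: "(\<lambda>x. ball x (r x)) fine p"
      define T where "T = {(x, K) \<in> p. x \<in> N}"
      have fin: "finite p" using p by auto
      have pK: "\<exists>u v. u \<le> v \<and> K = {u..v} \<and> x \<in> {u..v} \<and> {u..v} \<subseteq> {a..b} \<and> {u..v} \<subseteq> ball x (r x)"
        if xK: "(x, K) \<in> p" for x K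
      proof -
        obtain u v where "K = cbox u v" using tagged_division_ofD(4)[OF p xK] by blast
        moreover have "x \<in> K" "K \<subseteq> {a..b}" using p xK by auto
        moreover have "K \<subseteq> ball x (r x)" using fine xK by (auto simp: fine_def)
        ultimately show ?thesis by (intro exI[of _ u] exI[of _ v]) auto
      qed
      have fba: "f b - f a = (\<Sum>(x, K)\<in>p. increment f K)"
        using additive_tagged_division_1[OF \<open>a \<le> b\<close>, of p f] p by (simp add: increment_def)
      have bma: "b - a = (\<Sum>(x, K)\<in>p. content K)"
        using additive_content_tagged_division[OF p] \<open>a \<le> b\<close> by simp
      \<comment> \<open>Passing from tagged pairs to intervals may merge pairs that share a
        degenerate interval, so the summand has to vanish there. On \<open>{}\<close> it is set to 0
        by hand, because \<open>increment\<close> has no determined value on the empty set.\<close>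
      let ?d = "\<lambda>K. if K = {} then 0 else \<bar>increment f K\<bar>"
      have Tdiv: "T tagged_division_of \<Union>(snd ` T)"
      proof (rule tagged_partial_division_of_Union_self)
        show "T tagged_partial_division_of cbox a b"
          using p by (auto simp: T_def tagged_division_of_def intro: tagged_partial_division_subset)
      qed
      have Sdiv: "snd ` T division_of \<Union>(snd ` T)"
        by (rule division_of_tagged_division[OF Tdiv])
      have TV: "\<Union>(snd ` T) \<subseteq> V" "\<Union>(snd ` T) \<subseteq> {a..b}"
        using pK r(2) by (fastforce simp: T_def)+
      have "sum content (snd ` T) \<le> measure lebesgue V"
        using measure_mono_fmeasurable[OF TV(1) _ V(3)] measure_Union_division[OF Sdiv] by (simp add: fmeasurableD)
      then have "(\<Sum>K\<in>snd ` T. \<bar>increment f K\<bar>) < e / 2"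
        using V(4) TV(2) by (intro AC Sdiv) auto
      moreover have "(\<Sum>(x, K)\<in>T. ?d K) = (\<Sum>K\<in>snd ` T. ?d K)"
      proof (rule sum.over_tagged_division_lemma[OF Tdiv])
        show "?d (cbox u v) = 0" if "box u v = {}" for u v :: real
          using that by (cases "u = v") (auto simp: increment_def)
      qed
      moreover have "(\<Sum>K\<in>snd ` T. ?d K) = (\<Sum>K\<in>snd ` T. \<bar>increment f K\<bar>)"
        using Sdiv by (intro sum.cong) (auto simp: division_of_def)
      moreover have "(\<Sum>(x, K)\<in>T. ?d K) = (\<Sum>(x, K)\<in>T. \<bar>increment f K\<bar>)"
        using Tdiv by (intro sum.cong) auto
      ultimately have Tsum: "(\<Sum>(x, K)\<in>T. \<bar>increment f K\<bar>) < e / 2" by simp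
      have "norm ((\<Sum>(x, K)\<in>p. content K *\<^sub>R f' x) - (f b - f a))
          = norm (\<Sum>(x, K)\<in>p. content K *\<^sub>R f' x - increment f K)"
        unfolding fba by (simp add: sum_subtractf split_def)
      also have "\<dots> \<le> (\<Sum>z\<in>p. norm (case z of (x, K) \<Rightarrow> content K *\<^sub>R f' x - increment f K))"
        by (rule norm_sum)
      also have "\<dots> \<le> (\<Sum>(x, K)\<in>p. (if x \<in> N then \<bar>increment f K\<bar> else 0) + e' * content K)"
      proof (intro sum_mono, clarify)
        fix x K assume xK: "(x, K) \<in> p"
        obtain u v where uv: "u \<le> v" "K = {u..v}" "x \<in> {u..v}" "{u..v} \<subseteq> {a..b}" "{u..v} \<subseteq> ball x (r x)"
          using pK[OF xK] by blast
        have c0: "content K \<ge> 0" by simp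
        show "norm (content K *\<^sub>R f' x - increment f K) \<le> (if x \<in> N then \<bar>increment f K\<bar> else 0) + e' * content K"
        proof (cases "x \<in> N")
          case True
          then show ?thesis using c0 \<open>e' > 0\<close> by (simp add: f'_def)
        next
          case False
          \<comment> \<open>Estimating from the tag to each endpoint loses nothing: \<open>x\<close>
            lies between them, so the two distances add up to the length of the interval.\<close>
          have "u \<in> {u..v}" "v \<in> {u..v}" using uv(1) by auto
          then have "u \<in> ball x (r x)" "v \<in> ball x (r x)" "u \<in> {a..b}" "v \<in> {a..b}" "x \<in> {a..b}"
            using uv(3-5) by blast+
          then have "\<bar>f u - f x - (u - x) * g x\<bar> \<le> e' * \<bar>u - x\<bar>" "\<bar>f v - f x - (v - x) * g x\<bar> \<le> e' * \<bar>v - x\<bar>"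
            using r(3)[OF False, of u] r(3)[OF False, of v] by (auto simp: dist_real_def abs_minus_commute)
          moreover have "\<bar>u - x\<bar> + \<bar>v - x\<bar> = v - u" using uv by auto
          then have "e' * \<bar>u - x\<bar> + e' * \<bar>v - x\<bar> = e' * (v - u)" by (metis distrib_left)
          moreover have "content K *\<^sub>R f' x - increment f K
              = (f u - f x - (u - x) * g x) - (f v - f x - (v - x) * g x)"
            using uv False by (simp add: increment_def f'_def algebra_simps)
          ultimately show ?thesis using uv False by (simp add: abs_if split: if_splits)
        qed
      qed
      also have "\<dots> = (\<Sum>(x, K)\<in>p. if x \<in> N then \<bar>increment f K\<bar> else 0) + e' * (b - a)"
        unfolding bma by (simp add: split_def sum.distrib sum_distrib_left)
      also have "(\<Sum>(x, K)\<in>p. if x \<in> N then \<bar>increment f K\<bar> else 0) = (\<Sum>(x, K)\<in>T. \<bar>increment f K\<bar>)"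
        unfolding T_def using fin by (intro sum.mono_neutral_cong_right) (auto split: if_splits)
      also have "e' * (b - a) \<le> e / 2"
        using \<open>e > 0\<close> \<open>a \<le> b\<close> by (simp add: e'_def field_simps)
      finally show "norm ((\<Sum>(x, K)\<in>p. content K *\<^sub>R f' x) - (f b - f a)) < e"
        using Tsum by linarith
    qed
  qed
  then have "(f' has_integral (f b - f a)) {a..b}" by simp
  then show ?thesis
    by (rule has_integral_spike[OF N, rotated]) (auto simp: f'_def)
qed

section \<open>The potential along a curve\<close>

text \<open>Mean value theorem on the segment from \<open>x\<close> to \<open>y\<close>, followed by
  the Cauchy-Schwarz inequality for the gradient.\<close>

lemma C1_with_gradient_Lipschitz:
  assumes C1: "C1_with_gradient d f G" and G: "\<And>x. x \<in> Rn d \<Longrightarrow> L2_set (G x) {..<d} \<le> C"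
    and xy: "x \<in> Rn d" "y \<in> Rn d"
  shows "\<bar>f y - f x\<bar> \<le> C * L2_set (\<lambda>i. y i - x i) {..<d}"
proof -
  define n where "n = L2_set (\<lambda>i. y i - x i) {..<d}"
  define z where "z l = (\<lambda>i\<in>{..<d}. x i + l * (y i - x i))" for l :: real
  define S where "S l = (\<Sum>i<d. G (z l) i * (y i - x i))" for l
  have zR: "z l \<in> Rn d" for l by (auto simp: z_def)
  have n0: "n \<ge> 0" by (simp add: n_def)
  have zd: "L2_set (\<lambda>i. z m i - z l i) {..<d} = \<bar>m - l\<bar> * n" for m l
  proof -
    have "L2_set (\<lambda>i. z m i - z l i) {..<d} = L2_set (\<lambda>i. \<bar>m - l\<bar> * (y i - x i)) {..<d}"
      unfolding L2_set_def by (intro arg_cong[of _ _ sqrt] sum.cong refl)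
        (auto simp: z_def power_mult_distrib simp flip: left_diff_distrib)
    then show ?thesis by (simp add: L2_set_right_distrib n_def)
  qed
  have der: "((\<lambda>l. f (z l)) has_real_derivative S l) (at l)" for l
    unfolding has_field_derivative_def has_derivative_within_alt
  proof (intro conjI allI impI)
    fix e :: real assume "e > 0"
    \<comment> \<open>Moving the parameter by \<open>m - l\<close> moves the point by
      \<open>n\<close> times as much; \<open>n + 1\<close> avoids a division by zero when
      \<open>x = y\<close>.\<close>
    define e' where "e' = e / (n + 1)"
    have e': "e' > 0" "e' * n \<le> e" using \<open>e > 0\<close> n0 by (auto simp: e'_def field_simps)
    have "has_gradient d f (G (z l)) (z l)"
      using C1 zR by (auto simp: C1_with_gradient_def)
    then obtain \<delta> where \<delta>: "\<delta> > 0" "\<And>w. w \<in> Rn d \<Longrightarrow> L2_set (\<lambda>i. w i - z l i) {..<d} < \<delta> \<Longrightarrow>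
        \<bar>f w - f (z l) - (\<Sum>i<d. G (z l) i * (w i - z l i))\<bar> \<le> e' * L2_set (\<lambda>i. w i - z l i) {..<d}"
      using e'(1) unfolding has_gradient_def by meson
    show "\<exists>\<delta>>0. \<forall>m\<in>UNIV. norm (m - l) < \<delta> \<longrightarrow>
        norm (f (z m) - f (z l) - S l * (m - l)) \<le> e * norm (m - l)"
    proof (intro exI[of _ "\<delta> / (n + 1)"] conjI ballI impI)
      show "\<delta> / (n + 1) > 0" using \<delta> n0 by simp
      fix m assume "norm (m - l) < \<delta> / (n + 1)"
      then have "\<bar>m - l\<bar> * (n + 1) < \<delta>" using n0 by (simp add: field_simps)
      moreover have "\<bar>m - l\<bar> * n \<le> \<bar>m - l\<bar> * (n + 1)" by (intro mult_left_mono) auto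
      ultimately have "\<bar>m - l\<bar> * n < \<delta>" by linarith
      then have "\<bar>f (z m) - f (z l) - (\<Sum>i<d. G (z l) i * (z m i - z l i))\<bar> \<le> e' * (\<bar>m - l\<bar> * n)"
        using \<delta>(2)[OF zR, of m] by (simp add: zd)
      moreover have "(\<Sum>i<d. G (z l) i * (z m i - z l i)) = S l * (m - l)"
        unfolding S_def sum_distrib_right by (intro sum.cong refl) (auto simp: z_def algebra_simps)
      moreover have "e' * (\<bar>m - l\<bar> * n) \<le> e * \<bar>m - l\<bar>"
        using mult_right_mono[OF e'(2), of "\<bar>m - l\<bar>"] by (simp add: algebra_simps)
      ultimately show "norm (f (z m) - f (z l) - S l * (m - l)) \<le> e * norm (m - l)" by simp
    qed
  qed (rule bounded_linear_mult_right)
  obtain l where "f (z 1) - f (z 0) = (1 - 0) * S l"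
    using MVT2[of 0 1 "\<lambda>l. f (z l)" S] der by auto
  moreover have "z 1 = y" "z 0 = x"
    using xy by (auto simp: z_def fun_eq_iff PiE_iff extensional_def)
  moreover have "\<bar>S l\<bar> \<le> C * n"
  proof -
    have "\<bar>S l\<bar> \<le> (\<Sum>i<d. \<bar>G (z l) i\<bar> * \<bar>y i - x i\<bar>)"
      unfolding S_def by (rule order_trans[OF sum_abs]) (simp add: abs_mult)
    also have "\<dots> \<le> L2_set (G (z l)) {..<d} * n"
      unfolding n_def by (rule L2_set_mult_ineq)
    also have "\<dots> \<le> C * n" using G[OF zR] n0 by (intro mult_right_mono)
    finally show ?thesis .
  qed
  ultimately show ?thesis by (simp add: n_def)
qed

section \<open>Measurability of the potential along a curve\<close>

lemma borel_measurable_lebesgue_cong_AE: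
  fixes f g :: "real \<Rightarrow> real"
  assumes g: "g \<in> borel_measurable lebesgue" and ae: "AE t in lebesgue. f t = g t"
  shows "f \<in> borel_measurable lebesgue"
  unfolding borel_measurable_iff_greater
proof
  fix a
  show "{t \<in> space lebesgue. a < f t} \<in> sets lebesgue"
  proof (rule completion.in_sets_AE)
    show "{t \<in> space lebesgue. a < g t} \<in> sets lebesgue"
      using g by (auto simp: borel_measurable_iff_greater)
    show "AE t in lebesgue. t \<in> {t \<in> space lebesgue. a < g t} \<longleftrightarrow> t \<in> {t \<in> space lebesgue. a < f t}"
      using ae by eventually_elim auto
  qed auto
qed

text \<open>Fubini only gives measurability for almost every \<open>x\<close>; the exceptional set has dense
  complement, so continuity in \<open>x\<close> removes it.\<close>

lemma measurable_potential_section: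
  assumes U: "lebesgue_measurable_potential d U"
    and Lip: "\<And>x y t. x \<in> Rn d \<Longrightarrow> y \<in> Rn d \<Longrightarrow> \<bar>U y t - U x t\<bar> \<le> C * L2_set (\<lambda>i. y i - x i) {..<d}"
    and x: "x \<in> Rn d"
  shows "U x \<in> borel_measurable lebesgue"
proof -
  let ?M = "PiM {..<d} (\<lambda>_. lborel :: real measure)"
  interpret product_sigma_finite "\<lambda>_::nat. lborel :: real measure" ..
  interpret M: sigma_finite_measure ?M by (rule sigma_finite) simp
  interpret pair_sigma_finite ?M "lborel :: real measure" ..
  \<comment> \<open>\<open>U'\<close> is a Borel representative, whose sections are measurable at
    every point; \<open>good\<close> marks the points where the section of \<open>U\<close> agrees
    with it almost everywhere.\<close>
  obtain U' where U': "U' \<in> borel_measurable (?M \<Otimes>\<^sub>M lborel)"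
      and ae: "AE p in ?M \<Otimes>\<^sub>M lborel. (\<lambda>(x, t). U x t) p = U' p"
    using completion_ex_borel_measurable_real U unfolding lebesgue_measurable_potential_def by blast
  define good where "good y \<longleftrightarrow> (AE t in lborel. U y t = U' (y, t))" for y
  have good: "AE y in ?M. good y"
    using AE_pair[OF ae] by (simp add: good_def)
  have meas: "U y \<in> borel_measurable lebesgue" if "good y" "y \<in> Rn d" for y
  proof (rule borel_measurable_lebesgue_cong_AE)
    have "y \<in> space ?M" using that by (auto simp: space_PiM)
    then have "(\<lambda>t. U' (y, t)) \<in> borel_measurable lborel"
      using measurable_compose[OF measurable_Pair1' U'] by simp
    then show "(\<lambda>t. U' (y, t)) \<in> borel_measurable lebesgue"
      by (rule measurable_completion)
    show "AE t in lebesgue. U y t = U' (y, t)"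
      using that(1) unfolding good_def by (rule AE_completion)
  qed
  have dense: "\<exists>y\<in>Rn d. good y \<and> L2_set (\<lambda>i. y i - x i) {..<d} \<le> e" if e: "e > 0" for e
  proof (rule ccontr)
    assume no: "\<not> (\<exists>y\<in>Rn d. good y \<and> L2_set (\<lambda>i. y i - x i) {..<d} \<le> e)"
    \<comment> \<open>The cube of half-side \<open>r\<close> around \<open>x\<close> lies within
      Euclidean distance \<open>e\<close>, by comparison with the sum of the coordinates. It has
      positive measure, so it cannot consist of bad points only.\<close>
    define r where "r = e / (real d + 1)"
    have r: "r > 0" "real d * r \<le> e" using e by (auto simp: r_def field_simps)
    define B where "B = PiE {..<d} (\<lambda>i. {x i - r..x i + r})"
    have "emeasure ?M B = (\<Prod>i<d. emeasure lborel {x i - r..x i + r})"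
      unfolding B_def by (rule emeasure_PiM) auto
    also have "\<dots> = (\<Prod>i<d. ennreal (2 * r))"
      using r by (intro prod.cong) auto
    also have "\<dots> \<noteq> 0" using r by (simp add: ennreal_power del: ennreal_mult'')
    finally have pos: "emeasure ?M B \<noteq> 0" .
    obtain N where N: "N \<in> null_sets ?M" "{y \<in> space ?M. \<not> good y} \<subseteq> N"
      using good unfolding eventually_ae_filter by auto
    have "B \<subseteq> N"
    proof
      fix y assume y: "y \<in> B"
      then have yR: "y \<in> Rn d" by (auto simp: B_def PiE_iff)
      have "L2_set (\<lambda>i. y i - x i) {..<d} \<le> (\<Sum>i<d. \<bar>y i - x i\<bar>)" by (rule L2_set_le_sum_abs)
      also have "\<dots> \<le> (\<Sum>i<d. r)"
      proof (rule sum_mono)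
        fix i assume "i \<in> {..<d}"
        then have "y i \<in> {x i - r..x i + r}" using y by (auto simp: B_def PiE_iff)
        then show "\<bar>y i - x i\<bar> \<le> r" by (auto simp: abs_le_iff)
      qed
      also have "\<dots> \<le> e" using r by simp
      finally have "\<not> good y" using no yR by auto
      then show "y \<in> N" using N(2) yR by (auto simp: space_PiM)
    qed
    then have "emeasure ?M B \<le> emeasure ?M N" by (intro emeasure_mono) (use N in auto)
    then show False using pos N by auto
  qed
  have "\<forall>n. \<exists>y\<in>Rn d. good y \<and> L2_set (\<lambda>i. y i - x i) {..<d} \<le> 1 / real (Suc n)"
    using dense by simp
  then obtain y where y: "\<And>n. y n \<in> Rn d" "\<And>n. good (y n)"
      "\<And>n. L2_set (\<lambda>i. y n i - x i) {..<d} \<le> 1 / real (Suc n)"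
    by metis
  show ?thesis
  proof (rule borel_measurable_LIMSEQ_real)
    show "(\<lambda>n. U (y n) t) \<longlonglongrightarrow> U x t" for t
    proof (rule LIM_zero_cancel, rule Lim_null_comparison)
      show "\<forall>\<^sub>F n in sequentially. norm (U (y n) t - U x t) \<le> \<bar>C\<bar> * (1 / real (Suc n))"
      proof (intro always_eventually allI)
        fix n
        have "norm (U (y n) t - U x t) \<le> C * L2_set (\<lambda>i. y n i - x i) {..<d}"
          using Lip[OF x y(1)] by simp
        also have "\<dots> \<le> \<bar>C\<bar> * L2_set (\<lambda>i. y n i - x i) {..<d}"
          by (intro mult_right_mono) auto
        also have "\<dots> \<le> \<bar>C\<bar> * (1 / real (Suc n))" by (intro mult_left_mono y) auto
        finally show "norm (U (y n) t - U x t) \<le> \<bar>C\<bar> * (1 / real (Suc n))" .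
      qed
      show "(\<lambda>n. \<bar>C\<bar> * (1 / real (Suc n))) \<longlonglongrightarrow> 0"
        using tendsto_mult_right_zero[OF LIMSEQ_inverse_real_of_nat, of "\<bar>C\<bar>"] by (simp add: inverse_eq_divide)
    qed
    show "U (y n) \<in> borel_measurable lebesgue" for n by (rule meas[OF y(2,1)])
  qed
qed

text \<open>The curve is frozen at grid times. For each of the countably many frozen positions the
  section of \<open>U\<close> is measurable, and the Lipschitz bound together with the continuity of
  the curve passes to the limit.\<close>

lemma measurable_potential_along_curve:
  assumes U: "lebesgue_measurable_potential d U"
    and Lip: "\<And>x y t. x \<in> Rn d \<Longrightarrow> y \<in> Rn d \<Longrightarrow> \<bar>U y t - U x t\<bar> \<le> C * L2_set (\<lambda>i. y i - x i) {..<d}"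
    and "a \<le> b" and \<eta>: "\<And>s. s \<in> {a..b} \<Longrightarrow> \<eta> s \<in> Rn d"
    and cont: "\<And>i. i < d \<Longrightarrow> continuous_on {a..b} (\<lambda>s. \<eta> s i)"
  shows "(\<lambda>s. U (\<eta> s) s) \<in> borel_measurable (lebesgue_on {a..b})"
proof -
  \<comment> \<open>Rounding a time down to the grid can leave \<open>{a..b}\<close>, where nothing
    is known about the curve; \<open>c\<close> clamps it back.\<close>
  define c where "c s = max a (min b s)" for s
  have c: "c s \<in> {a..b}" for s using \<open>a \<le> b\<close> by (auto simp: c_def)
  define q where "q n s = real_of_int \<lfloor>real (Suc n) * s\<rfloor> / real (Suc n)" for n s
  have q: "(\<lambda>n. q n s) \<longlonglongrightarrow> s" for s
  proof (rule LIM_zero_cancel, rule Lim_null_comparison)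
    show "\<forall>\<^sub>F n in sequentially. norm (q n s - s) \<le> 1 / real (Suc n)"
    proof (intro always_eventually allI)
      fix n
      have "q n s - s = (real_of_int \<lfloor>real (Suc n) * s\<rfloor> - real (Suc n) * s) / real (Suc n)"
        unfolding q_def by (simp add: field_simps del: of_nat_Suc)
      moreover have "\<bar>real_of_int \<lfloor>real (Suc n) * s\<rfloor> - real (Suc n) * s\<bar> \<le> 1" by linarith
      ultimately show "norm (q n s - s) \<le> 1 / real (Suc n)"
        by (simp add: abs_divide divide_right_mono del: of_nat_Suc)
    qed
    show "(\<lambda>n. 1 / real (Suc n)) \<longlonglongrightarrow> 0"
      using LIMSEQ_inverse_real_of_nat by (simp add: inverse_eq_divide)
  qed
  have "(\<lambda>s. U (\<eta> (c s)) s) \<in> borel_measurable lebesgue"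
  proof (rule borel_measurable_LIMSEQ_real)
    show "(\<lambda>s. U (\<eta> (c (q n s))) s) \<in> borel_measurable lebesgue" for n
    proof -
      have "(\<lambda>s. (\<lambda>k s. U (\<eta> (c (real_of_int k / real (Suc n)))) s) \<lfloor>real (Suc n) * s\<rfloor> s) \<in> borel_measurable lebesgue"
      proof (rule measurable_compose_countable[where g = "\<lambda>s. \<lfloor>real (Suc n) * s\<rfloor>" and
            f = "\<lambda>k s. U (\<eta> (c (real_of_int k / real (Suc n)))) s"])
        show "(\<lambda>s. U (\<eta> (c (real_of_int k / real (Suc n)))) s) \<in> borel_measurable lebesgue" for k :: int
          by (rule measurable_potential_section[OF U Lip \<eta>[OF c]])
        have "(\<lambda>s. \<lfloor>real (Suc n) * s\<rfloor>) \<in> measurable borel (count_space UNIV)" by measurable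
        then show "(\<lambda>s. \<lfloor>real (Suc n) * s\<rfloor>) \<in> measurable lebesgue (count_space UNIV)"
          by (intro measurable_completion) simp
      qed
      then show ?thesis by (simp add: q_def)
    qed
    show "(\<lambda>n. U (\<eta> (c (q n s))) s) \<longlonglongrightarrow> U (\<eta> (c s)) s" for s
    proof (rule LIM_zero_cancel, rule Lim_null_comparison)
      show "\<forall>\<^sub>F n in sequentially. norm (U (\<eta> (c (q n s))) s - U (\<eta> (c s)) s)
          \<le> C * L2_set (\<lambda>i. \<eta> (c (q n s)) i - \<eta> (c s) i) {..<d}"
        using Lip[OF \<eta>[OF c] \<eta>[OF c]] by (intro always_eventually allI) simp
      have cq: "(\<lambda>n. c (q n s)) \<longlonglongrightarrow> c s"
        unfolding c_def by (intro tendsto_intros q)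
      have "(\<lambda>n. \<eta> (c (q n s)) i) \<longlonglongrightarrow> \<eta> (c s) i" if "i < d" for i
        using continuous_on_tendsto_compose[OF cont[OF that] cq c] c by simp
      then have "(\<lambda>n. C * sqrt (\<Sum>i<d. (\<eta> (c (q n s)) i - \<eta> (c s) i)\<^sup>2)) \<longlonglongrightarrow> C * sqrt (\<Sum>i<d. (\<eta> (c s) i - \<eta> (c s) i)\<^sup>2)"
        by (intro tendsto_intros) auto
      then show "(\<lambda>n. C * L2_set (\<lambda>i. \<eta> (c (q n s)) i - \<eta> (c s) i) {..<d}) \<longlonglongrightarrow> 0"
        by (simp add: L2_set_def)
    qed
  qed
  then have "(\<lambda>s. U (\<eta> (c s)) s) \<in> borel_measurable (lebesgue_on {a..b})"
    by (rule measurable_restrict_space1)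
  then show ?thesis
    by (rule measurable_cong[THEN iffD1, rotated]) (auto simp: c_def max_def min_def)
qed

section \<open>Strict convexity of the kinetic energy\<close>

abbreviation (input) nrm :: "nat \<Rightarrow> (nat \<Rightarrow> real) \<Rightarrow> real" where
  "nrm d v \<equiv> L2_set v {..<d}"

text \<open>Weighted arithmetic-geometric mean inequality. With y = (r m)^(\<beta>/2), the mixed
  term m^(\<beta>-1) r is a geometric mean of m^\<beta> and y when \<beta> \<ge> 2, and of r^\<beta>
  and y when \<beta> < 2. What remains is the square times 1 in the first case and times \<beta> - 1
  in the second.\<close>

lemma powr_Bregman_scalar:
  fixes r m \<beta> :: real
  assumes "\<beta> > 1" "r > 0" "m > 0"
  shows "r powr \<beta> + (\<beta> - 1) * m powr \<beta> - \<beta> * (m powr (\<beta> - 1) * r)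
    \<ge> min 1 (\<beta> - 1) * (r powr (\<beta> / 2) - m powr (\<beta> / 2))\<^sup>2"
proof -
  have sq: "(r powr (\<beta> / 2) - m powr (\<beta> / 2))\<^sup>2 = r powr \<beta> + m powr \<beta> - 2 * (r powr (\<beta> / 2) * m powr (\<beta> / 2))"
  proof -
    have "x powr (\<beta> / 2) * x powr (\<beta> / 2) = x powr \<beta>" if "x > 0" for x :: real
      using that by (simp flip: powr_add)
    then show ?thesis using assms(2,3) unfolding power2_diff by (simp add: power2_eq_square)
  qed
  define y where "y = r powr (\<beta> / 2) * m powr (\<beta> / 2)"
  have y: "y > 0" using assms by (simp add: y_def)
  have ypow: "y powr s = r powr (\<beta> / 2 * s) * m powr (\<beta> / 2 * s)" for s
    using assms by (simp add: y_def powr_mult powr_powr)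
  show ?thesis
  proof (cases "\<beta> \<ge> 2")
    case True
    have "(m powr \<beta>) powr (1 - 2 / \<beta>) * y powr (2 / \<beta>) \<le> (1 - 2 / \<beta>) * m powr \<beta> + 2 / \<beta> * y"
      using True assms y by (intro Youngs_inequality_0) auto
    moreover have "(m powr \<beta>) powr (1 - 2 / \<beta>) * y powr (2 / \<beta>) = m powr (\<beta> - 1) * r"
    proof -
      have "(m powr \<beta>) powr (1 - 2 / \<beta>) * y powr (2 / \<beta>) = m powr (\<beta> * (1 - 2 / \<beta>)) * (r * m)"
        using assms True by (simp add: powr_powr ypow)
      also have "\<dots> = (m powr (\<beta> * (1 - 2 / \<beta>)) * m powr 1) * r"
        using assms by simp
      also have "m powr (\<beta> * (1 - 2 / \<beta>)) * m powr 1 = m powr (\<beta> - 1)"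
        unfolding powr_add[symmetric] using assms by (intro arg_cong[of _ _ "\<lambda>u. m powr u"]) (simp add: field_simps)
      finally show ?thesis .
    qed
    ultimately have "\<beta> * (m powr (\<beta> - 1) * r) \<le> \<beta> * ((1 - 2 / \<beta>) * m powr \<beta> + 2 / \<beta> * y)"
      using assms by (intro mult_left_mono) auto
    also have "\<dots> = (\<beta> - 2) * m powr \<beta> + 2 * y"
      using assms by (simp add: field_simps)
    finally show ?thesis
      using True unfolding sq y_def[symmetric] by (simp add: min_def algebra_simps split: if_splits)
  next
    case False
    have "(r powr \<beta>) powr (2 / \<beta> - 1) * y powr (2 - 2 / \<beta>) \<le> (2 / \<beta> - 1) * r powr \<beta> + (2 - 2 / \<beta>) * y"
      using False assms y by (intro Youngs_inequality_0) (auto simp: field_simps)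
    moreover have "(r powr \<beta>) powr (2 / \<beta> - 1) * y powr (2 - 2 / \<beta>) = m powr (\<beta> - 1) * r"
    proof -
      have e: "\<beta> / 2 * (2 - 2 / \<beta>) = \<beta> - 1" using assms by (simp add: field_simps)
      have "(r powr \<beta>) powr (2 / \<beta> - 1) * y powr (2 - 2 / \<beta>)
          = (r powr (\<beta> * (2 / \<beta> - 1)) * r powr (\<beta> - 1)) * m powr (\<beta> - 1)"
        using assms unfolding ypow e by (simp add: powr_powr)
      also have "r powr (\<beta> * (2 / \<beta> - 1)) * r powr (\<beta> - 1) = r powr 1"
        unfolding powr_add[symmetric] using assms by (intro arg_cong[of _ _ "\<lambda>u. r powr u"]) (simp add: field_simps)
      finally show ?thesis using assms by simp
    qed
    ultimately have "\<beta> * (m powr (\<beta> - 1) * r) \<le> \<beta> * ((2 / \<beta> - 1) * r powr \<beta> + (2 - 2 / \<beta>) * y)"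
      using assms by (intro mult_left_mono) auto
    also have "\<dots> = (2 - \<beta>) * r powr \<beta> + (2 * \<beta> - 2) * y"
      using assms by (simp add: field_simps)
    finally show ?thesis
      using False assms unfolding sq y_def[symmetric] by (simp add: min_def algebra_simps)
  qed
qed

text \<open>The map V of the overview, familiar from regularity theory for the p-Laplacian with p =
  \<beta>. Its value at the zero vector is 0 also for \<beta> < 2, where the exponent is negative,
  because \<open>0 powr\<close> anything is 0.\<close>

definition Vmap :: "nat \<Rightarrow> real \<Rightarrow> (nat \<Rightarrow> real) \<Rightarrow> nat \<Rightarrow> real" where
  "Vmap d \<beta> v i = nrm d v powr (\<beta> / 2 - 1) * v i"

lemma abs_le_nrm: "i < d \<Longrightarrow> \<bar>v i\<bar> \<le> nrm d v"
  using member_le_L2_set[of "{..<d}" i "\<lambda>i. \<bar>v i\<bar>"] by (simp add: L2_set_def)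

lemma nrm_scale: "nrm d (\<lambda>i. k * v i) = \<bar>k\<bar> * nrm d v"
  unfolding L2_set_def by (simp add: power_mult_distrib real_sqrt_mult flip: sum_distrib_left)

lemma nrm_sq: "(nrm d v)\<^sup>2 = (\<Sum>i<d. (v i)\<^sup>2)"
  unfolding L2_set_def by (simp add: sum_nonneg)

lemma nrm_diff_sq: "(nrm d (\<lambda>i. v i - w i))\<^sup>2 = (nrm d v)\<^sup>2 + (nrm d w)\<^sup>2 - 2 * (\<Sum>i<d. v i * w i)"
  unfolding nrm_sq by (simp add: power2_diff sum.distrib sum_subtractf sum_distrib_left mult.assoc)

lemma nrm_inner_le: "\<bar>\<Sum>i<d. v i * w i\<bar> \<le> nrm d v * nrm d w"
  by (rule order_trans[OF sum_abs], rule order_trans[OF _ L2_set_mult_ineq]) (simp add: abs_mult)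

lemma nrm_triangle: "nrm d (\<lambda>i. v i - w i) \<le> nrm d (\<lambda>i. v i - u i) + nrm d (\<lambda>i. u i - w i)"
  using L2_set_triangle_ineq[of "\<lambda>i. v i - u i" "\<lambda>i. u i - w i" "{..<d}"] by simp

lemma nrm_Vmap: "\<beta> > 0 \<Longrightarrow> nrm d (Vmap d \<beta> v) = nrm d v powr (\<beta> / 2)"
  unfolding Vmap_def nrm_scale
  by (cases "nrm d v = 0") (simp_all add: powr_diff)

text \<open>The larger side is the Bregman divergence of |v|^\<beta>. Parallel vectors are the
  scalar lemma; for opposite ones the mixed term has the favourable sign and the bound 2 r^\<beta> +
  2 m^\<beta> for the square of a sum suffices, which is where the factor 1/2 is spent. Zero vectors
  are treated apart because the interpolation parameter \<open>lam\<close> divides by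
  \<open>r * m\<close>.\<close>

lemma powr_Bregman:
  assumes \<beta>: "\<beta> > 1"
  shows "nrm d a powr \<beta> - nrm d c powr \<beta> - \<beta> * nrm d c powr (\<beta> - 2) * (\<Sum>i<d. c i * (a i - c i))
    \<ge> min 1 (\<beta> - 1) / 2 * (nrm d (\<lambda>i. Vmap d \<beta> a i - Vmap d \<beta> c i))\<^sup>2"
proof -
  define r m t where "r = nrm d a" "m = nrm d c" "t = (\<Sum>i<d. a i * c i)"
  define k where "k = min 1 (\<beta> - 1)"
  have k: "k > 0" "k \<le> 1" "k \<le> \<beta> - 1" using \<beta> by (auto simp: k_def)
  have rm: "r \<ge> 0" "m \<ge> 0" by (simp_all add: r_m_t_def)
  have t: "\<bar>t\<bar> \<le> r * m" unfolding r_m_t_def by (rule nrm_inner_le)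
  have inner: "(\<Sum>i<d. c i * (a i - c i)) = t - m\<^sup>2"
    unfolding r_m_t_def nrm_sq by (simp add: algebra_simps sum_subtractf power2_eq_square)
  have pw: "x powr \<beta> = (x powr (\<beta> / 2))\<^sup>2" if "x \<ge> 0" for x :: real
    using that by (cases "x = 0") (simp_all add: power2_eq_square flip: powr_add)
  have W: "(nrm d (\<lambda>i. Vmap d \<beta> a i - Vmap d \<beta> c i))\<^sup>2
      = r powr \<beta> + m powr \<beta> - 2 * (r powr (\<beta> / 2 - 1) * m powr (\<beta> / 2 - 1) * t)"
  proof -
    have "(\<Sum>i<d. Vmap d \<beta> a i * Vmap d \<beta> c i) = r powr (\<beta> / 2 - 1) * m powr (\<beta> / 2 - 1) * t"
      unfolding r_m_t_def Vmap_def sum_distrib_left by (intro sum.cong refl) (simp add: algebra_simps)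
    then show ?thesis
      using \<beta> rm unfolding nrm_diff_sq by (simp add: nrm_Vmap pw r_m_t_def(1,2)[symmetric])
  qed
  have goal: "r powr \<beta> - m powr \<beta> - \<beta> * m powr (\<beta> - 2) * (t - m\<^sup>2) \<ge>
      k / 2 * (r powr \<beta> + m powr \<beta> - 2 * (r powr (\<beta> / 2 - 1) * m powr (\<beta> / 2 - 1) * t))"
  proof (cases "r = 0 \<or> m = 0")
    case True
    then have t0: "t = 0" using t by auto
    show ?thesis
    proof (cases "m = 0")
      case True
      then show ?thesis using t0 k rm mult_right_mono[of "k/2" 1 "r powr \<beta>"] by simp
    next
      case False
      then have "r = 0" "m > 0" using True rm \<open>r = 0 \<or> m = 0\<close> by auto
      moreover have "m powr (\<beta> - 2) * m\<^sup>2 = m powr \<beta>"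
        using \<open>m > 0\<close> by (simp add: powr_diff powr_realpow)
      moreover have "k / 2 * m powr \<beta> \<le> (\<beta> - 1) * m powr \<beta>"
        using k by (intro mult_right_mono) auto
      ultimately show ?thesis using t0 \<beta> by (simp add: algebra_simps)
    qed
  next
    case False
    then have rm: "r > 0" "m > 0" using rm by auto
    define lam where "lam = (1 + t / (r * m)) / 2"
    have lam: "0 \<le> lam" "lam \<le> 1"
    proof -
      have "\<bar>t / (r * m)\<bar> \<le> 1" using t rm by (simp add: abs_divide)
      then have "- 1 \<le> t / (r * m)" "t / (r * m) \<le> 1" by linarith+
      then show "0 \<le> lam" "lam \<le> 1" by (simp_all add: lam_def)
    qed
    \<comment> \<open>The claim is affine in the inner product \<open>t\<close>, so the extreme values \<open>t = r m\<close> and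
      \<open>t = - r m\<close> suffice.\<close>
    have tl: "t = lam * (r * m) + (1 - lam) * (- (r * m))"
      using rm by (simp add: lam_def field_simps)
    define F where "F t = r powr \<beta> - m powr \<beta> - \<beta> * m powr (\<beta> - 2) * (t - m\<^sup>2) -
      k / 2 * (r powr \<beta> + m powr \<beta> - 2 * (r powr (\<beta> / 2 - 1) * m powr (\<beta> / 2 - 1) * t))" for t
    have aff: "F t = lam * F (r * m) + (1 - lam) * F (- (r * m))"
      unfolding tl F_def by algebra
    have m2: "m powr (\<beta> - 2) * m\<^sup>2 = m powr \<beta>"
      using rm by (simp add: powr_diff powr_realpow)
    have m1: "m powr (\<beta> - 2) * m = m powr (\<beta> - 1)"
      using rm by (simp add: powr_diff power2_eq_square)
    have h: "x powr (\<beta> / 2 - 1) * x = x powr (\<beta> / 2)" if "x > 0" for x :: real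
      using that by (simp add: powr_diff)
    have rmh: "r powr (\<beta> / 2 - 1) * m powr (\<beta> / 2 - 1) * (r * m) = r powr (\<beta> / 2) * m powr (\<beta> / 2)"
      using h[OF rm(1)] h[OF rm(2)] by (metis mult.assoc mult.left_commute)
    have mrm: "m powr (\<beta> - 2) * (r * m) = m powr (\<beta> - 1) * r" using m1 by (metis mult.assoc mult.commute)
    have "F (r * m) = r powr \<beta> + (\<beta> - 1) * m powr \<beta> - \<beta> * (m powr (\<beta> - 1) * r)
        - k / 2 * (r powr (\<beta> / 2) - m powr (\<beta> / 2))\<^sup>2"
    proof -
      have "F (r * m) = r powr \<beta> - m powr \<beta> - \<beta> * (m powr (\<beta> - 2) * (r * m)) + \<beta> * (m powr (\<beta> - 2) * m\<^sup>2) -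
        k / 2 * (r powr \<beta> + m powr \<beta> - 2 * (r powr (\<beta> / 2 - 1) * m powr (\<beta> / 2 - 1) * (r * m)))"
        unfolding F_def by algebra
      then show ?thesis unfolding mrm m2 rmh power2_diff using rm by (simp add: pw algebra_simps)
    qed
    moreover have "k / 2 * (r powr (\<beta> / 2) - m powr (\<beta> / 2))\<^sup>2 \<le> k * (r powr (\<beta> / 2) - m powr (\<beta> / 2))\<^sup>2"
      using k by (intro mult_right_mono) auto
    ultimately have F1: "F (r * m) \<ge> 0"
      using powr_Bregman_scalar[OF \<beta> rm] unfolding k_def by linarith
    have "F (- (r * m)) = r powr \<beta> + (\<beta> - 1) * m powr \<beta> + \<beta> * (m powr (\<beta> - 1) * r)
        - k / 2 * (r powr (\<beta> / 2) + m powr (\<beta> / 2))\<^sup>2"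
    proof -
      have "F (- (r * m)) = r powr \<beta> - m powr \<beta> + \<beta> * (m powr (\<beta> - 2) * (r * m)) + \<beta> * (m powr (\<beta> - 2) * m\<^sup>2) -
        k / 2 * (r powr \<beta> + m powr \<beta> + 2 * (r powr (\<beta> / 2 - 1) * m powr (\<beta> / 2 - 1) * (r * m)))"
        unfolding F_def by algebra
      then show ?thesis unfolding mrm m2 rmh power2_sum using rm by (simp add: pw algebra_simps)
    qed
    moreover have "k / 2 * (r powr (\<beta> / 2) + m powr (\<beta> / 2))\<^sup>2 \<le> k / 2 * (2 * r powr \<beta> + 2 * m powr \<beta>)"
    proof (intro mult_left_mono)
      have "0 \<le> (r powr (\<beta> / 2) - m powr (\<beta> / 2))\<^sup>2" by simp
      then show "(r powr (\<beta> / 2) + m powr (\<beta> / 2))\<^sup>2 \<le> 2 * r powr \<beta> + 2 * m powr \<beta>"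
        unfolding power2_sum power2_diff using rm by (simp add: pw)
    qed (use k in auto)
    moreover have "k * r powr \<beta> \<le> 1 * r powr \<beta>" "k * m powr \<beta> \<le> (\<beta> - 1) * m powr \<beta>"
      using k by (intro mult_right_mono; simp)+
    moreover have "\<beta> * (m powr (\<beta> - 1) * r) \<ge> 0" using \<beta> rm by simp
    moreover have "k / 2 * (2 * r powr \<beta> + 2 * m powr \<beta>) = k * r powr \<beta> + k * m powr \<beta>"
      by (simp add: algebra_simps)
    ultimately have F2: "F (- (r * m)) \<ge> 0" by linarith
    have "F t \<ge> 0" unfolding aff using F1 F2 lam by (intro add_nonneg_nonneg mult_nonneg_nonneg) auto
    then show ?thesis unfolding F_def by linarith
  qed
  then show ?thesis
    unfolding inner W k_def[symmetric] unfolding r_m_t_def by simp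
qed

lemma powr_convex_tangent:
  assumes "\<beta> > 1"
  shows "nrm d a powr \<beta> \<ge> nrm d c powr \<beta> + \<beta> * nrm d c powr (\<beta> - 2) * (\<Sum>i<d. c i * (a i - c i))"
proof -
  have "min 1 (\<beta> - 1) / 2 * (nrm d (\<lambda>i. Vmap d \<beta> a i - Vmap d \<beta> c i))\<^sup>2 \<ge> 0"
    using assms by (intro mult_nonneg_nonneg) auto
  then show ?thesis using powr_Bregman[OF assms, where a=a and c=c and d=d] by linarith
qed

text \<open>Since |V(v)| = |v|^(\<beta>/2), the inverse of V has the same form with the exponent
  2/\<beta> - 1.\<close>

lemma Vmap_inverse:
  assumes "\<beta> > 0" "i < d"
  shows "v i = nrm d (Vmap d \<beta> v) powr (2 / \<beta> - 1) * Vmap d \<beta> v i"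
proof (cases "nrm d v = 0")
  case True
  then have "v i = 0" using assms(2) by (simp add: L2_set_eq_0_iff)
  then show ?thesis by (simp add: Vmap_def)
next
  case False
  then have "nrm d v > 0" by (simp add: less_le)
  then show ?thesis
    using assms(1) by (simp add: nrm_Vmap powr_powr Vmap_def flip: powr_add mult.assoc) (simp add: field_simps)
qed

text \<open>Continuity of the inverse of V. A zero limit is handled through the norms, because for
  \<beta> > 2 the exponent 2/\<beta> - 1 is negative and the power is not continuous at 0.\<close>

lemma tendsto_Vmap_inverse:
  assumes \<beta>: "\<beta> > 0" and i: "i < d" and lim: "\<And>i. i < d \<Longrightarrow> ((\<lambda>s. Vmap d \<beta> (v s) i) \<longlongrightarrow> w i) F"
  shows "((\<lambda>s. v s i) \<longlongrightarrow> nrm d w powr (2 / \<beta> - 1) * w i) F"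
proof -
  have nlim: "((\<lambda>s. nrm d (Vmap d \<beta> (v s))) \<longlongrightarrow> nrm d w) F"
    unfolding L2_set_def by (intro tendsto_intros lim) auto
  show ?thesis
  proof (cases "nrm d w = 0")
    case False
    have "((\<lambda>s. nrm d (Vmap d \<beta> (v s)) powr (2 / \<beta> - 1) * Vmap d \<beta> (v s) i) \<longlongrightarrow> nrm d w powr (2 / \<beta> - 1) * w i) F"
      using False by (intro tendsto_mult tendsto_powr nlim lim i tendsto_const)
    then show ?thesis using Vmap_inverse[OF \<beta> i] by simp
  next
    case True
    have "((\<lambda>s. nrm d (Vmap d \<beta> (v s)) powr (2 / \<beta>)) \<longlongrightarrow> 0 powr (2 / \<beta>)) F"
      using \<beta> nlim True by (intro tendsto_powr') auto
    then have "((\<lambda>s. nrm d (v s)) \<longlongrightarrow> 0) F"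
      using \<beta> by (simp add: nrm_Vmap powr_powr)
    then have "((\<lambda>s. v s i) \<longlongrightarrow> 0) F"
    proof (rule Lim_null_comparison[rotated])
      show "\<forall>\<^sub>F s in F. norm (v s i) \<le> nrm d (v s)"
        using abs_le_nrm[OF i] by (intro always_eventually allI) simp
    qed
    moreover have "w i = 0" using True i by (simp add: L2_set_eq_0_iff)
    ultimately show ?thesis by simp
  qed
qed

section \<open>Dyadic scales\<close>

text \<open>Discrete Gronwall inequality: each step multiplies \<open>1 + w j\<close> by at most
  \<open>1 + A * q ^ j\<close>, hence by at most \<open>exp (A * q ^ j)\<close>, and the geometric
  exponents sum to at most \<open>A / (1 - q)\<close>.\<close>

lemma one_plus_recursion_bound:
  fixes w :: "nat \<Rightarrow> real"
  assumes "A \<ge> 0" "0 < q" "q < 1" "\<And>j. w j \<ge> 0" "\<And>j. w (Suc j) \<le> w j + A * q ^ j * (1 + w j)"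
  shows "1 + w j \<le> (1 + w 0) * exp (A / (1 - q))"
proof -
  have "1 + w j \<le> (1 + w 0) * exp (A * (\<Sum>i<j. q ^ i))" for j
  proof (induction j)
    case (Suc j)
    have "1 + w (Suc j) \<le> (1 + w j) * (1 + A * q ^ j)" using assms(5)[of j] by (simp add: algebra_simps)
    also have "\<dots> \<le> (1 + w j) * exp (A * q ^ j)"
      using assms(4)[of j] by (intro mult_left_mono exp_ge_add_one_self) auto
    also have "\<dots> \<le> ((1 + w 0) * exp (A * (\<Sum>i<j. q ^ i))) * exp (A * q ^ j)"
      by (intro mult_right_mono Suc.IH) auto
    also have "\<dots> = (1 + w 0) * exp (A * (\<Sum>i<Suc j. q ^ i))"
      by (simp add: exp_add algebra_simps)
    finally show ?case .
  qed simp
  also have "(1 + w 0) * exp (A * (\<Sum>i<j. q ^ i)) \<le> (1 + w 0) * exp (A / (1 - q))"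
  proof -
    have "(\<Sum>i<j. q ^ i) = (1 - q ^ j) / (1 - q)" using assms by (simp add: sum_gp_strict)
    also have "\<dots> \<le> 1 / (1 - q)" using assms by (intro divide_right_mono) auto
    finally have "A * (\<Sum>i<j. q ^ i) \<le> A * (1 / (1 - q))" using assms(1) by (intro mult_left_mono)
    then show ?thesis using assms(4)[of 0] by (intro mult_left_mono) auto
  qed
  finally show ?thesis .
qed

text \<open>Allowing every \<open>s\<close> from \<open>\<tau> / 2\<close> up to
  \<open>\<tau>\<close>, and not only \<open>\<tau> / 2\<close>, is what upgrades convergence along
  the scales \<open>T / 2 ^ k\<close> to convergence as \<open>\<tau>\<close> tends to 0. The ratio
  \<open>q\<close> is the effect of one halving on \<open>sqrt \<tau>\<close>.\<close>

lemma dyadic_convergence: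
  fixes W :: "real \<Rightarrow> nat \<Rightarrow> real" and T A0 A1 A2 :: real
  defines "q \<equiv> sqrt (1 / 2)"
  assumes T: "T \<ge> 2" and A: "A0 \<ge> 0" "A1 \<ge> 0" "A2 \<ge> 0"
    and top: "nrm d (W T) \<le> A0"
    and step1: "\<And>s \<tau>. 0 < s \<Longrightarrow> s < \<tau> \<Longrightarrow> \<tau> \<le> T \<Longrightarrow> \<tau> \<le> 2 * s \<Longrightarrow> nrm d (\<lambda>i. W s i - W \<tau> i) \<le> A1"
    and step2: "\<And>s \<tau>. 0 < s \<Longrightarrow> s < \<tau> \<Longrightarrow> \<tau> \<le> T \<Longrightarrow> \<tau> \<le> 2 * s \<Longrightarrow>
      nrm d (\<lambda>i. W s i - W \<tau> i) \<le> A2 * sqrt \<tau> * (1 + nrm d (W \<tau>))"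
  obtains W0 where "\<And>i. i < d \<Longrightarrow> ((\<lambda>\<tau>. W \<tau> i) \<longlongrightarrow> W0 i) (at_right 0)"
    "nrm d W0 \<le> (1 + A0 + 2 * A1) / ln 2 * exp (A2 / (1 - q)) * ln T"
proof -
  define t where "t k = T / 2 ^ k" for k :: nat
  have t: "t k > 0" "t (Suc k) < t k" "t k \<le> T" "t k \<le> 2 * t (Suc k)" for k
    using T by (auto simp: t_def field_simps)
  have tri: "nrm d v \<le> nrm d w + nrm d (\<lambda>i. v i - w i)" for v w
    using L2_set_triangle_ineq[of w "\<lambda>i. v i - w i" "{..<d}"] by simp
  \<comment> \<open>The least number of halvings that brings the scale down to at most 1.\<close>
  define n where "n = nat \<lceil>log 2 T\<rceil>"
  have log1: "log 2 T \<ge> 1" using T by (simp add: le_log_iff)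
  have n: "log 2 T \<le> real n" "real n \<le> log 2 T + 1"
    using log1 unfolding n_def by linarith+
  have t1: "t (n + j) \<le> (1 / 2) ^ j" for j
  proof -
    have "T \<le> 2 powr real n" using n(1) T by (simp add: log_le_iff)
    then have "T \<le> 2 ^ n" by (simp add: powr_realpow)
    then show ?thesis by (simp add: t_def power_add power_divide field_simps)
  qed
  have large: "nrm d (W (t k)) \<le> A0 + real k * A1" for k
  proof (induction k)
    case 0 show ?case using top by (simp add: t_def)
  next
    case (Suc k)
    have "nrm d (W (t (Suc k))) \<le> nrm d (W (t k)) + A1"
      using tri[of "W (t (Suc k))" "W (t k)"] step1[OF t(1) t(2) t(3) t(4), of k] by linarith
    then show ?case using Suc by (simp add: algebra_simps)
  qed
  define w where "w j = nrm d (W (t (n + j)))" for j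
  have q: "0 < q" "q < 1" by (auto simp: q_def real_sqrt_lt_1_iff)
  have w0: "w j \<ge> 0" for j by (simp add: w_def)
  have small: "nrm d (\<lambda>i. W (t (n + Suc j)) i - W (t (n + j)) i) \<le> A2 * q ^ j * (1 + w j)" for j
  proof -
    have "nrm d (\<lambda>i. W (t (n + Suc j)) i - W (t (n + j)) i) \<le> A2 * sqrt (t (n + j)) * (1 + w j)"
      unfolding w_def using step2[OF t(1) t(2) t(3) t(4), of "n + j"] by simp
    also have "sqrt (t (n + j)) \<le> q ^ j"
      using t1[of j] unfolding q_def by (simp flip: real_sqrt_power)
    then have "A2 * sqrt (t (n + j)) * (1 + w j) \<le> A2 * q ^ j * (1 + w j)"
      using A w0[of j] by (intro mult_right_mono mult_left_mono) auto
    finally show ?thesis .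
  qed
  define E where "E = exp (A2 / (1 - q))"
  have wE: "1 + w j \<le> (1 + w 0) * E" for j
    unfolding E_def
  proof (rule one_plus_recursion_bound)
    show "w (Suc j) \<le> w j + A2 * q ^ j * (1 + w j)" for j
      using tri[of "W (t (n + Suc j))" "W (t (n + j))"] small[of j] unfolding w_def by linarith
  qed (use A q w0 in auto)
  define B where "B = (1 + w 0) * E"
  have w0B: "B \<le> (1 + A0 + 2 * A1) / ln 2 * E * ln T"
  proof -
    have "1 + w 0 \<le> 1 + A0 + real n * A1" using large[of n] by (simp add: w_def)
    also have "\<dots> \<le> 1 + A0 + (log 2 T + 1) * A1" using n A by (intro add_left_mono mult_right_mono) auto
    also have "\<dots> = (1 + A0 + A1) * 1 + A1 * log 2 T" by (simp add: algebra_simps)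
    \<comment> \<open>Here \<open>T \<ge> 2\<close> enters: \<open>log 2 T \<ge> 1\<close> absorbs
      the constant into a multiple of the logarithm.\<close>
    also have "\<dots> \<le> (1 + A0 + A1) * log 2 T + A1 * log 2 T"
      using log1 A by (intro add_right_mono mult_left_mono) auto
    also have "\<dots> = (1 + A0 + 2 * A1) / ln 2 * ln T" by (simp add: log_def algebra_simps add_divide_distrib)
    finally have "B \<le> (1 + A0 + 2 * A1) / ln 2 * ln T * E"
      unfolding B_def by (intro mult_right_mono) (auto simp: E_def)
    then show ?thesis by (simp add: algebra_simps)
  qed
  have "\<exists>l. (\<lambda>j. W (t (n + j)) i) \<longlonglongrightarrow> l" if i: "i < d" for i
  proof -
    have "summable (\<lambda>j. W (t (n + Suc j)) i - W (t (n + j)) i)"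
    proof (rule summable_comparison_test')
      show "summable (\<lambda>j. A2 * B * q ^ j)" using q by (intro summable_mult summable_geometric) auto
      fix j :: nat assume "j \<ge> 0"
      have "\<bar>W (t (n + Suc j)) i - W (t (n + j)) i\<bar> \<le> A2 * q ^ j * (1 + w j)"
        using abs_le_nrm[OF i, of "\<lambda>i. W (t (n + Suc j)) i - W (t (n + j)) i"] small[of j] by linarith
      also have "\<dots> \<le> A2 * q ^ j * B" unfolding B_def using A q by (intro mult_left_mono wE) auto
      finally show "norm (W (t (n + Suc j)) i - W (t (n + j)) i) \<le> A2 * B * q ^ j"
        by (simp add: algebra_simps)
    qed
    from summable_LIMSEQ[OF this] have "(\<lambda>j. W (t (n + j)) i - W (t (n + 0)) i) \<longlonglongrightarrow> (\<Sum>j. W (t (n + Suc j)) i - W (t (n + j)) i)"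
      by (simp only: sum_lessThan_telescope[of "\<lambda>j. W (t (n + j)) i"])
    from tendsto_add[OF this tendsto_const[of "W (t (n + 0)) i"]] show ?thesis by auto
  qed
  then obtain W0 where W0: "\<And>i. i < d \<Longrightarrow> (\<lambda>j. W (t (n + j)) i) \<longlonglongrightarrow> W0 i" by metis
  have "nrm d W0 \<le> B"
  proof (rule LIMSEQ_le_const2)
    show "(\<lambda>j. nrm d (W (t (n + j)))) \<longlonglongrightarrow> nrm d W0"
      unfolding L2_set_def by (intro tendsto_intros W0) auto
    show "\<exists>N. \<forall>j\<ge>N. nrm d (W (t (n + j))) \<le> B"
      using wE unfolding B_def w_def by (intro exI[of _ 0] allI impI) (smt (verit))
  qed
  then have bound: "nrm d W0 \<le> (1 + A0 + 2 * A1) / ln 2 * exp (A2 / (1 - q)) * ln T"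
    using w0B unfolding E_def by linarith
  show thesis
  proof (rule that[OF _ bound])
    fix i assume i: "i < d"
    show "((\<lambda>\<tau>. W \<tau> i) \<longlongrightarrow> W0 i) (at_right 0)"
    proof (rule tendstoI)
      fix e :: real assume e: "e > 0"
      have "(\<lambda>j. A2 * q ^ j * B + \<bar>W (t (n + j)) i - W0 i\<bar>) \<longlonglongrightarrow> A2 * 0 * B + \<bar>W0 i - W0 i\<bar>"
        using q by (intro tendsto_intros W0 i LIMSEQ_power_zero) auto
      then have "\<forall>\<^sub>F j in sequentially. A2 * q ^ j * B + \<bar>W (t (n + j)) i - W0 i\<bar> < e"
        by (rule order_tendstoD) (use e in simp)
      then obtain J where J: "\<And>j. j \<ge> J \<Longrightarrow> A2 * q ^ j * B + \<bar>W (t (n + j)) i - W0 i\<bar> < e"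
        by (auto simp: eventually_sequentially)
      have "dist (W \<tau> i) (W0 i) < e" if \<tau>: "\<tau> > 0" "\<tau> < t (n + J)" for \<tau>
      proof -
        have "\<exists>k. t (Suc k) \<le> \<tau>"
        proof -
          obtain k where "T / \<tau> < 2 ^ k" using real_arch_pow[of 2 "T / \<tau>"] by auto
          then have "t k < \<tau>" using \<tau> by (simp add: t_def field_simps)
          then show ?thesis using t(2)[of k] by (intro exI[of _ k]) linarith
        qed
        \<comment> \<open>The dyadic bracket of \<open>\<tau>\<close>:
          \<open>t (Suc k) \<le> \<tau> < t k\<close>, so a single use of \<open>step2\<close>
          compares \<open>W \<tau>\<close> with \<open>W (t k)\<close>.\<close>
        define k where "k = (LEAST k. t (Suc k) \<le> \<tau>)"
        have k1: "t (Suc k) \<le> \<tau>" unfolding k_def by (rule LeastI_ex) fact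
        have k2: "\<tau> < t k"
        proof (cases k)
          case 0 then show ?thesis using \<tau> t(3)[of "n + J"] by (simp add: t_def)
        next
          case (Suc l)
          then have "\<not> t (Suc l) \<le> \<tau>" using not_less_Least[of l "\<lambda>k. t (Suc k) \<le> \<tau>"] by (simp add: k_def)
          then show ?thesis using Suc by simp
        qed
        have "k \<ge> n + J"
        proof (rule ccontr)
          assume "\<not> k \<ge> n + J"
          then have "Suc k \<le> n + J" by simp
          then have "t (n + J) \<le> t (Suc k)" using T by (simp add: t_def frac_le power_increasing del: power_Suc)
          then show False using k1 \<tau> by linarith
        qed
        define j where "j = k - n"
        have j: "k = n + j" "j \<ge> J" using \<open>k \<ge> n + J\<close> by (auto simp: j_def)
        have "t k \<le> 2 * \<tau>" using t(4)[of k] k1 by linarith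
        from step2[OF \<tau>(1) k2 t(3) this] have "\<bar>W \<tau> i - W (t k) i\<bar> \<le> A2 * sqrt (t k) * (1 + w j)"
          using abs_le_nrm[OF i, of "\<lambda>i. W \<tau> i - W (t k) i"] unfolding w_def j(1)[symmetric] by linarith
        also have "\<dots> \<le> A2 * q ^ j * B"
        proof -
          have "sqrt (t k) \<le> q ^ j" using t1[of j] unfolding q_def j(1) by (simp flip: real_sqrt_power)
          then have "A2 * sqrt (t k) * (1 + w j) \<le> A2 * q ^ j * (1 + w j)"
            using A w0[of j] by (intro mult_right_mono mult_left_mono) auto
          also have "\<dots> \<le> A2 * q ^ j * B"
            unfolding B_def using A q by (intro mult_left_mono wE) auto
          finally show ?thesis .
        qed
        finally show ?thesis using J[OF j(2)] unfolding dist_real_def j(1) by linarith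
      qed
      then show "\<forall>\<^sub>F \<tau> in at_right 0. dist (W \<tau> i) (W0 i) < e"
        unfolding eventually_at_right_field using t(1)[of "n + J"] by (intro exI[of _ "t (n + J)"]) auto
    qed
  qed
qed

section \<open>Absolutely continuous curves\<close>

text \<open>Divisions are matched with sets of endpoint pairs. Degenerate intervals have no
  admissible pair \<open>a < b\<close> and are dropped, at no cost since their increments are
  0.\<close>

lemma abs_continuous_curve_component:
  assumes \<gamma>: "abs_continuous_curve d t1 t2 \<gamma>" and i: "i < d"
  shows "abs_cont t1 t2 (\<lambda>s. \<gamma> s i)"
  unfolding abs_cont_def
proof (intro allI impI)
  fix \<epsilon> :: real assume "\<epsilon> > 0"
  then obtain \<delta> where \<delta>: "\<delta> > 0" and AC: "\<And>P. finite P \<Longrightarrow>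
      (\<forall>(a, b)\<in>P. t1 \<le> a \<and> a < b \<and> b \<le> t2) \<Longrightarrow>
      pairwise (\<lambda>p q. disjnt {fst p<..<snd p} {fst q<..<snd q}) P \<Longrightarrow>
      (\<Sum>(a, b)\<in>P. b - a) < \<delta> \<Longrightarrow>
      (\<Sum>(a, b)\<in>P. nrm d (\<lambda>i. \<gamma> b i - \<gamma> a i)) < \<epsilon>"
    using \<gamma> unfolding abs_continuous_curve_def by meson
  show "\<exists>\<delta>>0. \<forall>D. D division_of \<Union>D \<longrightarrow> \<Union>D \<subseteq> {t1..t2} \<longrightarrow>
      sum content D < \<delta> \<longrightarrow> (\<Sum>K\<in>D. \<bar>increment (\<lambda>s. \<gamma> s i) K\<bar>) < \<epsilon>"
  proof (intro exI[of _ \<delta>] conjI allI impI)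
    fix D :: "real set set"
    assume D: "D division_of \<Union>D" and sub: "\<Union>D \<subseteq> {t1..t2}" and len: "sum content D < \<delta>"
    define D' where "D' = {K \<in> D. Inf K < Sup K}"
    define e where "e K = (Inf K, Sup K)" for K :: "real set"
    have box: "\<exists>u v. u \<le> v \<and> K = {u..v}" if K: "K \<in> D" for K
    proof -
      obtain u v where "K = cbox u v" "K \<noteq> {}" using division_ofD(3,4)[OF D K] by blast
      then show ?thesis by (intro exI[of _ u] exI[of _ v]) auto
    qed
    have KD: "K = {Inf K..Sup K} \<and> Inf K \<le> Sup K" if K: "K \<in> D" for K
    proof -
      obtain u v where "u \<le> v" "K = {u..v}" using box[OF K] by blast
      then show ?thesis by simp
    qed
    have fin: "finite D" "finite D'" using D by (auto simp: D'_def)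
    have inj: "inj_on e D'"
      by (rule inj_onI) (metis (mono_tags, lifting) D'_def KD e_def mem_Collect_eq prod.inject)
    have "(\<Sum>(a, b)\<in>e ` D'. nrm d (\<lambda>i. \<gamma> b i - \<gamma> a i)) < \<epsilon>"
    proof (rule AC)
      show "finite (e ` D')" using fin by simp
      have "t1 \<le> Inf K \<and> Inf K < Sup K \<and> Sup K \<le> t2" if K: "K \<in> D'" for K
      proof -
        have "K \<in> D" "Inf K < Sup K" using K by (auto simp: D'_def)
        moreover have "Inf K \<in> K" "Sup K \<in> K"
          using KD[OF \<open>K \<in> D\<close>] by (metis atLeastAtMost_iff order_refl)+
        ultimately have "Inf K \<in> {t1..t2}" "Sup K \<in> {t1..t2}" using sub by blast+
        then show ?thesis using \<open>Inf K < Sup K\<close> by simp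
      qed
      then show "\<forall>(a, b)\<in>e ` D'. t1 \<le> a \<and> a < b \<and> b \<le> t2" by (auto simp: e_def)
      show "pairwise (\<lambda>p q. disjnt {fst p<..<snd p} {fst q<..<snd q}) (e ` D')"
      proof (rule pairwise_imageI)
        fix K L assume KL: "K \<in> D'" "L \<in> D'" "K \<noteq> L"
        then have "K \<in> D" "L \<in> D" "K \<noteq> L" by (auto simp: D'_def)
        then have "interior K \<inter> interior L = {}" using division_ofD(5)[OF D] by blast
        moreover have "interior K = {Inf K<..<Sup K}" "interior L = {Inf L<..<Sup L}"
          using KD \<open>K \<in> D\<close> \<open>L \<in> D\<close> by (metis interior_atLeastAtMost_real)+
        ultimately show "disjnt {fst (e K)<..<snd (e K)} {fst (e L)<..<snd (e L)}"
          by (simp add: e_def disjnt_def)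
      qed
      have "(\<Sum>(a, b)\<in>e ` D'. b - a) = (\<Sum>K\<in>D'. Sup K - Inf K)"
        by (subst sum.reindex[OF inj]) (simp add: e_def)
      also have "\<dots> = (\<Sum>K\<in>D'. content K)"
      proof (rule sum.cong[OF refl])
        fix K assume "K \<in> D'"
        then have "K \<in> D" by (simp add: D'_def)
        then obtain u v where "u \<le> v" "K = {u..v}" using box by blast
        then show "Sup K - Inf K = content K" by simp
      qed
      also have "\<dots> \<le> sum content D"
        by (rule sum_mono2) (use fin in \<open>auto simp: D'_def\<close>)
      finally show "(\<Sum>(a, b)\<in>e ` D'. b - a) < \<delta>" using len by linarith
    qed
    moreover have "(\<Sum>(a, b)\<in>e ` D'. nrm d (\<lambda>i. \<gamma> b i - \<gamma> a i))
        = (\<Sum>K\<in>D'. nrm d (\<lambda>i. \<gamma> (Sup K) i - \<gamma> (Inf K) i))"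
      by (subst sum.reindex[OF inj]) (simp add: e_def)
    moreover have "(\<Sum>K\<in>D. \<bar>increment (\<lambda>s. \<gamma> s i) K\<bar>) = (\<Sum>K\<in>D'. \<bar>increment (\<lambda>s. \<gamma> s i) K\<bar>)"
    proof (rule sum.mono_neutral_right)
      show "\<forall>K\<in>D - D'. \<bar>increment (\<lambda>s. \<gamma> s i) K\<bar> = 0"
      proof
        fix K assume "K \<in> D - D'"
        then have "Inf K = Sup K" using KD[of K] by (auto simp: D'_def)
        then show "\<bar>increment (\<lambda>s. \<gamma> s i) K\<bar> = 0" by (simp add: increment_def)
      qed
    qed (use fin in \<open>auto simp: D'_def\<close>)
    moreover have "\<dots> \<le> (\<Sum>K\<in>D'. nrm d (\<lambda>i. \<gamma> (Sup K) i - \<gamma> (Inf K) i))"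
    proof (rule sum_mono)
      show "\<bar>increment (\<lambda>s. \<gamma> s i) K\<bar> \<le> nrm d (\<lambda>i. \<gamma> (Sup K) i - \<gamma> (Inf K) i)" for K
        using abs_le_nrm[OF i, of "\<lambda>i. \<gamma> (Sup K) i - \<gamma> (Inf K) i"] by (simp add: increment_def)
    qed
    ultimately show "(\<Sum>K\<in>D. \<bar>increment (\<lambda>s. \<gamma> s i) K\<bar>) < \<epsilon>" by linarith
  qed (rule \<delta>)
qed

lemma abs_cont_continuous_on:
  assumes "abs_cont a b f"
  shows "continuous_on {a..b} f"
proof (rule continuous_onI)
  fix x e :: real assume x: "x \<in> {a..b}" and e: "e > 0"
  from abs_contD[OF assms e] obtain \<delta> where \<delta>: "\<delta> > 0"
    "\<And>D. D division_of \<Union>D \<Longrightarrow> \<Union>D \<subseteq> {a..b} \<Longrightarrow> sum content D < \<delta> \<Longrightarrow>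
      (\<Sum>K\<in>D. \<bar>increment f K\<bar>) < e"
    by metis
  have two: "\<bar>f v - f u\<bar> < e" if "u \<le> v" "{u..v} \<subseteq> {a..b}" "v - u < \<delta>" for u v
  proof -
    have "{cbox u v} division_of cbox u v"
      using that by (intro division_of_self) auto
    then have "{cbox u v} division_of \<Union>{cbox u v}" by simp
    from \<delta>(2)[OF this] show ?thesis using that by (simp add: increment_def)
  qed
  show "\<exists>d>0. \<forall>y\<in>{a..b}. dist y x < d \<longrightarrow> dist (f y) (f x) \<le> e"
  proof (intro exI[of _ \<delta>] conjI ballI impI)
    fix y assume y: "y \<in> {a..b}" "dist y x < \<delta>"
    show "dist (f y) (f x) \<le> e"
    proof (cases "x \<le> y")
      case True
      then have "\<bar>f y - f x\<bar> < e" using x y by (intro two) (auto simp: dist_real_def)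
      then show ?thesis by (simp add: dist_real_def)
    next
      case False
      then have "\<bar>f x - f y\<bar> < e" using x y by (intro two) (auto simp: dist_real_def)
      then show ?thesis by (simp add: dist_real_def)
    qed
  qed (rule \<delta>)
qed

lemma abs_cont_subset:
  assumes "abs_cont a b f" "a \<le> c" "e \<le> b"
  shows "abs_cont c e f"
  unfolding abs_cont_def
proof (intro allI impI)
  fix \<epsilon> :: real assume "\<epsilon> > 0"
  from abs_contD[OF assms(1) this] obtain \<delta> where \<delta>: "\<delta> > 0"
    "\<And>D. D division_of \<Union>D \<Longrightarrow> \<Union>D \<subseteq> {a..b} \<Longrightarrow> sum content D < \<delta> \<Longrightarrow>
      (\<Sum>K\<in>D. \<bar>increment f K\<bar>) < \<epsilon>"
    by metis
  have "{c..e} \<subseteq> {a..b}" using assms by auto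
  then show "\<exists>\<delta>>0. \<forall>D. D division_of \<Union>D \<longrightarrow> \<Union>D \<subseteq> {c..e} \<longrightarrow>
      sum content D < \<delta> \<longrightarrow> (\<Sum>K\<in>D. \<bar>increment f K\<bar>) < \<epsilon>"
    using \<delta> by (meson subset_trans)
qed

section \<open>Velocity and kinetic energy of a curve\<close>

lemma curve_velocity_ae:
  assumes \<gamma>: "abs_continuous_curve d t1 t2 \<gamma>" and "t1 < t2"
  obtains N where "negligible N"
    "\<And>s i. s \<in> {t1..t2} - N \<Longrightarrow> i < d \<Longrightarrow>
      ((\<lambda>s. \<gamma> s i) has_vector_derivative curve_velocity t1 t2 \<gamma> s i) (at s within {t1..t2})"
proof -
  have "\<exists>N. negligible N \<and> (\<forall>s\<in>{t1..t2} - N. (\<lambda>s. \<gamma> s i) differentiable (at s))" if "i < d" for i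
    using abs_cont_differentiable_ae[OF abs_continuous_curve_component[OF \<gamma> that]] by metis
  then obtain N where N: "\<And>i. i < d \<Longrightarrow> negligible (N i)"
      "\<And>i s. i < d \<Longrightarrow> s \<in> {t1..t2} - N i \<Longrightarrow> (\<lambda>s. \<gamma> s i) differentiable (at s)"
    by metis
  show thesis
  proof (rule that[of "\<Union>i<d. N i"])
    show "negligible (\<Union>i<d. N i)" using N(1) by (intro negligible_Union) auto
    fix s i assume s: "s \<in> {t1..t2} - (\<Union>i<d. N i)" and i: "i < d"
    then have "(\<lambda>s. \<gamma> s i) differentiable (at s within {t1..t2})"
      using N(2)[OF i, of s] by (auto intro: differentiable_at_withinI)
    then show "((\<lambda>s. \<gamma> s i) has_vector_derivative curve_velocity t1 t2 \<gamma> s i) (at s within {t1..t2})"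
      unfolding curve_velocity_def by (simp add: vector_derivative_works)
  qed
qed

lemma curve_velocity_has_integral:
  assumes \<gamma>: "abs_continuous_curve d t1 t2 \<gamma>" and "t1 < t2" and i: "i < d"
    and ab: "t1 \<le> a" "a \<le> b" "b \<le> t2"
  shows "((\<lambda>s. curve_velocity t1 t2 \<gamma> s i) has_integral (\<gamma> b i - \<gamma> a i)) {a..b}"
proof -
  obtain N where N: "negligible N" "\<And>s i. s \<in> {t1..t2} - N \<Longrightarrow> i < d \<Longrightarrow>
      ((\<lambda>s. \<gamma> s i) has_vector_derivative curve_velocity t1 t2 \<gamma> s i) (at s within {t1..t2})"
    using curve_velocity_ae[OF \<gamma> \<open>t1 < t2\<close>] by metis
  show ?thesis
  proof (rule abs_cont_has_integral[OF abs_cont_subset ab(2) N(1)])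
    show "abs_cont t1 t2 (\<lambda>s. \<gamma> s i)" by (rule abs_continuous_curve_component[OF \<gamma> i])
    fix s assume "s \<in> {a..b} - N"
    then have "s \<in> {t1..t2} - N" using ab by auto
    from N(2)[OF this i] show "((\<lambda>s. \<gamma> s i) has_vector_derivative curve_velocity t1 t2 \<gamma> s i) (at s within {a..b})"
      by (rule has_vector_derivative_within_subset) (use ab in auto)
  qed (use ab in auto)
qed

text \<open>The factor \<open>1 / \<beta>\<close> of the action is left out here and put back in
  \<open>action_eq\<close>.\<close>

definition kinetic :: "nat \<Rightarrow> real \<Rightarrow> real \<Rightarrow> real \<Rightarrow> (real \<Rightarrow> nat \<Rightarrow> real) \<Rightarrow> real \<Rightarrow> real" where
  "kinetic d \<beta> t1 t2 \<gamma> s = nrm d (curve_velocity t1 t2 \<gamma> s) powr \<beta>"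

text \<open>Each velocity component is gauge integrable and therefore Lebesgue measurable.\<close>

lemma kinetic_measurable:
  assumes \<gamma>: "abs_continuous_curve d t1 t2 \<gamma>" and "t1 < t2"
  shows "kinetic d \<beta> t1 t2 \<gamma> \<in> borel_measurable (lebesgue_on {t1..t2})"
proof -
  have [measurable]: "(\<lambda>s. curve_velocity t1 t2 \<gamma> s i) \<in> borel_measurable (lebesgue_on {t1..t2})" if "i < d" for i
  proof -
    have "((\<lambda>s. curve_velocity t1 t2 \<gamma> s i) has_integral (\<gamma> t2 i - \<gamma> t1 i)) (cbox t1 t2)"
      using curve_velocity_has_integral[OF \<gamma> \<open>t1 < t2\<close> that] \<open>t1 < t2\<close> by simp
    from has_integral_implies_lebesgue_measurable_cbox[OF this] show ?thesis by simp
  qed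
  show ?thesis unfolding kinetic_def L2_set_def by measurable
qed

text \<open>Jensen's inequality: the tangent inequality for |v|^\<beta> at the mean velocity
  \<open>c\<close> is integrated, and its linear term has integral 0.\<close>

lemma kinetic_has_integral_ge:
  assumes \<beta>: "\<beta> > 1" and \<gamma>: "abs_continuous_curve d t1 t2 \<gamma>" and "t1 < t2"
    and ab: "t1 \<le> a" "a < b" "b \<le> t2" and int: "kinetic d \<beta> t1 t2 \<gamma> integrable_on {a..b}"
  shows "(b - a) * nrm d (\<lambda>i. (\<gamma> b i - \<gamma> a i) / (b - a)) powr \<beta> \<le> integral {a..b} (kinetic d \<beta> t1 t2 \<gamma>)"
proof -
  define c where "c = (\<lambda>i. (\<gamma> b i - \<gamma> a i) / (b - a))"
  define k where "k = \<beta> * nrm d c powr (\<beta> - 2)"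
  define v where "v s i = curve_velocity t1 t2 \<gamma> s i" for s i
  have v: "((\<lambda>s. v s i) has_integral (b - a) * c i) {a..b}" if "i < d" for i
    using curve_velocity_has_integral[OF \<gamma> \<open>t1 < t2\<close> that ab(1) _ ab(3)] ab unfolding v_def c_def by simp
  have "((\<lambda>s. nrm d c powr \<beta> + k * (\<Sum>i<d. c i * (v s i - c i))) has_integral
      (b - a) * nrm d c powr \<beta> + k * (\<Sum>i<d. c i * ((b - a) * c i - (b - a) * c i))) {a..b}"
  proof (intro has_integral_add has_integral_mult_right has_integral_sum has_integral_diff v)
    show "((\<lambda>s. nrm d c powr \<beta>) has_integral (b - a) * nrm d c powr \<beta>) {a..b}"
      using has_integral_const_real[of "nrm d c powr \<beta>" a b] ab by simp
    show "((\<lambda>s. c i) has_integral (b - a) * c i) {a..b}" for i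
      using has_integral_const_real[of "c i" a b] ab by simp
  qed auto
  then have "(b - a) * nrm d c powr \<beta> + k * (\<Sum>i<d. c i * ((b - a) * c i - (b - a) * c i)) \<le> integral {a..b} (kinetic d \<beta> t1 t2 \<gamma>)"
  proof (rule has_integral_le[OF _ integrable_integral[OF int]])
    fix s
    show "nrm d c powr \<beta> + k * (\<Sum>i<d. c i * (v s i - c i)) \<le> kinetic d \<beta> t1 t2 \<gamma> s"
      using powr_convex_tangent[OF \<beta>, where d = d and c = c and a = "curve_velocity t1 t2 \<gamma> s"] by (simp add: kinetic_def v_def k_def)
  qed
  then show ?thesis by (simp add: c_def)
qed

text \<open>With \<open>w = 0\<close> and suitable \<open>v\<close> this is the competitor that reaches \<open>x\<close> along a chord; with \<open>s = t1\<close>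
  and \<open>v = 0\<close> it is a constant curve.\<close>

definition spliced_curve :: "nat \<Rightarrow> (real \<Rightarrow> nat \<Rightarrow> real) \<Rightarrow> real \<Rightarrow> (nat \<Rightarrow> real) \<Rightarrow> (nat \<Rightarrow> real) \<Rightarrow> real \<Rightarrow> nat \<Rightarrow> real" where
  "spliced_curve d \<gamma> s v w r = (\<lambda>i\<in>{..<d}. \<gamma> (min r s) i + max (r - s) 0 * v i + w i)"

lemma spliced_curve_abs_continuous:
  assumes \<gamma>: "abs_continuous_curve d t1 t2 \<gamma>" and s: "t1 \<le> s" "s \<le> t2"
  shows "abs_continuous_curve d t1 t2 (spliced_curve d \<gamma> s v w)"
  unfolding abs_continuous_curve_def
proof (intro conjI allI impI)
  show "spliced_curve d \<gamma> s v w \<in> {t1..t2} \<rightarrow> Rn d" by (auto simp: spliced_curve_def)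
  fix \<epsilon> :: real assume "\<epsilon> > 0"
  then have "\<epsilon> / 2 > 0" by simp
  then obtain \<delta> where \<delta>: "\<delta> > 0" and AC: "\<And>P. finite P \<Longrightarrow>
      (\<forall>(a, b)\<in>P. t1 \<le> a \<and> a < b \<and> b \<le> t2) \<Longrightarrow>
      pairwise (\<lambda>p q. disjnt {fst p<..<snd p} {fst q<..<snd q}) P \<Longrightarrow>
      (\<Sum>(a, b)\<in>P. b - a) < \<delta> \<Longrightarrow>
      (\<Sum>(a, b)\<in>P. nrm d (\<lambda>i. \<gamma> b i - \<gamma> a i)) < \<epsilon> / 2"
    using \<gamma> unfolding abs_continuous_curve_def by meson
  \<comment> \<open>\<open>\<delta>\<close> serves the part that follows \<open>\<gamma>\<close>,
    the second bound the straight part with velocity \<open>v\<close>; each contributes less than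
    \<open>\<epsilon> / 2\<close>. The added 1 covers \<open>v = 0\<close>.\<close>
  define \<delta>' where "\<delta>' = min \<delta> (\<epsilon> / (2 * (nrm d v + 1)))"
  have n0: "nrm d v \<ge> 0" by simp
  have nrm_lip: "nrm d (\<lambda>i. spliced_curve d \<gamma> s v w b i - spliced_curve d \<gamma> s v w a i)
      \<le> nrm d (\<lambda>i. \<gamma> (min b s) i - \<gamma> (min a s) i) + (b - a) * nrm d v" if "a < b" for a b
  proof -
    define m where "m = max (b - s) 0 - max (a - s) 0"
    have m: "0 \<le> m" "m \<le> b - a" using that by (auto simp: m_def)
    have "nrm d (\<lambda>i. spliced_curve d \<gamma> s v w b i - spliced_curve d \<gamma> s v w a i)
        = nrm d (\<lambda>i. (\<gamma> (min b s) i - \<gamma> (min a s) i) + m * v i)"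
      by (rule L2_set_cong) (auto simp: spliced_curve_def m_def algebra_simps)
    also have "\<dots> \<le> nrm d (\<lambda>i. \<gamma> (min b s) i - \<gamma> (min a s) i) + nrm d (\<lambda>i. m * v i)"
      by (rule L2_set_triangle_ineq)
    also have "nrm d (\<lambda>i. m * v i) \<le> (b - a) * nrm d v"
      using m n0 by (simp add: nrm_scale mult_right_mono)
    finally show ?thesis by simp
  qed
  show "\<exists>\<delta>>0. \<forall>P. finite P \<longrightarrow>
      (\<forall>(a, b)\<in>P. t1 \<le> a \<and> a < b \<and> b \<le> t2) \<longrightarrow>
      pairwise (\<lambda>p q. disjnt {fst p<..<snd p} {fst q<..<snd q}) P \<longrightarrow>
      (\<Sum>(a, b)\<in>P. b - a) < \<delta> \<longrightarrow>
      (\<Sum>(a, b)\<in>P. nrm d (\<lambda>i. spliced_curve d \<gamma> s v w b i - spliced_curve d \<gamma> s v w a i)) < \<epsilon>"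
  proof (intro exI[of _ \<delta>'] conjI allI impI)
    show "\<delta>' > 0" using \<delta> \<open>\<epsilon> > 0\<close> n0 by (simp add: \<delta>'_def add_nonneg_pos)
    fix P :: "(real \<times> real) set"
    assume fin: "finite P" and P: "\<forall>(a, b)\<in>P. t1 \<le> a \<and> a < b \<and> b \<le> t2"
      and dj: "pairwise (\<lambda>p q. disjnt {fst p<..<snd p} {fst q<..<snd q}) P"
      and len: "(\<Sum>(a, b)\<in>P. b - a) < \<delta>'"
    have Pd: "t1 \<le> fst p" "fst p < snd p" "snd p \<le> t2" if "p \<in> P" for p
      using P that by (auto simp: case_prod_beta)
    \<comment> \<open>Only pairs starting before \<open>s\<close> involve \<open>\<gamma>\<close> at
      varying times; they are cut off at \<open>s\<close>. The cut \<open>e\<close> remains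
      injective because disjoint nonempty intervals have distinct left endpoints.\<close>
    define Q where "Q = {p \<in> P. fst p < s}"
    define e where "e p = (fst p, min (snd p) s)" for p :: "real \<times> real"
    have inj: "inj_on e Q"
    proof (rule inj_onI, rule ccontr)
      fix p q assume pq: "p \<in> Q" "q \<in> Q" "e p = e q" "p \<noteq> q"
      then have "p \<in> P" "q \<in> P" "fst p = fst q" by (auto simp: Q_def e_def)
      then have "{fst p<..<snd p} \<inter> {fst p<..<snd q} = {}"
        using dj pq(4) unfolding pairwise_def disjnt_def by metis
      moreover have "{fst p<..<snd p} \<inter> {fst p<..<snd q} = {fst p<..<min (snd p) (snd q)}" by auto
      ultimately show False
        using Pd(2)[OF \<open>p \<in> P\<close>] Pd(2)[OF \<open>q \<in> P\<close>] \<open>fst p = fst q\<close> by (simp add: greaterThanLessThan_empty_iff)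
    qed
    have "(\<Sum>(a, b)\<in>e ` Q. nrm d (\<lambda>i. \<gamma> b i - \<gamma> a i)) < \<epsilon> / 2"
    proof (rule AC)
      show "finite (e ` Q)" using fin by (simp add: Q_def)
      show "\<forall>(a, b)\<in>e ` Q. t1 \<le> a \<and> a < b \<and> b \<le> t2"
        using Pd s by (auto simp: e_def Q_def min_le_iff_disj)
      show "pairwise (\<lambda>p q. disjnt {fst p<..<snd p} {fst q<..<snd q}) (e ` Q)"
      proof (rule pairwise_imageI)
        fix p q assume pq: "p \<in> Q" "q \<in> Q" "p \<noteq> q"
        then have "{fst p<..<snd p} \<inter> {fst q<..<snd q} = {}"
          using dj unfolding pairwise_def disjnt_def Q_def by blast
        then show "disjnt {fst (e p)<..<snd (e p)} {fst (e q)<..<snd (e q)}"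
          unfolding disjnt_def e_def by auto
      qed
      have "(\<Sum>(a, b)\<in>e ` Q. b - a) = (\<Sum>p\<in>Q. min (snd p) s - fst p)"
        by (subst sum.reindex[OF inj]) (simp add: e_def)
      also have "\<dots> \<le> (\<Sum>p\<in>Q. snd p - fst p)" by (intro sum_mono) auto
      also have "\<dots> \<le> (\<Sum>p\<in>P. snd p - fst p)"
        using fin Pd(2) by (intro sum_mono2) (auto simp: Q_def less_imp_le)
      finally show "(\<Sum>(a, b)\<in>e ` Q. b - a) < \<delta>" using len by (simp add: \<delta>'_def case_prod_beta)
    qed
    moreover have "(\<Sum>(a, b)\<in>e ` Q. nrm d (\<lambda>i. \<gamma> b i - \<gamma> a i))
        = (\<Sum>p\<in>Q. nrm d (\<lambda>i. \<gamma> (min (snd p) s) i - \<gamma> (min (fst p) s) i))"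
      by (subst sum.reindex[OF inj]) (auto simp: e_def Q_def min_def intro!: sum.cong)
    moreover have "\<dots> = (\<Sum>p\<in>P. nrm d (\<lambda>i. \<gamma> (min (snd p) s) i - \<gamma> (min (fst p) s) i))"
    proof (rule sum.mono_neutral_left[OF fin])
      show "\<forall>p\<in>P - Q. nrm d (\<lambda>i. \<gamma> (min (snd p) s) i - \<gamma> (min (fst p) s) i) = 0"
      proof
        fix p assume "p \<in> P - Q"
        then have "min (snd p) s = s" "min (fst p) s = s" using Pd(2)[of p] by (auto simp: Q_def)
        then show "nrm d (\<lambda>i. \<gamma> (min (snd p) s) i - \<gamma> (min (fst p) s) i) = 0" by (simp add: L2_set_def)
      qed
    qed (auto simp: Q_def)
    ultimately have 1: "(\<Sum>p\<in>P. nrm d (\<lambda>i. \<gamma> (min (snd p) s) i - \<gamma> (min (fst p) s) i)) < \<epsilon> / 2" by simp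
    define l where "l = (\<Sum>p\<in>P. snd p - fst p)"
    have l: "l \<ge> 0" "l < \<epsilon> / (2 * (nrm d v + 1))"
    proof -
      show "l \<ge> 0" unfolding l_def using Pd(2) by (intro sum_nonneg) (simp add: less_imp_le)
      show "l < \<epsilon> / (2 * (nrm d v + 1))" using len by (simp add: l_def \<delta>'_def case_prod_beta)
    qed
    have "l * nrm d v \<le> l * (nrm d v + 1)" using l by (intro mult_left_mono) auto
    also have "\<dots> < \<epsilon> / 2" using l(2) n0 by (simp add: field_simps add_nonneg_pos)
    finally have 2: "l * nrm d v < \<epsilon> / 2" .
    have "(\<Sum>p\<in>P. nrm d (\<lambda>i. spliced_curve d \<gamma> s v w (snd p) i - spliced_curve d \<gamma> s v w (fst p) i))
        \<le> (\<Sum>p\<in>P. nrm d (\<lambda>i. \<gamma> (min (snd p) s) i - \<gamma> (min (fst p) s) i) + (snd p - fst p) * nrm d v)"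
      by (intro sum_mono nrm_lip Pd)
    also have "\<dots> = (\<Sum>p\<in>P. nrm d (\<lambda>i. \<gamma> (min (snd p) s) i - \<gamma> (min (fst p) s) i)) + l * nrm d v"
      by (simp add: sum.distrib l_def sum_distrib_right)
    finally have "(\<Sum>p\<in>P. nrm d (\<lambda>i. spliced_curve d \<gamma> s v w (snd p) i - spliced_curve d \<gamma> s v w (fst p) i)) < \<epsilon>"
      using 1 2 by linarith
    then show "(\<Sum>(a, b)\<in>P. nrm d (\<lambda>i. spliced_curve d \<gamma> s v w b i - spliced_curve d \<gamma> s v w a i)) < \<epsilon>"
      by (simp only: split_def)
  qed
qed

section \<open>Minimizing curves\<close>

lemma spliced_curve_velocity:
  assumes \<gamma>: "abs_continuous_curve d t1 t2 \<gamma>" and "t1 < t2"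
  obtains N where "negligible N"
    "\<And>r i. r \<in> {t1..t2} - N \<Longrightarrow> i < d \<Longrightarrow> curve_velocity t1 t2 (spliced_curve d \<gamma> s v w) r i =
      (if r < s then curve_velocity t1 t2 \<gamma> r i else v i)"
proof -
  obtain N where N: "negligible N" "\<And>r i. r \<in> {t1..t2} - N \<Longrightarrow> i < d \<Longrightarrow>
      ((\<lambda>s. \<gamma> s i) has_vector_derivative curve_velocity t1 t2 \<gamma> r i) (at r within {t1..t2})"
    using curve_velocity_ae[OF \<gamma> \<open>t1 < t2\<close>] by metis
  show thesis
  proof (rule that[of "insert s N"])
    show "negligible (insert s N)" using N(1) by (simp add: negligible_insert)
    fix r i assume r: "r \<in> {t1..t2} - insert s N" and i: "i < d"
    then have "r \<noteq> s" by simp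
    show "curve_velocity t1 t2 (spliced_curve d \<gamma> s v w) r i =
      (if r < s then curve_velocity t1 t2 \<gamma> r i else v i)"
    proof (cases "r < s")
      case True
      have "((\<lambda>q. \<gamma> q i + w i) has_vector_derivative curve_velocity t1 t2 \<gamma> r i + 0) (at r within {t1..t2})"
        using r i by (intro has_vector_derivative_add has_vector_derivative_const N(2)) auto
      then have "((\<lambda>q. spliced_curve d \<gamma> s v w q i) has_vector_derivative curve_velocity t1 t2 \<gamma> r i) (at r within {t1..t2})"
        by (rule has_vector_derivative_transform_within[where d = "s - r", OF has_vector_derivative_eq_rhs])
          (use True i r in \<open>auto simp: spliced_curve_def dist_real_def min_def max_def\<close>)
      then show ?thesis
        using True vector_derivative_within_cbox[OF \<open>t1 < t2\<close>, of r] r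
        unfolding curve_velocity_def[of t1 t2 "spliced_curve d \<gamma> s v w"] by simp
    next
      case False
      then have "s < r" using \<open>r \<noteq> s\<close> by simp
      have "((\<lambda>q. \<gamma> s i + (q - s) * v i + w i) has_vector_derivative v i) (at r within {t1..t2})"
        by (auto intro!: derivative_eq_intros simp flip: has_real_derivative_iff_has_vector_derivative)
      then have "((\<lambda>q. spliced_curve d \<gamma> s v w q i) has_vector_derivative v i) (at r within {t1..t2})"
        by (rule has_vector_derivative_transform_within[where d = "r - s"])
          (use \<open>s < r\<close> i r in \<open>auto simp: spliced_curve_def dist_real_def min_def max_def\<close>)
      then show ?thesis
        using False vector_derivative_within_cbox[OF \<open>t1 < t2\<close>, of r] r
        unfolding curve_velocity_def[of t1 t2 "spliced_curve d \<gamma> s v w"] by simp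
    qed
  qed
qed

lemma kinetic_spliced_curve_has_integral:
  assumes \<gamma>: "abs_continuous_curve d t1 t2 \<gamma>" and "t1 < t2" and s: "t1 \<le> s" "s \<le> t2"
    and int: "kinetic d \<beta> t1 t2 \<gamma> integrable_on {t1..s}"
  shows "(kinetic d \<beta> t1 t2 (spliced_curve d \<gamma> s v w) has_integral
    integral {t1..s} (kinetic d \<beta> t1 t2 \<gamma>) + (t2 - s) * nrm d v powr \<beta>) {t1..t2}"
proof -
  obtain N where N: "negligible N" "\<And>r i. r \<in> {t1..t2} - N \<Longrightarrow> i < d \<Longrightarrow>
      curve_velocity t1 t2 (spliced_curve d \<gamma> s v w) r i = (if r < s then curve_velocity t1 t2 \<gamma> r i else v i)"
    using spliced_curve_velocity[OF \<gamma> \<open>t1 < t2\<close>] by metis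
  have eq: "kinetic d \<beta> t1 t2 (spliced_curve d \<gamma> s v w) r =
      (if r < s then kinetic d \<beta> t1 t2 \<gamma> r else nrm d v powr \<beta>)" if "r \<in> {t1..t2} - N" for r
  proof -
    have "nrm d (curve_velocity t1 t2 (spliced_curve d \<gamma> s v w) r) =
        nrm d (if r < s then curve_velocity t1 t2 \<gamma> r else v)"
      using N(2)[OF that] by (intro L2_set_cong) auto
    then show ?thesis by (simp add: kinetic_def)
  qed
  have neg: "negligible (insert s N)" using N(1) by (simp add: negligible_insert)
  have "(kinetic d \<beta> t1 t2 (spliced_curve d \<gamma> s v w) has_integral
      integral {t1..s} (kinetic d \<beta> t1 t2 \<gamma>)) {t1..s}"
  proof (rule has_integral_spike[OF neg _ integrable_integral[OF int]])
    fix r assume "r \<in> {t1..s} - insert s N"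
    then have "r \<in> {t1..t2} - N" "r < s" using s by auto
    then show "kinetic d \<beta> t1 t2 (spliced_curve d \<gamma> s v w) r = kinetic d \<beta> t1 t2 \<gamma> r"
      using eq by simp
  qed
  moreover have "(kinetic d \<beta> t1 t2 (spliced_curve d \<gamma> s v w) has_integral
      (t2 - s) * nrm d v powr \<beta>) {s..t2}"
  proof (rule has_integral_spike[OF neg])
    show "((\<lambda>_. nrm d v powr \<beta>) has_integral (t2 - s) * nrm d v powr \<beta>) {s..t2}"
      using has_integral_const_real[of "nrm d v powr \<beta>" s t2] s by simp
    fix r assume "r \<in> {s..t2} - insert s N"
    then have "r \<in> {t1..t2} - N" "\<not> r < s" using s by auto
    then show "kinetic d \<beta> t1 t2 (spliced_curve d \<gamma> s v w) r = nrm d v powr \<beta>"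
      using eq by simp
  qed
  ultimately show ?thesis by (rule has_integral_combine[OF s])
qed

text \<open>Once both parts are finite, the extended-real definition reduces to the gauge integrals
  used from here on.\<close>

lemma action_eq:
  assumes "\<beta> > 0" and kin: "(kinetic d \<beta> t1 t2 \<gamma> has_integral I) {t1..t2}"
    and pot: "(\<lambda>r. U (\<gamma> r) r) absolutely_integrable_on {t1..t2}"
  shows "action d \<beta> U t1 t2 \<gamma> = ereal (1 / \<beta> * I - integral {t1..t2} (\<lambda>r. U (\<gamma> r) r))"
proof -
  have I0: "I \<ge> 0"
    by (rule has_integral_nonneg[OF kin]) (simp add: kinetic_def)
  have "((\<lambda>s. 1 / \<beta> * kinetic d \<beta> t1 t2 \<gamma> s) has_integral 1 / \<beta> * I) {t1..t2}"
    by (intro has_integral_mult_right kin)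
  from nn_integral_has_integral_lebesgue'[OF _ this]
  have "(\<integral>\<^sup>+s\<in>{t1..t2}. ennreal (1 / \<beta> * kinetic d \<beta> t1 t2 \<gamma> s) \<partial>lebesgue) = ennreal (1 / \<beta> * I)"
    using assms(1) by (simp add: nn_integral_completion kinetic_def)
  then show ?thesis
    using I0 assms(1) set_lebesgue_integral_eq_integral(2)[OF pot]
    unfolding action_def kinetic_def by (simp add: enn2ereal_ennreal)
qed

text \<open>The potential part is subtracted as a real number, so an action below a real bound
  forces a finite kinetic part.\<close>

lemma action_le_imp_kinetic_integrable:
  assumes "\<beta> > 0" and \<gamma>: "abs_continuous_curve d t1 t2 \<gamma>" and "t1 < t2"
    and le: "action d \<beta> U t1 t2 \<gamma> \<le> ereal M"
  shows "kinetic d \<beta> t1 t2 \<gamma> integrable_on {t1..t2}"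
proof -
  define X where "X = (\<integral>\<^sup>+s\<in>{t1..t2}. ennreal (1 / \<beta> * kinetic d \<beta> t1 t2 \<gamma> s) \<partial>lebesgue)"
  have "enn2ereal X - ereal (LINT s:{t1..t2}|lebesgue. U (\<gamma> s) s) \<le> ereal M"
    using le by (simp add: action_def X_def kinetic_def)
  then have "X < \<infinity>"
    by (cases X) auto
  let ?f = "\<lambda>s. indicator {t1..t2} s *\<^sub>R (1 / \<beta> * kinetic d \<beta> t1 t2 \<gamma> s)"
  have "integrable lebesgue ?f"
  proof (rule integrableI_bounded)
    have "(\<lambda>s. 1 / \<beta> * kinetic d \<beta> t1 t2 \<gamma> s) \<in> borel_measurable (lebesgue_on {t1..t2})"
      using kinetic_measurable[OF \<gamma> \<open>t1 < t2\<close>] by measurable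
    then show "?f \<in> borel_measurable lebesgue"
      by (subst (asm) borel_measurable_restrict_space_iff) (auto simp: mult.commute)
    have "(\<integral>\<^sup>+s. ennreal (norm (?f s)) \<partial>lebesgue) = X"
      unfolding X_def using assms(1)
      by (intro nn_integral_cong) (auto simp: indicator_def kinetic_def)
    then show "(\<integral>\<^sup>+s. ennreal (norm (?f s)) \<partial>lebesgue) < \<infinity>" using \<open>X < \<infinity>\<close> by simp
  qed
  then have "(\<lambda>s. 1 / \<beta> * kinetic d \<beta> t1 t2 \<gamma> s) absolutely_integrable_on {t1..t2}"
    by (simp add: set_integrable_def)
  then have "(\<lambda>s. 1 / \<beta> * kinetic d \<beta> t1 t2 \<gamma> s) integrable_on {t1..t2}"
    by (rule set_lebesgue_integral_eq_integral(1))
  from integrable_on_cmult_left[OF this, of \<beta>] show ?thesis using assms(1) by simp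
qed

text \<open>The gradient bound enters in the form \<open>U_Lip\<close>, which serves twice: for
  measurability along curves and for the gain at small scales.\<close>

locale minimizing_curve =
  fixes d :: nat and \<beta> C :: real and U :: "(nat \<Rightarrow> real) \<Rightarrow> real \<Rightarrow> real"
    and t1 t2 :: real and x :: "nat \<Rightarrow> real" and \<gamma> :: "real \<Rightarrow> nat \<Rightarrow> real"
  assumes \<beta>: "\<beta> > 1" and C: "C > 0"
    and U_meas: "lebesgue_measurable_potential d U"
    and U_Lip: "\<And>x y t. x \<in> Rn d \<Longrightarrow> y \<in> Rn d \<Longrightarrow> \<bar>U y t - U x t\<bar> \<le> C * nrm d (\<lambda>i. y i - x i)"
    and U_bounds: "\<And>x t. x \<in> Rn d \<Longrightarrow> 0 \<le> U x t" "\<And>x t. x \<in> Rn d \<Longrightarrow> U x t \<le> C"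
    and t12: "t1 < t2" and min: "is_minimizer d \<beta> U t1 t2 x \<gamma>"
begin

abbreviation "kin \<equiv> kinetic d \<beta> t1 t2 \<gamma>"

section \<open>Finite kinetic energy and comparison with spliced curves\<close>

lemma \<gamma>_AC: "abs_continuous_curve d t1 t2 \<gamma>" and \<gamma>_end: "\<gamma> t2 = x"
  using min by (auto simp: is_minimizer_def)

lemma AC_Rn: "abs_continuous_curve d t1 t2 \<eta> \<Longrightarrow> r \<in> {t1..t2} \<Longrightarrow> \<eta> r \<in> Rn d"
  by (auto simp: abs_continuous_curve_def)

lemma x_Rn: "x \<in> Rn d"
  using AC_Rn[OF \<gamma>_AC, of t2] t12 \<gamma>_end by simp

lemma potential_integrable:
  assumes \<eta>: "abs_continuous_curve d t1 t2 \<eta>"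
  shows "(\<lambda>r. U (\<eta> r) r) absolutely_integrable_on {t1..t2}"
proof (rule measurable_bounded_by_integrable_imp_absolutely_integrable)
  show "(\<lambda>r. U (\<eta> r) r) \<in> borel_measurable (lebesgue_on {t1..t2})"
  proof (rule measurable_potential_along_curve[OF U_meas])
    show "\<bar>U y t - U x t\<bar> \<le> C * nrm d (\<lambda>i. y i - x i)" if "x \<in> Rn d" "y \<in> Rn d" for x y t
      by (rule U_Lip[OF that])
    show "continuous_on {t1..t2} (\<lambda>s. \<eta> s i)" if "i < d" for i
      by (rule abs_cont_continuous_on[OF abs_continuous_curve_component[OF \<eta> that]])
  qed (use t12 AC_Rn[OF \<eta>] in auto)
  show "(\<lambda>_. C) integrable_on {t1..t2}" by (rule integrable_const_ivl)
  show "norm (U (\<eta> r) r) \<le> C" if "r \<in> {t1..t2}" for r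
    using U_bounds[OF AC_Rn[OF \<eta> that]] by simp
qed simp

text \<open>Integrability is assumed only up to \<open>s\<close>. For \<open>s = t1\<close> it is
  trivial, so the comparison is available before the kinetic energy of the minimizer is known to be
  finite.\<close>

lemma spliced_curve_comparison:
  assumes s: "t1 \<le> s" "s \<le> t2" and "end": "\<And>i. i < d \<Longrightarrow> \<gamma> s i + (t2 - s) * v i + w i = x i"
    and int: "kin integrable_on {t1..s}"
  shows "action d \<beta> U t1 t2 \<gamma> \<le> ereal (1 / \<beta> * (integral {t1..s} kin + (t2 - s) * nrm d v powr \<beta>)
    - integral {t1..t2} (\<lambda>r. U (spliced_curve d \<gamma> s v w r) r))"
proof -
  have AC: "abs_continuous_curve d t1 t2 (spliced_curve d \<gamma> s v w)"
    by (rule spliced_curve_abs_continuous[OF \<gamma>_AC s])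
  moreover have "spliced_curve d \<gamma> s v w t2 = x"
  proof
    show "spliced_curve d \<gamma> s v w t2 i = x i" for i
      using "end"[of i] s x_Rn by (cases "i < d") (auto simp: spliced_curve_def PiE_iff extensional_def)
  qed
  ultimately have "action d \<beta> U t1 t2 \<gamma> \<le> action d \<beta> U t1 t2 (spliced_curve d \<gamma> s v w)"
    using min unfolding is_minimizer_def by blast
  also have "\<dots> = ereal (1 / \<beta> * (integral {t1..s} kin + (t2 - s) * nrm d v powr \<beta>)
    - integral {t1..t2} (\<lambda>r. U (spliced_curve d \<gamma> s v w r) r))"
    using \<beta> by (intro action_eq kinetic_spliced_curve_has_integral[OF \<gamma>_AC t12 s int] potential_integrable[OF AC]) simp
  finally show ?thesis .
qed

text \<open>The competitor is the constant curve at \<open>x\<close>, whose action is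
  finite.\<close>

lemma kin_integrable: "kin integrable_on {t1..t2}"
proof (rule action_le_imp_kinetic_integrable[OF _ \<gamma>_AC t12])
  show "action d \<beta> U t1 t2 \<gamma> \<le> ereal (1 / \<beta> * (integral {t1..t1} kin + (t2 - t1) * nrm d (\<lambda>_. 0) powr \<beta>)
    - integral {t1..t2} (\<lambda>r. U (spliced_curve d \<gamma> t1 (\<lambda>_. 0) (\<lambda>i. x i - \<gamma> t1 i) r) r))"
  proof (rule spliced_curve_comparison)
    show "kin integrable_on {t1..t1}" using integrable_on_refl[of kin t1] by simp
  qed (use t12 in auto)
qed (use \<beta> in simp)

lemma kin_integrable': "t1 \<le> a \<Longrightarrow> b \<le> t2 \<Longrightarrow> kin integrable_on {a..b}"
  by (rule integrable_on_subinterval[OF kin_integrable]) auto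

text \<open>The kinetic energy before \<open>s\<close> is common to both curves and cancels. The
  potential difference stays over all of \<open>{t1..t2}\<close>, since \<open>w\<close> also
  translates the part before \<open>s\<close>.\<close>

lemma minimality:
  assumes s: "t1 \<le> s" "s \<le> t2" and "end": "\<And>i. i < d \<Longrightarrow> \<gamma> s i + (t2 - s) * v i + w i = x i"
  shows "integral {s..t2} kin \<le> (t2 - s) * nrm d v powr \<beta> +
    \<beta> * integral {t1..t2} (\<lambda>r. U (\<gamma> r) r - U (spliced_curve d \<gamma> s v w r) r)"
proof -
  have AC: "abs_continuous_curve d t1 t2 (spliced_curve d \<gamma> s v w)"
    by (rule spliced_curve_abs_continuous[OF \<gamma>_AC s])
  note p1 = set_lebesgue_integral_eq_integral(1)[OF potential_integrable[OF \<gamma>_AC]]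
  note p2 = set_lebesgue_integral_eq_integral(1)[OF potential_integrable[OF AC]]
  have "action d \<beta> U t1 t2 \<gamma> = ereal (1 / \<beta> * integral {t1..t2} kin - integral {t1..t2} (\<lambda>r. U (\<gamma> r) r))"
    using \<beta> by (intro action_eq integrable_integral kin_integrable potential_integrable \<gamma>_AC) simp
  then have "1 / \<beta> * integral {t1..t2} kin - integral {t1..t2} (\<lambda>r. U (\<gamma> r) r)
      \<le> 1 / \<beta> * (integral {t1..s} kin + (t2 - s) * nrm d v powr \<beta>)
        - integral {t1..t2} (\<lambda>r. U (spliced_curve d \<gamma> s v w r) r)"
    using spliced_curve_comparison[OF s "end"] kin_integrable'[OF _ s(2), of t1] by simp
  then have "\<beta> * (1 / \<beta> * integral {t1..t2} kin - integral {t1..t2} (\<lambda>r. U (\<gamma> r) r))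
      \<le> \<beta> * (1 / \<beta> * (integral {t1..s} kin + (t2 - s) * nrm d v powr \<beta>)
        - integral {t1..t2} (\<lambda>r. U (spliced_curve d \<gamma> s v w r) r))"
    using \<beta> by (intro mult_left_mono) auto
  then have "integral {t1..t2} kin \<le> integral {t1..s} kin + (t2 - s) * nrm d v powr \<beta>
      + \<beta> * (integral {t1..t2} (\<lambda>r. U (\<gamma> r) r) - integral {t1..t2} (\<lambda>r. U (spliced_curve d \<gamma> s v w r) r))"
    using \<beta> by (simp add: algebra_simps)
  moreover have "integral {t1..s} kin + integral {s..t2} kin = integral {t1..t2} kin"
    by (rule Henstock_Kurzweil_Integration.integral_combine[OF s kin_integrable])
  ultimately show ?thesis
    unfolding integral_diff[OF p1 p2] by linarith
qed

text \<open>The constant curve at \<open>x\<close> has no kinetic energy, and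
  \<open>0 \<le> U \<le> C\<close> bounds the difference of the potentials by
  \<open>C\<close>.\<close>

lemma kin_total_le: "integral {t1..t2} kin \<le> (t2 - t1) * (\<beta> * C)"
proof -
  let ?\<eta> = "spliced_curve d \<gamma> t1 (\<lambda>_. 0) (\<lambda>i. x i - \<gamma> t1 i)"
  have AC: "abs_continuous_curve d t1 t2 ?\<eta>"
    using t12 by (intro spliced_curve_abs_continuous[OF \<gamma>_AC]) auto
  note p1 = set_lebesgue_integral_eq_integral(1)[OF potential_integrable[OF \<gamma>_AC]]
  note p2 = set_lebesgue_integral_eq_integral(1)[OF potential_integrable[OF AC]]
  have "integral {t1..t2} (\<lambda>r. U (\<gamma> r) r - U (?\<eta> r) r) \<le> integral {t1..t2} (\<lambda>_. C)"
  proof (rule integral_le[OF integrable_diff[OF p1 p2] integrable_const_ivl])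
    show "U (\<gamma> r) r - U (?\<eta> r) r \<le> C" if "r \<in> {t1..t2}" for r
      using U_bounds(2)[OF AC_Rn[OF \<gamma>_AC that], of r] U_bounds(1)[OF AC_Rn[OF AC that], of r] by linarith
  qed
  then have "integral {t1..t2} (\<lambda>r. U (\<gamma> r) r - U (?\<eta> r) r) \<le> (t2 - t1) * C" using t12 by simp
  then have "\<beta> * integral {t1..t2} (\<lambda>r. U (\<gamma> r) r - U (?\<eta> r) r) \<le> \<beta> * ((t2 - t1) * C)"
    using \<beta> by (intro mult_left_mono) auto
  moreover have "integral {t1..t2} kin \<le> (t2 - t1) * nrm d (\<lambda>_. 0) powr \<beta> +
      \<beta> * integral {t1..t2} (\<lambda>r. U (\<gamma> r) r - U (?\<eta> r) r)"
    using t12 by (intro minimality) auto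
  ultimately show ?thesis by (simp add: L2_set_def algebra_simps)
qed

section \<open>Mean velocities over final intervals, and the corresponding chords\<close>

definition avg :: "real \<Rightarrow> nat \<Rightarrow> real" where
  "avg \<tau> i = (\<gamma> t2 i - \<gamma> (t2 - \<tau>) i) / \<tau>"

definition chord :: "real \<Rightarrow> real \<Rightarrow> nat \<Rightarrow> real" where
  "chord \<tau> = spliced_curve d \<gamma> (t2 - \<tau>) (avg \<tau>) (\<lambda>_. 0)"

text \<open>The chord coincides with \<open>\<gamma>\<close> up to \<open>t2 - \<tau>\<close>, so
  only the last stretch, of length \<open>\<tau>\<close>, contributes to the potential
  difference.\<close>

lemma kin_tail_le:
  assumes \<tau>: "0 < \<tau>" "\<tau> \<le> t2 - t1"
    and M: "\<And>r. r \<in> {t2 - \<tau>..t2} \<Longrightarrow> U (\<gamma> r) r - U (chord \<tau> r) r \<le> M"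
  shows "integral {t2 - \<tau>..t2} kin \<le> \<tau> * nrm d (avg \<tau>) powr \<beta> + \<beta> * (\<tau> * M)"
proof -
  define s where "s = t2 - \<tau>"
  have s: "t1 \<le> s" "s \<le> t2" using \<tau> by (auto simp: s_def)
  have AC: "abs_continuous_curve d t1 t2 (chord \<tau>)"
    unfolding chord_def by (rule spliced_curve_abs_continuous[OF \<gamma>_AC s[unfolded s_def]])
  note p1 = set_lebesgue_integral_eq_integral(1)[OF potential_integrable[OF \<gamma>_AC]]
  note p2 = set_lebesgue_integral_eq_integral(1)[OF potential_integrable[OF AC]]
  note p = integrable_diff[OF p1 p2]
  have "integral {t1..s} (\<lambda>r. U (\<gamma> r) r - U (chord \<tau> r) r) = 0"
  proof -
    have "chord \<tau> r = \<gamma> r" if "r \<in> {t1..s}" for r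
    proof
      have "\<gamma> r \<in> Rn d" using that s by (intro AC_Rn[OF \<gamma>_AC]) auto
      then show "chord \<tau> r i = \<gamma> r i" for i
        using that by (cases "i < d") (auto simp: chord_def spliced_curve_def s_def PiE_iff extensional_def)
    qed
    then have "integral {t1..s} (\<lambda>r. U (\<gamma> r) r - U (chord \<tau> r) r) = integral {t1..s} (\<lambda>_. 0)"
      by (intro integral_cong) simp
    then show ?thesis by simp
  qed
  moreover have "integral {s..t2} (\<lambda>r. U (\<gamma> r) r - U (chord \<tau> r) r) \<le> integral {s..t2} (\<lambda>_. M)"
  proof (rule integral_le[OF integrable_on_subinterval[OF p] integrable_const_ivl])
    show "{s..t2} \<subseteq> {t1..t2}" using s by auto
  qed (use M in \<open>simp add: s_def\<close>)
  moreover have "integral {t1..s} (\<lambda>r. U (\<gamma> r) r - U (chord \<tau> r) r) +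
      integral {s..t2} (\<lambda>r. U (\<gamma> r) r - U (chord \<tau> r) r) = integral {t1..t2} (\<lambda>r. U (\<gamma> r) r - U (chord \<tau> r) r)"
    by (rule Henstock_Kurzweil_Integration.integral_combine[OF s p])
  ultimately have "integral {t1..t2} (\<lambda>r. U (\<gamma> r) r - U (chord \<tau> r) r) \<le> \<tau> * M"
    using s by (simp add: s_def)
  then have "\<beta> * integral {t1..t2} (\<lambda>r. U (\<gamma> r) r - U (chord \<tau> r) r) \<le> \<beta> * (\<tau> * M)"
    using \<beta> by (intro mult_left_mono) auto
  moreover have "integral {s..t2} kin \<le> (t2 - s) * nrm d (avg \<tau>) powr \<beta> +
      \<beta> * integral {t1..t2} (\<lambda>r. U (\<gamma> r) r - U (chord \<tau> r) r)"
    unfolding chord_def s_def using \<tau> \<gamma>_end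
    by (intro minimality) (auto simp: avg_def)
  ultimately show ?thesis by (simp add: s_def)
qed

lemma Jensen:
  assumes "t1 \<le> a" "a < b" "b \<le> t2"
  shows "(b - a) * nrm d (\<lambda>i. (\<gamma> b i - \<gamma> a i) / (b - a)) powr \<beta> \<le> integral {a..b} kin"
  using assms by (intro kinetic_has_integral_ge[OF \<beta> \<gamma>_AC t12] kin_integrable') auto

lemma AC_chord: "0 < \<tau> \<Longrightarrow> \<tau> \<le> t2 - t1 \<Longrightarrow> abs_continuous_curve d t1 t2 (chord \<tau>)"
  unfolding chord_def by (rule spliced_curve_abs_continuous[OF \<gamma>_AC]) auto

lemma potential_gap_le:
  assumes \<tau>: "0 < \<tau>" "\<tau> \<le> t2 - t1" and r: "r \<in> {t2 - \<tau>..t2}"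
  shows "U (\<gamma> r) r - U (chord \<tau> r) r \<le> C"
proof -
  have "r \<in> {t1..t2}" using assms by auto
  then show ?thesis
    using U_bounds(2)[OF AC_Rn[OF \<gamma>_AC], of r r] U_bounds(1)[OF AC_Rn[OF AC_chord[OF \<tau>]], of r r] by linarith
qed

text \<open>At time \<open>t2 - \<tau>\<close> both curves are at the same point, and afterwards
  each moves at most \<open>\<tau> * R\<close> away from it: \<open>\<gamma>\<close> by Jensen's
  inequality and the bound \<open>\<tau> * P\<close> on the tail energy, the chord because its speed
  is at most \<open>R\<close>.\<close>

lemma distance_to_chord_le:
  assumes \<tau>: "0 < \<tau>" "\<tau> \<le> t2 - t1" and r: "r \<in> {t2 - \<tau>..t2}"
  shows "nrm d (\<lambda>i. \<gamma> r i - chord \<tau> r i) \<le> 2 * \<tau> * (nrm d (avg \<tau>) powr \<beta> + \<beta> * C) powr (1 / \<beta>)"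
proof -
  define s where "s = t2 - \<tau>"
  define P where "P = nrm d (avg \<tau>) powr \<beta> + \<beta> * C"
  define R where "R = P powr (1 / \<beta>)"
  have P: "P > 0" using \<beta> C unfolding P_def by (intro add_nonneg_pos) auto
  have PR: "R powr \<beta> = P" using \<beta> P by (simp add: R_def powr_powr)
  have R0: "R \<ge> 0" by (simp add: R_def)
  have s: "t1 \<le> s" "s \<le> r" "r \<le> t2" using \<tau> r by (auto simp: s_def)
  have "nrm d (avg \<tau>) powr \<beta> \<le> R powr \<beta>" using \<beta> C by (simp add: PR P_def)
  then have aR: "nrm d (avg \<tau>) \<le> R"
    using powr_mono2[of "1 / \<beta>" "nrm d (avg \<tau>) powr \<beta>" P] \<beta> unfolding PR by (simp add: R_def powr_powr)
  have total: "integral {s..t2} kin \<le> \<tau> * P"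
    using kin_tail_le[OF \<tau> potential_gap_le[OF \<tau>]] by (simp add: s_def P_def algebra_simps)
  have 1: "nrm d (\<lambda>i. \<gamma> r i - \<gamma> s i) \<le> \<tau> * R"
  proof (cases "r = s")
    case True
    then show ?thesis using \<tau> R0 by (simp add: L2_set_def)
  next
    case False
    define h where "h = r - s"
    have h: "0 < h" "h \<le> \<tau>" using False s by (auto simp: h_def s_def)
    define n where "n = nrm d (\<lambda>i. \<gamma> r i - \<gamma> s i)"
    have n0: "n \<ge> 0" by (simp add: n_def)
    have "nrm d (\<lambda>i. (\<gamma> r i - \<gamma> s i) / h) = n / h"
      using nrm_scale[where d = d and k = "1 / h" and v = "\<lambda>i. \<gamma> r i - \<gamma> s i"] h by (simp add: n_def)
    moreover have "h * nrm d (\<lambda>i. (\<gamma> r i - \<gamma> s i) / h) powr \<beta> \<le> integral {s..r} kin"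
      unfolding h_def using s False by (intro Jensen) auto
    moreover have "integral {s..r} kin \<le> integral {s..t2} kin"
      using s by (intro integral_subset_le kin_integrable') (auto simp: kinetic_def)
    ultimately have "h * (n / h) powr \<beta> \<le> \<tau> * P" using total by simp
    have "n powr \<beta> \<le> (\<tau> * R) powr \<beta>"
    proof -
      \<comment> \<open>For a given energy bound the worst case is \<open>h = \<tau>\<close>,
        because \<beta> > 1 makes \<open>h powr (\<beta> - 1)\<close> increase with
        \<open>h\<close>.\<close>
      have "n powr \<beta> = h powr (\<beta> - 1) * (h * (n / h) powr \<beta>)"
        using h n0 by (simp add: powr_divide powr_diff)
      also have "\<dots> \<le> \<tau> powr (\<beta> - 1) * (\<tau> * P)"
      proof (rule mult_mono)
        show "h powr (\<beta> - 1) \<le> \<tau> powr (\<beta> - 1)" using h \<beta> by (intro powr_mono2) auto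
        show "h * (n / h) powr \<beta> \<le> \<tau> * P" by fact
      qed (use h in auto)
      also have "\<dots> = (\<tau> * R) powr \<beta>"
        using \<tau> R0 by (simp add: powr_mult PR powr_diff)
      finally show ?thesis .
    qed
    then show ?thesis
      using powr_mono2[of "1 / \<beta>" "n powr \<beta>" "(\<tau> * R) powr \<beta>"] \<beta> \<tau> R0 n0
      by (simp add: powr_powr n_def)
  qed
  have 2: "nrm d (\<lambda>i. \<gamma> s i - chord \<tau> r i) \<le> \<tau> * R"
  proof -
    have "nrm d (\<lambda>i. \<gamma> s i - chord \<tau> r i) = nrm d (\<lambda>i. - (r - s) * avg \<tau> i)"
      by (rule L2_set_cong) (use s in \<open>auto simp: chord_def spliced_curve_def s_def min_def max_def algebra_simps\<close>)
    also have "\<dots> = \<bar>- (r - s)\<bar> * nrm d (avg \<tau>)" by (rule nrm_scale)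
    also have "\<dots> \<le> \<tau> * R"
      using s aR \<tau> by (intro mult_mono) (auto simp: s_def)
    finally show ?thesis .
  qed
  show ?thesis
    using nrm_triangle[where d = d and v = "\<gamma> r" and w = "chord \<tau> r" and u = "\<gamma> s"] 1 2 unfolding R_def P_def by linarith
qed

text \<open>\<open>c\<close> is the mean of \<open>a\<close> and \<open>b\<close> with weights
  \<open>s\<close> and \<open>\<tau> - s\<close>, so the linear terms of the two convexity
  inequalities cancel, and what exceeds the energy of the chord is the defect. The quadratic gain is
  kept for \<open>a\<close> only; its weight \<open>s\<close> is at least \<open>\<tau> / 2\<close>,
  so the lengths cancel at the price of a factor 2.\<close>

lemma Vmap_avg_step:
  assumes \<tau>: "0 < s" "s < \<tau>" "\<tau> \<le> t2 - t1" "\<tau> \<le> 2 * s"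
    and M: "\<And>r. r \<in> {t2 - \<tau>..t2} \<Longrightarrow> U (\<gamma> r) r - U (chord \<tau> r) r \<le> M"
  shows "min 1 (\<beta> - 1) * (nrm d (\<lambda>i. Vmap d \<beta> (avg s) i - Vmap d \<beta> (avg \<tau>) i))\<^sup>2 \<le> 4 * \<beta> * M"
proof -
  define c where "c = avg \<tau>"
  define a where "a = avg s"
  define b where "b i = (\<gamma> (t2 - s) i - \<gamma> (t2 - \<tau>) i) / (\<tau> - s)" for i
  define k where "k = \<beta> * nrm d c powr (\<beta> - 2)"
  define D where "D = min 1 (\<beta> - 1) / 2 * (nrm d (\<lambda>i. Vmap d \<beta> a i - Vmap d \<beta> c i))\<^sup>2"
  have mean: "s * (a i - c i) + (\<tau> - s) * (b i - c i) = 0" for i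
    using \<tau> by (simp add: a_def b_def c_def avg_def field_simps)
  have "s * (k * (\<Sum>i<d. c i * (a i - c i))) + (\<tau> - s) * (k * (\<Sum>i<d. c i * (b i - c i)))
      = k * (\<Sum>i<d. c i * (s * (a i - c i) + (\<tau> - s) * (b i - c i)))"
    unfolding sum_distrib_left sum.distrib[symmetric] by (intro sum.cong refl) (simp add: algebra_simps)
  then have lin: "s * (k * (\<Sum>i<d. c i * (a i - c i))) + (\<tau> - s) * (k * (\<Sum>i<d. c i * (b i - c i))) = 0"
    unfolding mean by simp
  have A: "s * (nrm d c powr \<beta> + k * (\<Sum>i<d. c i * (a i - c i)) + D) \<le> s * nrm d a powr \<beta>"
    using powr_Bregman[OF \<beta>, where d = d and a = a and c = c] \<tau>
    unfolding k_def D_def by (intro mult_left_mono) auto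
  have B: "(\<tau> - s) * (nrm d c powr \<beta> + k * (\<Sum>i<d. c i * (b i - c i))) \<le> (\<tau> - s) * nrm d b powr \<beta>"
    using powr_convex_tangent[OF \<beta>, where d = d and a = b and c = c] \<tau>
    unfolding k_def by (intro mult_left_mono) auto
  have "s * nrm d a powr \<beta> \<le> integral {t2 - s..t2} kin"
    using Jensen[of "t2 - s" t2] \<tau> by (simp add: a_def avg_def[abs_def])
  moreover have "(\<tau> - s) * nrm d b powr \<beta> \<le> integral {t2 - \<tau>..t2 - s} kin"
    using Jensen[of "t2 - \<tau>" "t2 - s"] \<tau> by (simp add: b_def[abs_def])
  moreover have "integral {t2 - \<tau>..t2 - s} kin + integral {t2 - s..t2} kin = integral {t2 - \<tau>..t2} kin"
    using \<tau> by (intro Henstock_Kurzweil_Integration.integral_combine kin_integrable') auto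
  moreover have "integral {t2 - \<tau>..t2} kin \<le> \<tau> * nrm d c powr \<beta> + \<beta> * (\<tau> * M)"
    unfolding c_def using \<tau> by (intro kin_tail_le M) auto
  ultimately have "s * D \<le> \<beta> * (\<tau> * M)"
    using A B lin by (simp add: algebra_simps)
  moreover have "D \<ge> 0" unfolding D_def using \<beta> by (intro mult_nonneg_nonneg) auto
  then have "\<tau> * D \<le> 2 * s * D" using \<tau> by (intro mult_right_mono)
  ultimately have "\<tau> * D \<le> \<tau> * (2 * \<beta> * M)" by (simp add: algebra_simps)
  then have "D \<le> 2 * \<beta> * M" using \<tau> by simp
  then show ?thesis unfolding D_def a_def c_def by simp
qed

text \<open>Jensen's inequality on the whole interval against \<open>kin_total_le\<close>, using
  |V(v)|^2 = |v|^\<beta>.\<close>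

lemma Vmap_avg_top: "nrm d (Vmap d \<beta> (avg (t2 - t1))) \<le> sqrt (\<beta> * C)"
proof -
  have "(t2 - t1) * nrm d (avg (t2 - t1)) powr \<beta> \<le> (t2 - t1) * (\<beta> * C)"
    using order_trans[OF Jensen[of t1 t2] kin_total_le] t12 unfolding avg_def[abs_def] by simp
  then have "nrm d (avg (t2 - t1)) powr \<beta> \<le> \<beta> * C" using t12 by simp
  moreover have "(nrm d (avg (t2 - t1)) powr (\<beta> / 2))\<^sup>2 = nrm d (avg (t2 - t1)) powr \<beta>"
    by (simp add: power2_eq_square flip: powr_add)
  ultimately show ?thesis
    using \<beta> by (simp add: nrm_Vmap real_le_rsqrt)
qed

lemma Vmap_avg_step1:
  assumes \<tau>: "0 < s" "s < \<tau>" "\<tau> \<le> t2 - t1" "\<tau> \<le> 2 * s"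
  shows "nrm d (\<lambda>i. Vmap d \<beta> (avg s) i - Vmap d \<beta> (avg \<tau>) i) \<le> sqrt (4 * \<beta> * C / min 1 (\<beta> - 1))"
proof (rule real_le_rsqrt)
  have "min 1 (\<beta> - 1) * (nrm d (\<lambda>i. Vmap d \<beta> (avg s) i - Vmap d \<beta> (avg \<tau>) i))\<^sup>2 \<le> 4 * \<beta> * C"
    using \<tau> by (intro Vmap_avg_step potential_gap_le) auto
  then show "(nrm d (\<lambda>i. Vmap d \<beta> (avg s) i - Vmap d \<beta> (avg \<tau>) i))\<^sup>2 \<le> 4 * \<beta> * C / min 1 (\<beta> - 1)"
    using \<beta> by (simp add: field_simps)
qed

text \<open>The Lipschitz bound times the distance to the chord gives a potential gap proportional
  to \<open>\<tau>\<close>. The constant 8 is the 4 of \<open>Vmap_avg_step\<close> times the 2 of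
  \<open>distance_to_chord_le\<close>.\<close>

lemma Vmap_avg_step2:
  assumes \<tau>: "0 < s" "s < \<tau>" "\<tau> \<le> t2 - t1" "\<tau> \<le> 2 * s"
  shows "nrm d (\<lambda>i. Vmap d \<beta> (avg s) i - Vmap d \<beta> (avg \<tau>) i)
    \<le> sqrt (8 * \<beta> * C * (1 + \<beta> * C) / min 1 (\<beta> - 1)) * sqrt \<tau> * (1 + nrm d (Vmap d \<beta> (avg \<tau>)))"
proof -
  define w where "w = nrm d (Vmap d \<beta> (avg \<tau>))"
  define P where "P = nrm d (avg \<tau>) powr \<beta> + \<beta> * C"
  define Q where "Q = 8 * \<beta> * C * (1 + \<beta> * C) / min 1 (\<beta> - 1)"
  have w0: "w \<ge> 0" by (simp add: w_def)
  have bC: "\<beta> * C > 0" using \<beta> C by simp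
  have Pw: "P = w\<^sup>2 + \<beta> * C"
    using \<beta> by (simp add: P_def w_def nrm_Vmap power2_eq_square flip: powr_add)
  have P0: "P > 0" unfolding Pw using bC by (intro add_nonneg_pos) auto
  \<comment> \<open>Giving up the power 1/\<beta> for a quadratic in \<open>w\<close> is affordable:
    after the square root the bound is linear in \<open>w\<close>, as the Gronwall estimate
    requires.\<close>
  have "P powr (1 / \<beta>) \<le> (1 + P) powr (1 / \<beta>)" using P0 \<beta> by (intro powr_mono2) auto
  also have "\<dots> \<le> (1 + P) powr 1" using P0 \<beta> by (intro powr_mono) auto
  also have "\<dots> = 1 + P" using P0 by simp
  also have "\<dots> \<le> (1 + \<beta> * C) * (1 + w)\<^sup>2"
  proof -
    have "(1 + \<beta> * C) * (1 + w)\<^sup>2 - (1 + P) = 2 * w + \<beta> * C * (2 * w + w\<^sup>2)"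
      unfolding Pw by (simp add: power2_sum algebra_simps)
    also have "\<dots> \<ge> 0" using w0 bC by simp
    finally show ?thesis by linarith
  qed
  finally have R: "P powr (1 / \<beta>) \<le> (1 + \<beta> * C) * (1 + w)\<^sup>2" .
  have gap: "U (\<gamma> r) r - U (chord \<tau> r) r \<le> C * (2 * \<tau> * ((1 + \<beta> * C) * (1 + w)\<^sup>2))"
    if r: "r \<in> {t2 - \<tau>..t2}" for r
  proof -
    have "r \<in> {t1..t2}" using r \<tau> by auto
    then have "U (\<gamma> r) r - U (chord \<tau> r) r \<le> C * nrm d (\<lambda>i. \<gamma> r i - chord \<tau> r i)"
      using U_Lip[OF AC_Rn[OF AC_chord] AC_Rn[OF \<gamma>_AC], of \<tau> r r r] \<tau> by fastforce
    also have "\<dots> \<le> C * (2 * \<tau> * P powr (1 / \<beta>))"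
      unfolding P_def using C \<tau> r by (intro mult_left_mono distance_to_chord_le) auto
    also have "\<dots> \<le> C * (2 * \<tau> * ((1 + \<beta> * C) * (1 + w)\<^sup>2))"
      using C \<tau> R by (intro mult_left_mono) auto
    finally show ?thesis .
  qed
  have "min 1 (\<beta> - 1) * (nrm d (\<lambda>i. Vmap d \<beta> (avg s) i - Vmap d \<beta> (avg \<tau>) i))\<^sup>2
      \<le> 4 * \<beta> * (C * (2 * \<tau> * ((1 + \<beta> * C) * (1 + w)\<^sup>2)))"
    by (rule Vmap_avg_step[OF \<tau> gap])
  then have "(nrm d (\<lambda>i. Vmap d \<beta> (avg s) i - Vmap d \<beta> (avg \<tau>) i))\<^sup>2 \<le> Q * \<tau> * (1 + w)\<^sup>2"
    using \<beta> by (simp add: Q_def field_simps)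
  then have "nrm d (\<lambda>i. Vmap d \<beta> (avg s) i - Vmap d \<beta> (avg \<tau>) i) \<le> sqrt (Q * \<tau> * (1 + w)\<^sup>2)"
    by (rule real_le_rsqrt)
  also have "\<dots> = sqrt Q * sqrt \<tau> * (1 + w)" using w0 by (simp add: real_sqrt_mult)
  finally show ?thesis unfolding Q_def w_def .
qed

text \<open>\<open>avg (t2 - y)\<close> is the difference quotient of \<open>\<gamma>\<close>
  between \<open>y\<close> and \<open>t2\<close>, so inverting V in the limit gives the one-sided
  derivative, and its norm from |V(v)| = |v|^(\<beta>/2).\<close>

lemma velocity_at_end:
  assumes lim: "\<And>i. i < d \<Longrightarrow> ((\<lambda>\<tau>. Vmap d \<beta> (avg \<tau>) i) \<longlongrightarrow> W0 i) (at_right 0)"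
  shows "\<And>i. i < d \<Longrightarrow> (\<lambda>s. \<gamma> s i) differentiable (at t2 within {t1..t2})"
    and "nrm d (curve_velocity t1 t2 \<gamma> t2) = nrm d W0 powr (2 / \<beta>)"
proof -
  define l where "l i = nrm d W0 powr (2 / \<beta> - 1) * W0 i" for i
  have fl: "filterlim (\<lambda>y. t2 - y) (at_right 0) (at t2 within {t1..t2})"
    unfolding filterlim_at
  proof (intro conjI)
    show "\<forall>\<^sub>F y in at t2 within {t1..t2}. t2 - y \<in> {0<..} \<and> t2 - y \<noteq> 0"
      unfolding eventually_at_filter by (intro always_eventually allI impI) auto
    show "((\<lambda>y. t2 - y) \<longlongrightarrow> 0) (at t2 within {t1..t2})"
      by (auto intro!: tendsto_eq_intros)
  qed
  have der: "((\<lambda>s. \<gamma> s i) has_vector_derivative l i) (at t2 within {t1..t2})" if i: "i < d" for i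
  proof -
    have "((\<lambda>\<tau>. avg \<tau> i) \<longlongrightarrow> l i) (at_right 0)"
      unfolding l_def using \<beta> by (intro tendsto_Vmap_inverse[OF _ i lim]) auto
    from filterlim_compose[OF this fl]
    have "((\<lambda>y. avg (t2 - y) i) \<longlongrightarrow> l i) (at t2 within {t1..t2})" .
    moreover have "avg (t2 - y) i = (\<gamma> y i - \<gamma> t2 i) / (y - t2)" for y
      by (simp add: avg_def) (metis minus_diff_eq minus_divide_divide)
    ultimately show ?thesis
      unfolding has_real_derivative_iff_has_vector_derivative[symmetric] has_field_derivative_iff by simp
  qed
  then show "(\<lambda>s. \<gamma> s i) differentiable (at t2 within {t1..t2})" if "i < d" for i
    using that by (auto simp: has_vector_derivative_def differentiable_def)
  have "curve_velocity t1 t2 \<gamma> t2 i = l i" if "i < d" for i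
    unfolding curve_velocity_def using vector_derivative_within_cbox[OF t12, of t2] der[OF that] t12 by simp
  then have "nrm d (curve_velocity t1 t2 \<gamma> t2) = nrm d l" by (intro L2_set_cong) auto
  also have "\<dots> = nrm d W0 powr (2 / \<beta> - 1) * nrm d W0"
    unfolding l_def[abs_def] nrm_scale by simp
  also have "\<dots> = nrm d W0 powr (2 / \<beta>)"
    by (cases "nrm d W0 = 0") (simp_all add: powr_diff)
  finally show "nrm d (curve_velocity t1 t2 \<gamma> t2) = nrm d W0 powr (2 / \<beta>)" .
qed

end

text \<open>Differentiability at \<open>t2\<close> is part of the conclusion because
  \<open>curve_velocity\<close> would otherwise be an unspecified value there, and its bound would
  say nothing about the curve.\<close>

theorem theorem1:
  fixes \<beta> C :: real
  assumes "\<beta> > 1" and "C > 0"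
  shows "\<exists>K1>0. \<exists>T0>0. \<forall>d\<ge>(1::nat).
    \<forall>(U :: (nat \<Rightarrow> real) \<Rightarrow> real \<Rightarrow> real) (DU :: real \<Rightarrow> (nat \<Rightarrow> real) \<Rightarrow> nat \<Rightarrow> real).
      lebesgue_measurable_potential d U \<longrightarrow>
      (\<forall>t. C1_with_gradient d (\<lambda>x. U x t) (DU t)) \<longrightarrow>
      (\<forall>x\<in>Rn d. \<forall>t. 0 \<le> U x t \<and> U x t \<le> C) \<longrightarrow>
      (\<forall>x\<in>Rn d. \<forall>t. L2_set (DU t x) {..<d} \<le> C) \<longrightarrow>
      (\<forall>t1 t2 x \<gamma>. t2 - t1 \<ge> T0 \<longrightarrow> x \<in> Rn d \<longrightarrow> is_minimizer d \<beta> U t1 t2 x \<gamma> \<longrightarrow>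
        (\<forall>i<d. (\<lambda>s. \<gamma> s i) differentiable (at t2 within {t1..t2})) \<and>
        L2_set (curve_velocity t1 t2 \<gamma> t2) {..<d} \<le> K1 * ln (t2 - t1) powr (2 / \<beta>))"
proof -
  define A0 where "A0 = sqrt (\<beta> * C)"
  define A1 where "A1 = sqrt (4 * \<beta> * C / min 1 (\<beta> - 1))"
  define A2 where "A2 = sqrt (8 * \<beta> * C * (1 + \<beta> * C) / min 1 (\<beta> - 1))"
  define K where "K = (1 + A0 + 2 * A1) / ln 2 * exp (A2 / (1 - sqrt (1 / 2)))"
  have A: "A0 \<ge> 0" "A1 \<ge> 0" "A2 \<ge> 0"
    using assms by (auto simp: A0_def A1_def A2_def)
  have K: "K > 0"
    using A by (auto simp: K_def intro!: mult_pos_pos divide_pos_pos)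
  show ?thesis
  \<comment> \<open>\<open>K * ln T\<close> bounds the limit of V, which is then raised to the power
    2/\<beta>. The choice 2 for \<open>T0\<close> makes \<open>log 2 T\<close> at least 1, as
    \<open>dyadic_convergence\<close> requires.\<close>
  proof (rule exI[of _ "K powr (2 / \<beta>)"], rule conjI[OF _ exI[of _ 2]], goal_cases)
    case 1
    show ?case using K by simp
  next
    case 2
    show ?case
    proof (intro conjI allI impI)
      fix d :: nat and U :: "(nat \<Rightarrow> real) \<Rightarrow> real \<Rightarrow> real" and DU :: "real \<Rightarrow> (nat \<Rightarrow> real) \<Rightarrow> nat \<Rightarrow> real"
        and t1 t2 :: real and x and \<gamma> :: "real \<Rightarrow> nat \<Rightarrow> real"
      assume meas: "lebesgue_measurable_potential d U"
        and C1: "\<forall>t. C1_with_gradient d (\<lambda>x. U x t) (DU t)"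
        and U: "\<forall>x\<in>Rn d. \<forall>t. 0 \<le> U x t \<and> U x t \<le> C"
        and DU: "\<forall>x\<in>Rn d. \<forall>t. L2_set (DU t x) {..<d} \<le> C"
        and T: "2 \<le> t2 - t1" and x: "x \<in> Rn d" and min: "is_minimizer d \<beta> U t1 t2 x \<gamma>"
      interpret minimizing_curve d \<beta> C U t1 t2 x \<gamma>
      proof
        show "\<bar>U y t - U x t\<bar> \<le> C * nrm d (\<lambda>i. y i - x i)" if "x \<in> Rn d" "y \<in> Rn d" for x y t
          using C1 DU that by (intro C1_with_gradient_Lipschitz[of d "\<lambda>x. U x t" "DU t"]) auto
      qed (use assms meas U T min in auto)
      obtain W0 where W0: "\<And>i. i < d \<Longrightarrow> ((\<lambda>\<tau>. Vmap d \<beta> (avg \<tau>) i) \<longlongrightarrow> W0 i) (at_right 0)"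
        and W0_le: "nrm d W0 \<le> K * ln (t2 - t1)"
        unfolding K_def
      proof (rule dyadic_convergence[OF T A, where W = "\<lambda>\<tau>. Vmap d \<beta> (avg \<tau>)"])
        show "nrm d (Vmap d \<beta> (avg (t2 - t1))) \<le> A0"
          unfolding A0_def by (rule Vmap_avg_top)
      qed (use Vmap_avg_step1 Vmap_avg_step2 in \<open>auto simp: A1_def A2_def\<close>)
      show "(\<lambda>s. \<gamma> s i) differentiable (at t2 within {t1..t2})" if "i < d" for i
        by (rule velocity_at_end(1)[OF W0 that])
      have "nrm d W0 powr (2 / \<beta>) \<le> (K * ln (t2 - t1)) powr (2 / \<beta>)"
        using assms W0_le by (intro powr_mono2) auto
      then show "L2_set (curve_velocity t1 t2 \<gamma> t2) {..<d} \<le> K powr (2 / \<beta>) * ln (t2 - t1) powr (2 / \<beta>)"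
        using K T by (simp add: velocity_at_end(2)[OF W0] powr_mult)
    qed simp
  qed
qed

end
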